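(* Let $(E):0\to\mathscr B\to\mathscr E\to\mathscr A\to 0$ be an extension of algebras with a lifting $0\to\mathscr R\to\mathscr M\to\mathscr P\to 0$, and let $n\ge 1$. Let $\sigma:\mathscr A\to\mathscr M$ be a linear splitting of the projection homomorphism $\mathscr M\to\mathscr A$, with induced chain map $\sigma_*:X(\widehat T\mathscr A)\to X(\widetilde{\mathscr M})$. The map sending a cocycle $\tau$ over $F^n_{\mathscr R}X(\widehat{\mathscr M})$ to the cocycle $\tau_R\partial\circ\sigma_*$ over $X(\widehat T\mathscr A)$, for an arbitrary choice of renormalization $\tau_R$ of $\tau$, descends to a morphism in cohomology $$E^n:\ H^i\big(F^n_{\mathscr R}X(\widehat{\mathscr M})\big)\to HP^{i+1}(\mathscr A),\qquad i\in\mathbb Z_2 .$$ This morphism depends neither on the choice of renormalization nor on the linear splitting $\sigma$. If the exact sequence $(E)$ is split by an algebra homomorphism $\mathscr A\to\mathscr E$, then $E^n$ vanishes. Finally, $E^{n+1}$ composed with the natural pullback (restriction) $H^*\big(F^n_{\mathscr R}X(\widehat{\mathscr M})\big)\to H^*\big(F^{n+1}_{\mathscr R}X(\widehat{\mathscr M})\big)$ coincides with $E^n$.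
   Context: Algebras are associative over $\mathbb C$, not necessarily unital; $\mathscr R^+=\mathscr R\oplus\mathbb C$ is the unitalization. An extension is a short exact sequence of algebras. $X$-complex: for an algebra $\mathscr R$, $\Omega^1\mathscr R$ is the bimodule of universal (noncommutative) one-forms with differential $\mathbf d$, $\Omega^1\mathscr R_\natural=\Omega^1\mathscr R/[\mathscr R,\Omega^1\mathscr R]$, and $\natural x_0\mathbf dx_1$ is the class of $x_0\mathbf dx_1$. $X(\mathscr R)$ is the $\mathbb Z_2$-graded complex with even part $\mathscr R$, odd part $\Omega^1\mathscr R_\natural$, and boundary $\partial=\natural\mathbf d\oplus\overline b$, where $\natural\mathbf d(x)=\natural\mathbf dx$ and $\overline b(\natural x_0\mathbf dx_1)=[x_0,x_1]$. For a two-sided ideal $\mathscr J\subset\mathscr R$, $X(\mathscr R)$ has a decreasing filtration by subcomplexes (even part; odd part) $F^{2n}_{\mathscr J}X(\mathscr R):\ \mathscr J^{n+1}+[\mathscr J^n,\mathscr R]\ ;\ \natural\mathscr J^n_{(+)}\mathbf d\mathscr R$, and $F^{2n+1}_{\mathscr J}X(\mathscr R):\ \mathscr J^{n+1}\ ;\ \natural(\mathscr J^{n+1}_{(+)}\mathbf d\mathscr R+\mathscr J^n_{(+)}\mathbf d\mathscr J)$, where $\mathscr J^n_{(+)}=\mathscr J^n$ for $n>0$ and $\mathscr R^+$ for $n\le0$ (and $\mathscr J^0=\mathscr R$). Completions: $\widehat{\mathscr R}=\varprojlim_n\mathscr R/\mathscr J^n$ and $X(\widehat{\mathscr R})=\varprojlim_nX(\mathscr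 R)/F^n_{\mathscr J}X(\mathscr R)$, viewed as pro-objects; a linear map $X(\widehat{\mathscr R})\to\mathbb C$ means a linear map on $X(\mathscr R)$ vanishing on $F^k_{\mathscr J}X(\mathscr R)$ for some $k\gg0$. Periodic cyclic cohomology: $T\mathscr A=\mathscr A\oplus\mathscr A^{\otimes2}\oplus\cdots$ is the non-unital tensor algebra, $J\mathscr A$ the kernel of the multiplication map $T\mathscr A\to\mathscr A$, $\widehat T\mathscr A$ the $J\mathscr A$-adic completion, and $HP^*(\mathscr A)=H^*(X(\widehat T\mathscr A))$. Lifting: $0\to\mathscr R\to\mathscr M\to\mathscr P\to0$ is a lifting of $(E)$ if there is a commutative diagram with exact rows $0\to\mathscr J\to\mathscr N\to\mathscr Q\to0$, $0\to\mathscr R\to\mathscr M\to\mathscr P\to0$, $0\to\mathscr B\to\mathscr E\to\mathscr A\to0$ and exact columns $0\to\mathscr J\to\mathscr R\to\mathscr B\to0$, $0\to\mathscr N\to\mathscr M\to\mathscr E\to0$, $0\to\mathscr Q\to\mathscr P\to\mathscr A\to0$, all rows and columns being extensions of algebras. Then $\mathscr R,\mathscr N$ are ideals of $\mathscr M$ and $\mathscr R+\mathscr N=\ker(\mathscr M\to\mathscr A)$. Hats on $\mathscr M$ denote $\mathscr N$-adic completions: $\widehat{\mathscr M}=\varprojlim_n\mathscr M/\mathscr N^n$, $X(\widehat{\mathscr M})=\varprojlim_nX(\mathscr M)/F^n_{\mathscr N}X(\mathscr M)$, and $F^n_{\mathscr R}X(\widehat{\mathscr M})=\varprojlim_kF^n_{\mathscr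 R}X(\mathscr M)/(F^n_{\mathscr R}X(\mathscr M)\cap F^k_{\mathscr N}X(\mathscr M))$. Tildes denote $(\mathscr R+\mathscr N)$-adic completions: $\widetilde{\mathscr M}=\varprojlim_n\mathscr M/(\mathscr R+\mathscr N)^n$, $X(\widetilde{\mathscr M})=\varprojlim_nX(\widehat{\mathscr M})/F^n_{\mathscr R}X(\widehat{\mathscr M})$. A cocycle over $F^n_{\mathscr R}X(\widehat{\mathscr M})$ is a linear map $\tau:F^n_{\mathscr R}X(\widehat{\mathscr M})\to\mathbb C$ (that is, a linear map on $F^n_{\mathscr R}X(\mathscr M)$ vanishing on $F^n_{\mathscr R}X(\mathscr M)\cap F^k_{\mathscr N}X(\mathscr M)$ for some $k\gg0$) with $\tau\partial=0$. Renormalization: for a cocycle $\tau$ over $F^n_{\mathscr R}X(\widehat{\mathscr M})$, $n\ge1$, a renormalization is a linear map $\tau_R:X(\widehat{\mathscr M})\to\mathbb C$ extending $\tau$. Its coboundary $\tau_R\partial$ vanishes on $F^n_{\mathscr R}X(\widehat{\mathscr M})$, hence descends to a cocycle over $X(\widetilde{\mathscr M})$, still denoted $\tau_R\partial$. A linear splitting $\sigma:\mathscr A\to\mathscr M$ extends to the homomorphism $\sigma_*:T\mathscr A\to\mathscr M$, $\sigma_*(a_1\otimes\cdots\otimes a_k)=\sigma(a_1)\cdots\sigma(a_k)$, which maps $J\mathscr A$ to $\mathscr R+\mathscr N$ and hence induces $\widehat T\mathscr A\to\widetilde{\mathscr M}$ and a chain map $\sigma_*:X(\widehat T\mathscr A)\to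 X(\widetilde{\mathscr M})$. *)

theory Defs
  imports Complex_Main "HOL-Library.Poly_Mapping" "HOL-Library.Product_Plus" "HOL-Library.Z2"
begin

section \<open>Complex vector spaces and algebras\<close>

class complex_vector = ab_group_add +
  fixes scaleC :: "complex \<Rightarrow> 'a \<Rightarrow> 'a"  (infixr \<open>*\<^sub>C\<close> 75)
  assumes scaleC_add_right: "a *\<^sub>C (x + y) = a *\<^sub>C x + a *\<^sub>C y"
    and scaleC_add_left: "(a + b) *\<^sub>C x = a *\<^sub>C x + b *\<^sub>C x"
    and scaleC_scaleC [simp]: "a *\<^sub>C b *\<^sub>C x = (a * b) *\<^sub>C x"
    and scaleC_one [simp]: "1 *\<^sub>C x = x"

text \<open>The class \<^class>\<open>ring\<close> requires neither a unit nor commutativity.\<close>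

class complex_algebra = complex_vector + ring +
  assumes mult_scaleC_left [simp]: "a *\<^sub>C x * y = a *\<^sub>C (x * y)"
    and mult_scaleC_right [simp]: "x * a *\<^sub>C y = a *\<^sub>C (x * y)"

global_interpretation cvec: vector_space "scaleC :: complex \<Rightarrow> 'a \<Rightarrow> 'a::complex_vector"
  by unfold_locales (simp_all add: scaleC_add_right scaleC_add_left)

abbreviation cspan :: "'a::complex_vector set \<Rightarrow> 'a set"
  where "cspan \<equiv> cvec.span"

abbreviation clinear :: "('a::complex_vector \<Rightarrow> 'b::complex_vector) \<Rightarrow> bool"
  where "clinear \<equiv> Vector_Spaces.linear scaleC scaleC"

lemma clinearI:
  assumes "\<And>x y. f (x + y) = f x + f y" "\<And>c x. f (c *\<^sub>C x) = c *\<^sub>C f x"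
  shows "clinear f"
  by (simp add: Vector_Spaces.linear_iff cvec.vector_space_axioms assms)

lemma clinear_add: "clinear f \<Longrightarrow> f (x + y) = f x + f y"
  and clinear_scaleC: "clinear f \<Longrightarrow> f (c *\<^sub>C x) = c *\<^sub>C f x"
  by (simp_all add: Vector_Spaces.linear_iff)

lemma clinear_0: "clinear f \<Longrightarrow> f 0 = 0"
  using clinear_scaleC[of f 0 0] by simp

lemma clinear_minus: "clinear f \<Longrightarrow> f (- x) = - f x"
  by (metis clinear_0 clinear_add add_eq_0_iff add.right_inverse)

lemma clinear_diff: "clinear f \<Longrightarrow> f (x - y) = f x - f y"
  using clinear_add[of f x "- y"] clinear_minus[of f y] by simp

lemma clinear_sum: "clinear f \<Longrightarrow> f (\<Sum>i\<in>I. g i) = (\<Sum>i\<in>I. f (g i))"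
  by (induction I rule: infinite_finite_induct) (simp_all add: clinear_0 clinear_add)

lemmas clinear_simps = clinear_add clinear_scaleC clinear_0 clinear_minus clinear_diff clinear_sum

lemma clinear_maps_span:
  assumes "clinear f" "\<And>x. x \<in> S \<Longrightarrow> f x \<in> cspan T" "x \<in> cspan S"
  shows "f x \<in> cspan T"
  using assms(3)
  by (induction rule: cvec.span_induct_alt)
    (auto simp: clinear_simps[OF assms(1)] cvec.span_zero
        intro!: cvec.span_add cvec.span_scale assms(2))

lemma clinear_zero_span:
  assumes "clinear f" "\<And>x. x \<in> S \<Longrightarrow> f x = 0" "x \<in> cspan S"
  shows "f x = 0"
  using clinear_maps_span[of f S "{}" x] assms by simp

definition alg_hom :: "('a::complex_algebra \<Rightarrow> 'b::complex_algebra) \<Rightarrow> bool"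
  where "alg_hom f \<longleftrightarrow> clinear f \<and> (\<forall>x y. f (x * y) = f x * f y)"

definition commutator :: "'a::ring \<Rightarrow> 'a \<Rightarrow> 'a"
  where "commutator x y = x * y - y * x"

instantiation complex :: complex_algebra
begin
definition scaleC_complex_def [simp]: "scaleC a (x::complex) = a * x"
instance by standard (simp_all add: algebra_simps)
end

instantiation prod :: (complex_vector, complex_vector) complex_vector
begin
definition scaleC_prod_def: "scaleC a x = (a *\<^sub>C fst x, a *\<^sub>C snd x)"
instance by standard (simp_all add: scaleC_prod_def prod_eq_iff scaleC_add_left scaleC_add_right)
end

lemma fst_scaleC [simp]: "fst (a *\<^sub>C x) = a *\<^sub>C fst x"
  and snd_scaleC [simp]: "snd (a *\<^sub>C x) = a *\<^sub>C snd x"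
  by (simp_all add: scaleC_prod_def)


section \<open>Free vector spaces\<close>

instantiation poly_mapping :: (type, complex_vector) complex_vector
begin
lift_definition scaleC_poly_mapping :: "complex \<Rightarrow> ('a \<Rightarrow>\<^sub>0 'b) \<Rightarrow> 'a \<Rightarrow>\<^sub>0 'b"
  is "\<lambda>c f k. c *\<^sub>C f k"
  by (erule rev_finite_subset) auto
instance
  by standard (transfer, simp add: fun_eq_iff scaleC_add_left scaleC_add_right)+
end

lemma lookup_scaleC: "Poly_Mapping.lookup (c *\<^sub>C p) k = c *\<^sub>C Poly_Mapping.lookup p k"
  by transfer simp

abbreviation basis :: "'x \<Rightarrow> ('x \<Rightarrow>\<^sub>0 complex)"
  where "basis x \<equiv> Poly_Mapping.single x 1"

definition free_ext :: "('x \<Rightarrow> 'v::complex_vector) \<Rightarrow> ('x \<Rightarrow>\<^sub>0 complex) \<Rightarrow> 'v"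
  where "free_ext g p = (\<Sum>x\<in>Poly_Mapping.keys p. Poly_Mapping.lookup p x *\<^sub>C g x)"

lemma free_ext_superset:
  assumes "finite K" "Poly_Mapping.keys p \<subseteq> K"
  shows "free_ext g p = (\<Sum>x\<in>K. Poly_Mapping.lookup p x *\<^sub>C g x)"
  unfolding free_ext_def
  by (rule sum.mono_neutral_left) (use assms in \<open>auto simp: in_keys_iff\<close>)

lemma clinear_free_ext: "clinear (free_ext g)"
proof (rule clinearI)
  fix p q :: "'a \<Rightarrow>\<^sub>0 complex" and c
  let ?K = "Poly_Mapping.keys p \<union> Poly_Mapping.keys q"
  have "free_ext g (p + q) = (\<Sum>x\<in>?K. Poly_Mapping.lookup (p + q) x *\<^sub>C g x)"
    by (rule free_ext_superset) (auto simp: Poly_Mapping.keys_add)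
  also have "\<dots> = free_ext g p + free_ext g q"
    using free_ext_superset[of ?K p g] free_ext_superset[of ?K q g]
    by (simp add: lookup_add scaleC_add_left sum.distrib)
  finally show "free_ext g (p + q) = free_ext g p + free_ext g q" .
  have "free_ext g (c *\<^sub>C p)
      = (\<Sum>x\<in>Poly_Mapping.keys p. Poly_Mapping.lookup (c *\<^sub>C p) x *\<^sub>C g x)"
    by (rule free_ext_superset) (auto simp: in_keys_iff lookup_scaleC)
  then show "free_ext g (c *\<^sub>C p) = c *\<^sub>C free_ext g p"
    by (simp add: free_ext_def lookup_scaleC cvec.scale_sum_right)
qed

lemmas free_ext_simps = clinear_simps[OF clinear_free_ext]

lemma free_ext_basis [simp]: "free_ext g (basis x) = g x"
  by (simp add: free_ext_def)

lemma clinear_basis_expansion: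
  assumes "clinear f"
  shows "f p = free_ext (\<lambda>x. f (basis x)) p"
proof -
  have "p = (\<Sum>x\<in>Poly_Mapping.keys p. Poly_Mapping.lookup p x *\<^sub>C basis x)"
    by (rule poly_mapping_eqI)
      (simp add: lookup_sum lookup_scaleC lookup_single when_def in_keys_iff if_distrib cong: if_cong)
  then have "f p = f (\<Sum>x\<in>Poly_Mapping.keys p. Poly_Mapping.lookup p x *\<^sub>C basis x)"
    by simp
  then show ?thesis
    by (simp add: clinear_simps[OF assms] free_ext_def)
qed

lemma clinear_eq_basis:
  assumes "clinear f" "clinear g" "\<And>x. f (basis x) = g (basis x)"
  shows "f p = g p"
  by (simp only: clinear_basis_expansion[OF assms(1), of p]
      clinear_basis_expansion[OF assms(2), of p] assms(3))

lemma free_ext_map_add: "free_ext (\<lambda>x. f x + g x) p = free_ext f p + free_ext g p"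
  by (simp add: free_ext_def scaleC_add_right sum.distrib)

lemma free_ext_map_scaleC: "free_ext (\<lambda>x. c *\<^sub>C f x) p = c *\<^sub>C free_ext f p"
  by (simp add: free_ext_def cvec.scale_sum_right mult.commute)

lemma equivp_mod_span: "equivp (\<lambda>x y. x - y \<in> cspan S)"
proof (rule equivpI)
  show "reflp (\<lambda>x y. x - y \<in> cspan S)"
    by (rule reflpI) (simp add: cvec.span_zero)
  show "symp (\<lambda>x y. x - y \<in> cspan S)"
    by (rule sympI) (metis cvec.span_neg minus_diff_eq)
  show "transp (\<lambda>x y. x - y \<in> cspan S)"
  proof (rule transpI)
    fix x y z assume "x - y \<in> cspan S" "y - z \<in> cspan S"
    from cvec.span_add[OF this] show "x - z \<in> cspan S" by simp
  qed
qed

lemma mod_span_add: "a - b \<in> cspan S \<Longrightarrow> c - d \<in> cspan S \<Longrightarrow> a + c - (b + d) \<in> cspan S"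
  by (metis add_diff_add cvec.span_add)

lemma mod_span_diff: "a - b \<in> cspan S \<Longrightarrow> c - d \<in> cspan S \<Longrightarrow> a - c - (b - d) \<in> cspan S"
  using cvec.span_diff[of "a - b" S "c - d"] by (simp add: algebra_simps)

lemma mod_span_minus: "a - b \<in> cspan S \<Longrightarrow> - a - - b \<in> cspan S"
  using cvec.span_neg[of "a - b" S] by simp

lemma mod_span_scaleC: "a - b \<in> cspan S \<Longrightarrow> c *\<^sub>C a - c *\<^sub>C b \<in> cspan S"
  by (metis cvec.scale_right_diff_distrib cvec.span_scale)

lemmas mod_span_intros = mod_span_add mod_span_diff mod_span_minus mod_span_scaleC


section \<open>Tensor products\<close>

inductive_set tensor_rels :: "(('a::complex_vector \<times> 'b::complex_vector) \<Rightarrow>\<^sub>0 complex) set" where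
  "basis (x + x', y) - basis (x, y) - basis (x', y) \<in> tensor_rels"
| "basis (x, y + y') - basis (x, y) - basis (x, y') \<in> tensor_rels"
| "basis (c *\<^sub>C x, y) - c *\<^sub>C basis (x, y) \<in> tensor_rels"
| "basis (x, c *\<^sub>C y) - c *\<^sub>C basis (x, y) \<in> tensor_rels"

quotient_type (overloaded) ('a, 'b) tensor =
    "('a::complex_vector \<times> 'b::complex_vector) \<Rightarrow>\<^sub>0 complex"
  / "\<lambda>p q. p - q \<in> cspan tensor_rels"
  by (rule equivp_mod_span)

instantiation tensor :: (complex_vector, complex_vector) complex_vector
begin
lift_definition zero_tensor :: "('a, 'b) tensor" is 0 .
lift_definition plus_tensor :: "('a, 'b) tensor \<Rightarrow> ('a, 'b) tensor \<Rightarrow> ('a, 'b) tensor" is plus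
  by (rule mod_span_intros)
lift_definition minus_tensor :: "('a, 'b) tensor \<Rightarrow> ('a, 'b) tensor \<Rightarrow> ('a, 'b) tensor" is minus
  by (rule mod_span_intros)
lift_definition uminus_tensor :: "('a, 'b) tensor \<Rightarrow> ('a, 'b) tensor" is uminus
  by (rule mod_span_intros)
lift_definition scaleC_tensor :: "complex \<Rightarrow> ('a, 'b) tensor \<Rightarrow> ('a, 'b) tensor" is scaleC
  by (rule mod_span_intros)
instance
  by standard
    (transfer, simp add: cvec.span_zero algebra_simps scaleC_add_left scaleC_add_right)+
end

lift_definition tens :: "'a::complex_vector \<Rightarrow> 'b::complex_vector \<Rightarrow> ('a, 'b) tensor"
    (infixr \<open>\<otimes>\<^sub>t\<close> 76)
  is "\<lambda>x y. basis (x, y)" .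

lemma tens_bilinear:
  "(x + x') \<otimes>\<^sub>t y = x \<otimes>\<^sub>t y + x' \<otimes>\<^sub>t y" "x \<otimes>\<^sub>t (y + y') = x \<otimes>\<^sub>t y + x \<otimes>\<^sub>t y'"
  "(c *\<^sub>C x) \<otimes>\<^sub>t y = c *\<^sub>C (x \<otimes>\<^sub>t y)" "x \<otimes>\<^sub>t (c *\<^sub>C y) = c *\<^sub>C (x \<otimes>\<^sub>t y)"
  by (transfer, metis cvec.span_base tensor_rels.intros diff_diff_eq)+

definition cbilinear ::
    "('a::complex_vector \<Rightarrow> 'b::complex_vector \<Rightarrow> 'c::complex_vector) \<Rightarrow> bool"
  where "cbilinear f \<longleftrightarrow> (\<forall>y. clinear (\<lambda>x. f x y)) \<and> (\<forall>x. clinear (f x))"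

lemma cbilinearI:
  assumes "\<And>x x' y. f (x + x') y = f x y + f x' y" "\<And>x y y'. f x (y + y') = f x y + f x y'"
    "\<And>c x y. f (c *\<^sub>C x) y = c *\<^sub>C f x y" "\<And>c x y. f x (c *\<^sub>C y) = c *\<^sub>C f x y"
  shows "cbilinear f"
  unfolding cbilinear_def by (auto intro!: clinearI simp: assms)

lemma cbilinear_simps:
  assumes "cbilinear f"
  shows "f (x + x') y = f x y + f x' y" "f x (y + y') = f x y + f x y'"
    "f (c *\<^sub>C x) y = c *\<^sub>C f x y" "f x (c *\<^sub>C y) = c *\<^sub>C f x y"
  using assms unfolding cbilinear_def Vector_Spaces.linear_iff by blast+

text \<open>The linear map on the tensor product induced by a bilinear map. The choice of
  representative in the quotient is irrelevant only when \<open>f\<close> is bilinear.\<close>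

definition tensor_ext ::
    "('a::complex_vector \<Rightarrow> 'b::complex_vector \<Rightarrow> 'c::complex_vector) \<Rightarrow> ('a, 'b) tensor \<Rightarrow> 'c"
  where "tensor_ext f t = free_ext (case_prod f) (rep_tensor t)"

lemma tensor_ext_abs:
  assumes "cbilinear f"
  shows "tensor_ext f (abs_tensor p) = free_ext (case_prod f) p"
proof -
  have "free_ext (case_prod f) r = 0" if "r \<in> tensor_rels" for r
    using that
    by cases (simp_all add: free_ext_simps cbilinear_simps[OF assms])
  moreover have "rep_tensor (abs_tensor p) - p \<in> cspan tensor_rels"
    by (rule rep_abs_rsp_left[OF Quotient3_tensor]) (simp add: cvec.span_zero)
  ultimately have "free_ext (case_prod f) (rep_tensor (abs_tensor p) - p) = 0"
    by (rule clinear_zero_span[OF clinear_free_ext])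
  then show ?thesis by (simp add: tensor_ext_def free_ext_simps)
qed

lemma tensor_ext_tens:
  assumes "cbilinear f"
  shows "tensor_ext f (x \<otimes>\<^sub>t y) = f x y"
  using tensor_ext_abs[OF assms, of "basis (x, y)"] by (simp add: tens.abs_eq)

lemma clinear_tensor_ext:
  assumes "cbilinear f"
  shows "clinear (tensor_ext f)"
proof (rule clinearI)
  fix s t c
  show "tensor_ext f (s + t) = tensor_ext f s + tensor_ext f t"
    by (induction s, induction t)
      (simp add: plus_tensor.abs_eq tensor_ext_abs[OF assms] free_ext_simps)
  show "tensor_ext f (c *\<^sub>C s) = c *\<^sub>C tensor_ext f s"
    by (induction s) (simp add: scaleC_tensor.abs_eq tensor_ext_abs[OF assms] free_ext_simps)
qed


section \<open>Unitalization\<close>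

datatype 'a unitization = Unitize (alg_part: 'a) (scalar_part: complex)

lemma unitization_eq_iff:
  "x = y \<longleftrightarrow> alg_part x = alg_part y \<and> scalar_part x = scalar_part y"
  by (cases x; cases y) simp

instantiation unitization :: (complex_algebra) "{complex_algebra, ring_1}"
begin
definition "0 = Unitize 0 0"
definition "1 = Unitize 0 1"
definition "x + y = Unitize (alg_part x + alg_part y) (scalar_part x + scalar_part y)"
definition "x - y = Unitize (alg_part x - alg_part y) (scalar_part x - scalar_part y)"
definition "- x = Unitize (- alg_part x) (- scalar_part x)"
definition "c *\<^sub>C x = Unitize (c *\<^sub>C alg_part x) (c * scalar_part x)"
definition "x * y = Unitize
  (alg_part x * alg_part y + scalar_part x *\<^sub>C alg_part y + scalar_part y *\<^sub>C alg_part x)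
  (scalar_part x * scalar_part y)"
instance
  by standard
    (simp_all add: zero_unitization_def one_unitization_def plus_unitization_def
      minus_unitization_def uminus_unitization_def scaleC_unitization_def times_unitization_def
      unitization_eq_iff scaleC_add_left scaleC_add_right algebra_simps)
end

definition incl :: "'a::complex_algebra \<Rightarrow> 'a unitization"
  where "incl x = Unitize x 0"

definition unitize_map ::
    "('a::complex_algebra \<Rightarrow> 'b::complex_algebra) \<Rightarrow> 'a unitization \<Rightarrow> 'b unitization"
  where "unitize_map f x = Unitize (f (alg_part x)) (scalar_part x)"


lemma incl_simps:
  "incl (x + y) = incl x + incl y" "incl (c *\<^sub>C x) = c *\<^sub>C incl x" "incl (x * y) = incl x * incl y"
  by (simp_all add: incl_def unitization_eq_iff plus_unitization_def scaleC_unitization_def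
      times_unitization_def)


section \<open>Universal one-forms and the X-complex\<close>

text \<open>As a vector space, the bimodule of universal one-forms over \<open>R\<close> is the tensor product of
  the unitalization of \<open>R\<close> with \<open>R\<close>; the tensor \<open>x0 \<otimes> x1\<close> stands for \<open>x0 dx1\<close>, and the right
  multiplication is dictated by the Leibniz rule \<open>(x0 dx1) a = x0 d(x1 a) - x0 x1 da\<close>.\<close>

type_synonym 'a one_forms = "('a unitization, 'a) tensor"

definition form_d :: "'a::complex_algebra \<Rightarrow> 'a one_forms"
  where "form_d x = 1 \<otimes>\<^sub>t x"

definition form_lmul :: "'a::complex_algebra \<Rightarrow> 'a one_forms \<Rightarrow> 'a one_forms"
  where "form_lmul a = tensor_ext (\<lambda>x0 x1. (incl a * x0) \<otimes>\<^sub>t x1)"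

definition form_rmul :: "'a::complex_algebra one_forms \<Rightarrow> 'a \<Rightarrow> 'a one_forms"
  where "form_rmul \<omega> a = tensor_ext (\<lambda>x0 x1. x0 \<otimes>\<^sub>t (x1 * a) - (x0 * incl x1) \<otimes>\<^sub>t a) \<omega>"

lemma cbilinear_form_lmul: "cbilinear (\<lambda>x0 x1. (incl a * x0) \<otimes>\<^sub>t x1)"
  by (rule cbilinearI) (simp_all add: tens_bilinear distrib_left)

lemma cbilinear_form_rmul: "cbilinear (\<lambda>x0 x1. x0 \<otimes>\<^sub>t (x1 * a) - (x0 * incl x1) \<otimes>\<^sub>t a)"
  by (rule cbilinearI)
    (simp_all add: tens_bilinear incl_simps distrib_left distrib_right cvec.scale_right_diff_distrib)

lemma clinear_form_lmul: "clinear (form_lmul a)"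
  unfolding form_lmul_def by (rule clinear_tensor_ext[OF cbilinear_form_lmul])

lemma clinear_form_rmul: "clinear (\<lambda>\<omega>. form_rmul \<omega> a)"
  unfolding form_rmul_def by (rule clinear_tensor_ext[OF cbilinear_form_rmul])

lemma form_lmul_tens [simp]: "form_lmul a (x0 \<otimes>\<^sub>t x1) = (incl a * x0) \<otimes>\<^sub>t x1"
  by (simp add: form_lmul_def tensor_ext_tens[OF cbilinear_form_lmul])

lemma form_rmul_tens [simp]:
  "form_rmul (x0 \<otimes>\<^sub>t x1) a = x0 \<otimes>\<^sub>t (x1 * a) - (x0 * incl x1) \<otimes>\<^sub>t a"
  by (simp add: form_rmul_def tensor_ext_tens[OF cbilinear_form_rmul])

lemma form_d_Leibniz: "form_d (x * y) = form_lmul x (form_d y) + form_rmul (form_d x) y"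
  by (simp add: form_d_def)

inductive_set form_commutators :: "'a::complex_algebra one_forms set" where
  "form_lmul a \<omega> - form_rmul \<omega> a \<in> form_commutators"

quotient_type (overloaded) 'a one_forms_nat = "'a::complex_algebra one_forms"
  / "\<lambda>\<omega> \<eta>. \<omega> - \<eta> \<in> cspan form_commutators"
  by (rule equivp_mod_span)

instantiation one_forms_nat :: (complex_algebra) complex_vector
begin
lift_definition zero_one_forms_nat :: "'a one_forms_nat" is 0 .
lift_definition plus_one_forms_nat :: "'a one_forms_nat \<Rightarrow> 'a one_forms_nat \<Rightarrow> 'a one_forms_nat"
  is plus by (rule mod_span_intros)
lift_definition minus_one_forms_nat :: "'a one_forms_nat \<Rightarrow> 'a one_forms_nat \<Rightarrow> 'a one_forms_nat"
  is minus by (rule mod_span_intros)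
lift_definition uminus_one_forms_nat :: "'a one_forms_nat \<Rightarrow> 'a one_forms_nat"
  is uminus by (rule mod_span_intros)
lift_definition scaleC_one_forms_nat :: "complex \<Rightarrow> 'a one_forms_nat \<Rightarrow> 'a one_forms_nat"
  is scaleC by (rule mod_span_intros)
instance
  by standard
    (transfer, simp add: cvec.span_zero algebra_simps scaleC_add_left scaleC_add_right)+
end

text \<open>\<open>natd x0 x1\<close> is the class of the one-form \<open>x0 dx1\<close>.\<close>

lift_definition natd :: "'a::complex_algebra unitization \<Rightarrow> 'a \<Rightarrow> 'a one_forms_nat"
  is "\<lambda>x0 x1. x0 \<otimes>\<^sub>t x1" .

lemma cbilinear_natd: "cbilinear natd"
  by (rule cbilinearI) (transfer, simp add: tens_bilinear cvec.span_zero)+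

lemma natd_trace: "natd (incl a * x0) x1 = natd x0 (x1 * a) - natd (x0 * incl x1) a"
proof -
  have "form_lmul a (x0 \<otimes>\<^sub>t x1) - form_rmul (x0 \<otimes>\<^sub>t x1) a \<in> cspan form_commutators"
    by (intro cvec.span_base form_commutators.intros)
  then show ?thesis
    by (simp add: natd.abs_eq minus_one_forms_nat.abs_eq one_forms_nat.abs_eq_iff)
qed

definition trace_like ::
    "('a::complex_algebra unitization \<Rightarrow> 'a \<Rightarrow> 'c::complex_vector) \<Rightarrow> bool"
  where "trace_like f \<longleftrightarrow> cbilinear f \<and>
    (\<forall>a x0 x1. f (incl a * x0) x1 = f x0 (x1 * a) - f (x0 * incl x1) a)"

text \<open>The linear map sending \<open>natd x0 x1\<close> to \<open>f x0 x1\<close>; it has this property only if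
  \<open>f\<close> is bilinear and vanishes on commutators.\<close>

definition form_ext ::
    "('a::complex_algebra unitization \<Rightarrow> 'a \<Rightarrow> 'c::complex_vector) \<Rightarrow> 'a one_forms_nat \<Rightarrow> 'c"
  where "form_ext f \<omega> = tensor_ext f (rep_one_forms_nat \<omega>)"

lemma clinear_eq_tens:
  assumes "clinear f" "clinear g" "\<And>x y. f (x \<otimes>\<^sub>t y) = g (x \<otimes>\<^sub>t y)"
  shows "f t = g t"
proof -
  have lin: "clinear abs_tensor"
    by (rule clinearI) (simp_all add: plus_tensor.abs_eq scaleC_tensor.abs_eq)
  have "f (abs_tensor p) = g (abs_tensor p)" for p
    by (rule clinear_eq_basis[where f = "\<lambda>p. f (abs_tensor p)" and g = "\<lambda>p. g (abs_tensor p)"])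
      (use assms(3) in \<open>auto intro!: clinearI simp: clinear_add[OF lin] clinear_scaleC[OF lin]
        clinear_add[OF assms(1)] clinear_scaleC[OF assms(1)] clinear_add[OF assms(2)]
        clinear_scaleC[OF assms(2)] tens.abs_eq[symmetric]\<close>)
  then show ?thesis
    by (metis Quotient3_abs_rep[OF Quotient3_tensor])
qed

lemma form_ext_abs:
  assumes "trace_like f"
  shows "form_ext f (abs_one_forms_nat t) = tensor_ext f t"
proof -
  have bil: "cbilinear f" and tr: "\<And>a x0 x1. f (incl a * x0) x1 = f x0 (x1 * a) - f (x0 * incl x1) a"
    using assms by (auto simp: trace_like_def)
  note lin = clinear_tensor_ext[OF bil]
  note lin_l = clinear_form_lmul and lin_r = clinear_form_rmul
  have comm: "tensor_ext f (form_lmul a \<omega>) = tensor_ext f (form_rmul \<omega> a)" for a \<omega>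
    by (rule clinear_eq_tens[where f = "\<lambda>\<omega>. tensor_ext f (form_lmul a \<omega>)"
          and g = "\<lambda>\<omega>. tensor_ext f (form_rmul \<omega> a)"])
      (auto intro!: clinearI simp: clinear_add[OF lin] clinear_scaleC[OF lin] clinear_diff[OF lin]
        clinear_add[OF lin_l] clinear_scaleC[OF lin_l] clinear_add[OF lin_r]
        clinear_scaleC[OF lin_r] tensor_ext_tens[OF bil] tr)
  have "tensor_ext f r = 0" if "r \<in> form_commutators" for r
    using that by cases (simp add: clinear_diff[OF lin] comm)
  moreover have "rep_one_forms_nat (abs_one_forms_nat t) - t \<in> cspan form_commutators"
    by (rule rep_abs_rsp_left[OF Quotient3_one_forms_nat]) (simp add: cvec.span_zero)
  ultimately have "tensor_ext f (rep_one_forms_nat (abs_one_forms_nat t) - t) = 0"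
    by (rule clinear_zero_span[OF lin])
  then show ?thesis by (simp add: form_ext_def clinear_diff[OF lin])
qed

lemma form_ext_natd: "trace_like f \<Longrightarrow> form_ext f (natd x0 x1) = f x0 x1"
  by (simp add: natd.abs_eq form_ext_abs tensor_ext_tens trace_like_def)

lemma clinear_form_ext:
  assumes "trace_like f"
  shows "clinear (form_ext f)"
proof (rule clinearI)
  note lin = clinear_tensor_ext[of f]
  fix s t c
  show "form_ext f (s + t) = form_ext f s + form_ext f t"
    by (induction s, induction t) (use assms in \<open>simp add: plus_one_forms_nat.abs_eq
      form_ext_abs clinear_add[OF lin] trace_like_def\<close>)
  show "form_ext f (c *\<^sub>C s) = c *\<^sub>C form_ext f s"
    by (induction s) (use assms in \<open>simp add: scaleC_one_forms_nat.abs_eq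
      form_ext_abs clinear_scaleC[OF lin] trace_like_def\<close>)
qed

text \<open>The X-complex is the direct sum of its even part (first component) and its odd part.\<close>

type_synonym 'a X = "'a \<times> 'a one_forms_nat"

text \<open>The scalar part of \<open>x0\<close> does not contribute to the commutator of \<open>x0\<close> with \<open>x1\<close>.\<close>

definition bbar :: "'a::complex_algebra one_forms_nat \<Rightarrow> 'a"
  where "bbar = form_ext (\<lambda>x0 x1. commutator (alg_part x0) x1)"

definition X_boundary :: "'a::complex_algebra X \<Rightarrow> 'a X"
  where "X_boundary \<xi> = (bbar (snd \<xi>), natd 1 (fst \<xi>))"

definition X_map ::
    "('a::complex_algebra \<Rightarrow> 'b::complex_algebra) \<Rightarrow> 'a X \<Rightarrow> 'b X"
  where "X_map f \<xi> = (f (fst \<xi>),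
    form_ext (\<lambda>x0 x1. natd (unitize_map f x0) (f x1)) (snd \<xi>))"

lemma bbar_natd: "bbar (natd x0 x1) = commutator (alg_part x0) x1"
  unfolding bbar_def
  by (subst form_ext_natd)
    (auto simp: trace_like_def commutator_def incl_def plus_unitization_def times_unitization_def
      scaleC_unitization_def algebra_simps intro!: cbilinearI)

lemma X_map_natd:
  assumes "alg_hom f"
  shows "X_map f (x, natd x0 x1) = (f x, natd (unitize_map f x0) (f x1))"
proof -
  have lin: "clinear f" and mult: "f (x * y) = f x * f y" for x y
    using assms by (auto simp: alg_hom_def)
  have u: "unitize_map f (x + y) = unitize_map f x + unitize_map f y"
    "unitize_map f (c *\<^sub>C x) = c *\<^sub>C unitize_map f x"
    "unitize_map f (x * y) = unitize_map f x * unitize_map f y"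
    "unitize_map f (incl a) = incl (f a)" for x y c a
    by (simp_all add: unitize_map_def incl_def plus_unitization_def scaleC_unitization_def
        times_unitization_def clinear_add[OF lin] clinear_scaleC[OF lin] mult)
  have "trace_like (\<lambda>x0 x1. natd (unitize_map f x0) (f x1))"
    by (auto simp: trace_like_def u mult natd_trace clinear_add[OF lin] clinear_scaleC[OF lin]
        cbilinear_simps[OF cbilinear_natd] intro!: cbilinearI)
  then show ?thesis by (simp add: X_map_def form_ext_natd)
qed


section \<open>The non-unital tensor algebra\<close>

typedef 'a word = "{w :: 'a list. w \<noteq> []}"
  by auto

setup_lifting type_definition_word

lift_definition word_append :: "'a word \<Rightarrow> 'a word \<Rightarrow> 'a word" is append by simp

lift_definition word_at :: "'a list \<Rightarrow> 'a \<Rightarrow> 'a list \<Rightarrow> 'a word" is "\<lambda>u a v. u @ a # v" by simp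

lemma Rep_word_nonempty: "Rep_word w \<noteq> []"
  using Rep_word[of w] by simp

lemma word_append_assoc: "word_append (word_append u v) w = word_append u (word_append v w)"
  by transfer simp

lemma word_append_word_at:
  "word_append (word_at u a v) w = word_at u a (v @ Rep_word w)"
  "word_append w (word_at u a v) = word_at (Rep_word w @ u) a v"
  by (transfer, simp)+

text \<open>The direct sum of the tensor powers of \<open>A\<close> of positive order: the vector space spanned by
  the nonempty words in \<open>A\<close> modulo multilinearity in each letter.\<close>

inductive_set multilinear_rels :: "('a::complex_vector word \<Rightarrow>\<^sub>0 complex) set" where
  "basis (word_at u (a + b) v) - basis (word_at u a v) - basis (word_at u b v) \<in> multilinear_rels"
| "basis (word_at u (c *\<^sub>C a) v) - c *\<^sub>C basis (word_at u a v) \<in> multilinear_rels"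

definition word_mult :: "('a word \<Rightarrow>\<^sub>0 complex) \<Rightarrow> ('a word \<Rightarrow>\<^sub>0 complex) \<Rightarrow> ('a word \<Rightarrow>\<^sub>0 complex)"
  where "word_mult p q = free_ext (\<lambda>u. free_ext (\<lambda>v. basis (word_append u v)) q) p"

lemma word_mult_basis [simp]: "word_mult (basis u) (basis v) = basis (word_append u v)"
  by (simp add: word_mult_def)

lemma clinear_word_mult: "clinear (\<lambda>p. word_mult p q)" "clinear (word_mult p)"
  unfolding word_mult_def
  by (rule clinear_free_ext,
      rule clinearI) (simp_all add: free_ext_simps free_ext_map_add free_ext_map_scaleC)

lemmas word_mult_simps = clinear_simps[OF clinear_word_mult(1)] clinear_simps[OF clinear_word_mult(2)]

lemma clinear_word_mult_comp:
  "clinear f \<Longrightarrow> clinear (\<lambda>p. word_mult (f p) q)" "clinear f \<Longrightarrow> clinear (\<lambda>p. word_mult q (f p))"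
  by (rule clinearI; simp add: word_mult_simps clinear_add clinear_scaleC)+

lemma clinear_id: "clinear (\<lambda>x. x)"
  by (rule clinearI) simp_all

lemma word_mult_assoc: "word_mult (word_mult p q) r = word_mult p (word_mult q r)"
proof (rule clinear_eq_basis[where p = p])
  fix u show "word_mult (word_mult (basis u) q) r = word_mult (basis u) (word_mult q r)"
  proof (rule clinear_eq_basis[where p = q])
    fix v show "word_mult (word_mult (basis u) (basis v)) r
        = word_mult (basis u) (word_mult (basis v) r)"
      by (rule clinear_eq_basis[where p = r])
        (intro clinear_word_mult_comp clinear_id, intro clinear_word_mult_comp clinear_id,
          simp add: word_append_assoc)
  qed (intro clinear_word_mult_comp clinear_id)+
qed (intro clinear_word_mult_comp clinear_id)+

lemma word_mult_rels:
  assumes "r \<in> cspan multilinear_rels"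
  shows "word_mult r p \<in> cspan multilinear_rels" "word_mult p r \<in> cspan multilinear_rels"
proof -
  have "word_mult r (basis w) \<in> cspan multilinear_rels \<and>
      word_mult (basis w) r \<in> cspan multilinear_rels"
    if "r \<in> multilinear_rels" for r :: "'a word \<Rightarrow>\<^sub>0 complex" and w
    using that
    by cases (simp_all add: word_mult_simps word_append_word_at multilinear_rels.intros
        cvec.span_base)
  then have *: "word_mult r (basis w) \<in> cspan multilinear_rels"
      "word_mult (basis w) r \<in> cspan multilinear_rels" for w
    using clinear_maps_span[OF clinear_word_mult(1) _ assms]
      clinear_maps_span[OF clinear_word_mult(2) _ assms] by blast+
  have "free_ext f p \<in> cspan multilinear_rels" if "\<And>w. f w \<in> cspan multilinear_rels"
    for f :: "'a word \<Rightarrow> 'a word \<Rightarrow>\<^sub>0 complex"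
    unfolding free_ext_def by (intro cvec.span_sum cvec.span_scale that)
  then show "word_mult r p \<in> cspan multilinear_rels" "word_mult p r \<in> cspan multilinear_rels"
    using clinear_basis_expansion[OF clinear_word_mult(2)[of r], of p]
      clinear_basis_expansion[OF clinear_word_mult(1)[of r], of p] * by simp_all
qed

quotient_type (overloaded) 'a tensor_algebra = "'a::complex_vector word \<Rightarrow>\<^sub>0 complex"
  / "\<lambda>p q. p - q \<in> cspan multilinear_rels"
  by (rule equivp_mod_span)

instantiation tensor_algebra :: (complex_vector) complex_algebra
begin
lift_definition zero_tensor_algebra :: "'a tensor_algebra" is 0 .
lift_definition plus_tensor_algebra :: "'a tensor_algebra \<Rightarrow> 'a tensor_algebra \<Rightarrow> 'a tensor_algebra"
  is plus by (rule mod_span_intros)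
lift_definition minus_tensor_algebra :: "'a tensor_algebra \<Rightarrow> 'a tensor_algebra \<Rightarrow> 'a tensor_algebra"
  is minus by (rule mod_span_intros)
lift_definition uminus_tensor_algebra :: "'a tensor_algebra \<Rightarrow> 'a tensor_algebra"
  is uminus by (rule mod_span_intros)
lift_definition scaleC_tensor_algebra :: "complex \<Rightarrow> 'a tensor_algebra \<Rightarrow> 'a tensor_algebra"
  is scaleC by (rule mod_span_intros)
lift_definition times_tensor_algebra :: "'a tensor_algebra \<Rightarrow> 'a tensor_algebra \<Rightarrow> 'a tensor_algebra"
  is word_mult
proof -
  fix p p' q q' :: "'a word \<Rightarrow>\<^sub>0 complex"
  assume "p - p' \<in> cspan multilinear_rels" "q - q' \<in> cspan multilinear_rels"
  then have "word_mult (p - p') q + word_mult p' (q - q') \<in> cspan multilinear_rels"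
    by (intro cvec.span_add word_mult_rels)
  then show "word_mult p q - word_mult p' q' \<in> cspan multilinear_rels"
    by (simp add: word_mult_simps)
qed
instance
  by standard
    (transfer, simp add: cvec.span_zero word_mult_assoc word_mult_simps scaleC_add_left
      scaleC_add_right algebra_simps)+
end

fun word_prod :: "('a \<Rightarrow> 'b::ring) \<Rightarrow> 'a list \<Rightarrow> 'b" where
  "word_prod s [] = 0"
| "word_prod s [a] = s a"
| "word_prod s (a # b # w) = s a * word_prod s (b # w)"

text \<open>The homomorphism from the tensor algebra induced by a linear map \<open>s\<close>.\<close>

definition T_ext :: "('a::complex_vector \<Rightarrow> 'b::complex_algebra) \<Rightarrow> 'a tensor_algebra \<Rightarrow> 'b"
  where "T_ext s t = free_ext (\<lambda>w. word_prod s (Rep_word w)) (rep_tensor_algebra t)"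

lemma word_prod_append:
  "u \<noteq> [] \<Longrightarrow> v \<noteq> [] \<Longrightarrow> word_prod s (u @ v) = word_prod s u * word_prod s v"
proof (induction s u rule: word_prod.induct)
  case (2 s a)
  then show ?case by (cases v) simp_all
qed (simp_all add: mult.assoc)

lemma word_prod_at:
  fixes s :: "'a::complex_vector \<Rightarrow> 'b::complex_algebra"
  assumes "clinear s"
  shows "word_prod s (u @ (a + b) # v) = word_prod s (u @ a # v) + word_prod s (u @ b # v)"
    "word_prod s (u @ (c *\<^sub>C a) # v) = c *\<^sub>C word_prod s (u @ a # v)"
proof -
  have add: "word_prod s ((a + b) # v) = word_prod s (a # v) + word_prod s (b # v)"
    by (cases v) (simp_all add: clinear_add[OF assms] distrib_right)
  have scale: "word_prod s ((c *\<^sub>C a) # v) = c *\<^sub>C word_prod s (a # v)"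
    by (cases v) (simp_all add: clinear_scaleC[OF assms])
  show "word_prod s (u @ (a + b) # v) = word_prod s (u @ a # v) + word_prod s (u @ b # v)"
    by (cases "u = []") (simp_all add: add word_prod_append distrib_left)
  show "word_prod s (u @ (c *\<^sub>C a) # v) = c *\<^sub>C word_prod s (u @ a # v)"
    by (cases "u = []") (simp_all add: scale word_prod_append)
qed

lemma T_ext_abs:
  assumes "clinear s"
  shows "T_ext s (abs_tensor_algebra p) = free_ext (\<lambda>w. word_prod s (Rep_word w)) p"
proof -
  have "free_ext (\<lambda>w. word_prod s (Rep_word w)) r = 0" if "r \<in> multilinear_rels" for r
    using that
    by cases (simp_all add: free_ext_simps word_at.rep_eq word_prod_at[OF assms])
  moreover have "rep_tensor_algebra (abs_tensor_algebra p) - p \<in> cspan multilinear_rels"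
    by (rule rep_abs_rsp_left[OF Quotient3_tensor_algebra]) (simp add: cvec.span_zero)
  ultimately have "free_ext (\<lambda>w. word_prod s (Rep_word w))
      (rep_tensor_algebra (abs_tensor_algebra p) - p) = 0"
    by (rule clinear_zero_span[OF clinear_free_ext])
  then show ?thesis by (simp add: T_ext_def free_ext_simps)
qed

lemma T_ext_word:
  "clinear s \<Longrightarrow> T_ext s (abs_tensor_algebra (basis w)) = word_prod s (Rep_word w)"
  by (simp add: T_ext_abs)

lemma alg_hom_T_ext:
  assumes "clinear s"
  shows "alg_hom (T_ext s)"
  unfolding alg_hom_def
proof (intro conjI allI clinearI)
  fix x y c
  note abs = T_ext_abs[OF assms]
  show "T_ext s (x + y) = T_ext s x + T_ext s y"
    by (induction x, induction y) (simp add: plus_tensor_algebra.abs_eq abs free_ext_simps)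
  show "T_ext s (c *\<^sub>C x) = c *\<^sub>C T_ext s x"
    by (induction x) (simp add: scaleC_tensor_algebra.abs_eq abs free_ext_simps)
  let ?F = "free_ext (\<lambda>w. word_prod s (Rep_word w))"
  have "?F (word_mult p q) = ?F p * ?F q" for p q
  proof (rule clinear_eq_basis[where p = p])
    fix u show "?F (word_mult (basis u) q) = ?F (basis u) * ?F q"
      by (rule clinear_eq_basis[where p = q])
        (auto intro!: clinearI simp: free_ext_simps word_mult_simps distrib_left
          word_append.rep_eq word_prod_append Rep_word_nonempty)
  qed (auto intro!: clinearI simp: free_ext_simps word_mult_simps distrib_right)
  then show "T_ext s (x * y) = T_ext s x * T_ext s y"
    by (induction x, induction y) (simp add: times_tensor_algebra.abs_eq abs)
qed

definition T_kernel :: "'a::complex_algebra tensor_algebra set"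
  where "T_kernel = {t. T_ext (\<lambda>a. a) t = 0}"


section \<open>Adic filtrations\<close>

fun ideal_pow :: "'a::complex_algebra set \<Rightarrow> nat \<Rightarrow> 'a set" where
  "ideal_pow J 0 = UNIV"
| "ideal_pow J (Suc 0) = J"
| "ideal_pow J (Suc (Suc n)) = cspan {x * y | x y. x \<in> J \<and> y \<in> ideal_pow J (Suc n)}"

definition ideal_pow_plus :: "'a::complex_algebra set \<Rightarrow> nat \<Rightarrow> 'a unitization set"
  where "ideal_pow_plus J n = (if n = 0 then UNIV else incl ` ideal_pow J n)"

definition X_filt :: "'a::complex_algebra set \<Rightarrow> nat \<Rightarrow> 'a X set"
  where "X_filt J k = (let n = k div 2 in
    if even k then
      cspan (ideal_pow J (n + 1) \<union> {commutator x y | x y. x \<in> ideal_pow J n}) \<times>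
      cspan {natd x y | x y. x \<in> ideal_pow_plus J n}
    else
      ideal_pow J (n + 1) \<times>
      cspan ({natd x y | x y. x \<in> ideal_pow_plus J (n + 1)} \<union>
        {natd x y | x y. x \<in> ideal_pow_plus J n \<and> y \<in> J}))"

text \<open>\<open>X_filt R m + X_filt N m\<close> is the diagonal of the pro-object that is first completed for
  the \<open>N\<close>-adic and then for the \<open>R\<close>-adic filtration; as both filtrations decrease, vanishing on
  \<open>X_filt R l\<close> and on \<open>X_filt N k\<close> for some \<open>l, k\<close> is vanishing on some diagonal term.\<close>

definition X_tilde :: "'a::complex_algebra set \<Rightarrow> 'a set \<Rightarrow> nat \<Rightarrow> 'a X set"
  where "X_tilde R N m = {\<xi> + \<eta> | \<xi> \<eta>. \<xi> \<in> X_filt R m \<and> \<eta> \<in> X_filt N m}"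


text \<open>Morphisms of pro-complexes that are induced by a chain map between the uncompleted
  X-complexes.\<close>

definition pro_chain_map ::
    "(nat \<Rightarrow> 'a::complex_algebra X set) \<Rightarrow> (nat \<Rightarrow> 'b::complex_algebra X set) \<Rightarrow>
     ('a X \<Rightarrow> 'b X) \<Rightarrow> bool"
  where "pro_chain_map G G' f \<longleftrightarrow> clinear f \<and>
    (\<forall>\<xi>. f (X_boundary \<xi>) = X_boundary (f \<xi>)) \<and> (\<forall>m. \<exists>k. f ` G k \<subseteq> G' m)"


section \<open>Cohomology of pro-complexes\<close>

text \<open>A subcomplex \<open>S\<close> of an X-complex, completed along a decreasing filtration \<open>G\<close>. Its
  cochains are the linear functionals on \<open>S\<close> that vanish on \<open>S \<inter> G k\<close> for some \<open>k\<close>; as functions on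
  the whole type they are normalized to be zero outside \<open>S\<close>.\<close>

definition cochains :: "'a::complex_algebra X set \<Rightarrow> (nat \<Rightarrow> 'a X set) \<Rightarrow> ('a X \<Rightarrow> complex) set"
  where "cochains S G = {\<tau>.
    (\<forall>\<xi>\<in>S. \<forall>\<eta>\<in>S. \<tau> (\<xi> + \<eta>) = \<tau> \<xi> + \<tau> \<eta>) \<and>
    (\<forall>c. \<forall>\<xi>\<in>S. \<tau> (c *\<^sub>C \<xi>) = c * \<tau> \<xi>) \<and>
    (\<forall>\<xi>. \<xi> \<notin> S \<longrightarrow> \<tau> \<xi> = 0) \<and>
    (\<exists>k. \<forall>\<xi>\<in>S \<inter> G k. \<tau> \<xi> = 0)}"

definition cobd :: "'a::complex_algebra X set \<Rightarrow> ('a X \<Rightarrow> complex) \<Rightarrow> 'a X \<Rightarrow> complex"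
  where "cobd S \<tau> = (\<lambda>\<xi>. if \<xi> \<in> S then \<tau> (X_boundary \<xi>) else 0)"

definition cocycles :: "'a::complex_algebra X set \<Rightarrow> (nat \<Rightarrow> 'a X set) \<Rightarrow> ('a X \<Rightarrow> complex) set"
  where "cocycles S G = {\<tau> \<in> cochains S G. cobd S \<tau> = (\<lambda>_. 0)}"

definition cohom_rel ::
    "'a::complex_algebra X set \<Rightarrow> (nat \<Rightarrow> 'a X set) \<Rightarrow> (('a X \<Rightarrow> complex) \<times> ('a X \<Rightarrow> complex)) set"
  where "cohom_rel S G = {(\<tau>, \<tau>'). \<tau> \<in> cocycles S G \<and> \<tau>' \<in> cocycles S G \<and>
    (\<lambda>\<xi>. \<tau> \<xi> - \<tau>' \<xi>) \<in> cobd S ` cochains S G}"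

text \<open>The total cohomology, the direct sum of its parts of degree 0 and 1.\<close>

definition cohom ::
    "'a::complex_algebra X set \<Rightarrow> (nat \<Rightarrow> 'a X set) \<Rightarrow> ('a X \<Rightarrow> complex) set set"
  where "cohom S G = cocycles S G // cohom_rel S G"

definition coh_class ::
    "'a::complex_algebra X set \<Rightarrow> (nat \<Rightarrow> 'a X set) \<Rightarrow> ('a X \<Rightarrow> complex) \<Rightarrow> ('a X \<Rightarrow> complex) set"
  where "coh_class S G \<tau> = cohom_rel S G `` {\<tau>}"

definition X_part :: "bit \<Rightarrow> 'a::complex_algebra X set"
  where "X_part i = (if i = 0 then UNIV \<times> {0} else {0} \<times> UNIV)"

definition homogeneous :: "bit \<Rightarrow> ('a::complex_algebra X \<Rightarrow> complex) \<Rightarrow> bool"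
  where "homogeneous i \<tau> \<longleftrightarrow> (\<forall>\<xi>\<in>X_part (i + 1). \<tau> \<xi> = 0)"

text \<open>The part of degree \<open>i\<close> of the cohomology, as a subspace of the total cohomology.\<close>

definition cohom_deg ::
    "bit \<Rightarrow> 'a::complex_algebra X set \<Rightarrow> (nat \<Rightarrow> 'a X set) \<Rightarrow> ('a X \<Rightarrow> complex) set set"
  where "cohom_deg i S G = coh_class S G ` {\<tau> \<in> cocycles S G. homogeneous i \<tau>}"

definition coh_zero ::
    "'a::complex_algebra X set \<Rightarrow> (nat \<Rightarrow> 'a X set) \<Rightarrow> ('a X \<Rightarrow> complex) set"
  where "coh_zero S G = coh_class S G (\<lambda>_. 0)"

definition coh_add ::
    "'a::complex_algebra X set \<Rightarrow> (nat \<Rightarrow> 'a X set) \<Rightarrow>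
     ('a X \<Rightarrow> complex) set \<Rightarrow> ('a X \<Rightarrow> complex) set \<Rightarrow> ('a X \<Rightarrow> complex) set"
  where "coh_add S G c c' = (\<Union>\<tau>\<in>c. \<Union>\<tau>'\<in>c'. coh_class S G (\<lambda>\<xi>. \<tau> \<xi> + \<tau>' \<xi>))"

definition coh_scale ::
    "'a::complex_algebra X set \<Rightarrow> (nat \<Rightarrow> 'a X set) \<Rightarrow>
     complex \<Rightarrow> ('a X \<Rightarrow> complex) set \<Rightarrow> ('a X \<Rightarrow> complex) set"
  where "coh_scale S G a c = (\<Union>\<tau>\<in>c. coh_class S G (\<lambda>\<xi>. a * \<tau> \<xi>))"

definition coh_linear ::
    "'a::complex_algebra X set \<Rightarrow> (nat \<Rightarrow> 'a X set) \<Rightarrow>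
     'b::complex_algebra X set \<Rightarrow> (nat \<Rightarrow> 'b X set) \<Rightarrow>
     (('a X \<Rightarrow> complex) set \<Rightarrow> ('b X \<Rightarrow> complex) set) \<Rightarrow> bool"
  where "coh_linear S G S' G' \<Phi> \<longleftrightarrow>
    (\<forall>c\<in>cohom S G. \<Phi> c \<in> cohom S' G') \<and>
    (\<forall>c\<in>cohom S G. \<forall>c'\<in>cohom S G. \<Phi> (coh_add S G c c') = coh_add S' G' (\<Phi> c) (\<Phi> c')) \<and>
    (\<forall>a. \<forall>c\<in>cohom S G. \<Phi> (coh_scale S G a c) = coh_scale S' G' a (\<Phi> c))"

definition coh_restrict ::
    "'a::complex_algebra X set \<Rightarrow> (nat \<Rightarrow> 'a X set) \<Rightarrow> ('a X \<Rightarrow> complex) set \<Rightarrow> ('a X \<Rightarrow> complex) set"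
  where "coh_restrict S' G c = (\<Union>\<tau>\<in>c. coh_class S' G (\<lambda>\<xi>. if \<xi> \<in> S' then \<tau> \<xi> else 0))"


section \<open>Liftings and the connecting morphism\<close>

definition extension ::
    "('i::complex_algebra \<Rightarrow> 'e::complex_algebra) \<Rightarrow> ('e \<Rightarrow> 'q::complex_algebra) \<Rightarrow> bool"
  where "extension f g \<longleftrightarrow>
    alg_hom f \<and> alg_hom g \<and> inj f \<and> surj g \<and> range f = {x. g x = 0}"

text \<open>The arguments are named after their source and target in the diagram with rows
  \<open>J \<rightarrow> N \<rightarrow> Q\<close>, \<open>R \<rightarrow> M \<rightarrow> P\<close>, \<open>B \<rightarrow> E \<rightarrow> A\<close> and columns \<open>J \<rightarrow> R \<rightarrow> B\<close>, \<open>N \<rightarrow> M \<rightarrow> E\<close>, \<open>Q \<rightarrow> P \<rightarrow> A\<close>.\<close>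

definition lifting ::
    "('j::complex_algebra \<Rightarrow> 'n::complex_algebra) \<Rightarrow> ('n \<Rightarrow> 'q::complex_algebra) \<Rightarrow>
     ('r::complex_algebra \<Rightarrow> 'm::complex_algebra) \<Rightarrow> ('m \<Rightarrow> 'p::complex_algebra) \<Rightarrow>
     ('b::complex_algebra \<Rightarrow> 'e::complex_algebra) \<Rightarrow> ('e \<Rightarrow> 'a::complex_algebra) \<Rightarrow>
     ('j \<Rightarrow> 'r) \<Rightarrow> ('r \<Rightarrow> 'b) \<Rightarrow> ('n \<Rightarrow> 'm) \<Rightarrow> ('m \<Rightarrow> 'e) \<Rightarrow> ('q \<Rightarrow> 'p) \<Rightarrow> ('p \<Rightarrow> 'a) \<Rightarrow> bool"
  where "lifting j_n n_q r_m m_p b_e e_a j_r r_b n_m m_e q_p p_a \<longleftrightarrow>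
    extension j_n n_q \<and> extension r_m m_p \<and> extension b_e e_a \<and>
    extension j_r r_b \<and> extension n_m m_e \<and> extension q_p p_a \<and>
    r_m \<circ> j_r = n_m \<circ> j_n \<and> m_p \<circ> n_m = q_p \<circ> n_q \<and>
    b_e \<circ> r_b = m_e \<circ> r_m \<and> e_a \<circ> m_e = p_a \<circ> m_p"

definition linear_splitting ::
    "('m::complex_vector \<Rightarrow> 'a::complex_vector) \<Rightarrow> ('a \<Rightarrow> 'm) \<Rightarrow> bool"
  where "linear_splitting \<pi> \<sigma> \<longleftrightarrow> clinear \<sigma> \<and> (\<forall>a. \<pi> (\<sigma> a) = a)"

text \<open>A renormalization need not be homogeneous, even if \<open>\<tau>\<close> is.\<close>

definition renormalizations ::
    "'m::complex_algebra set \<Rightarrow> 'm set \<Rightarrow> nat \<Rightarrow> ('m X \<Rightarrow> complex) \<Rightarrow> ('m X \<Rightarrow> complex) set"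
  where "renormalizations R N n \<tau> =
    {\<rho> \<in> cochains UNIV (X_filt N). \<forall>\<xi>\<in>X_filt R n. \<rho> \<xi> = \<tau> \<xi>}"

definition renormalized_pullback ::
    "('a::complex_algebra \<Rightarrow> 'm::complex_algebra) \<Rightarrow> ('m X \<Rightarrow> complex) \<Rightarrow>
     'a tensor_algebra X \<Rightarrow> complex"
  where "renormalized_pullback \<sigma> \<rho> = cobd UNIV \<rho> \<circ> X_map (T_ext \<sigma>)"

text \<open>Periodic cyclic cohomology is the cohomology of the X-complex of the tensor algebra,
  completed along the kernel of the multiplication map.\<close>

abbreviation HP_class :: "('a::complex_algebra tensor_algebra X \<Rightarrow> complex) \<Rightarrow> _"
  where "HP_class \<equiv> coh_class UNIV (X_filt T_kernel)"

abbreviation HP_deg :: "bit \<Rightarrow> ('a::complex_algebra tensor_algebra X \<Rightarrow> complex) set set"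
  where "HP_deg i \<equiv> cohom_deg i UNIV (X_filt T_kernel)"

text \<open>A map that descends to cohomology classes is written, as usual for quotients, as the union
  over all representatives (and here over all renormalizations) of a common value.\<close>

definition E_map ::
    "'m::complex_algebra set \<Rightarrow> 'm set \<Rightarrow> ('a::complex_algebra \<Rightarrow> 'm) \<Rightarrow> nat \<Rightarrow>
     ('m X \<Rightarrow> complex) set \<Rightarrow> ('a tensor_algebra X \<Rightarrow> complex) set"
  where "E_map R N \<sigma> n c =
    (\<Union>\<tau>\<in>c. \<Union>\<rho>\<in>renormalizations R N n \<tau>. HP_class (renormalized_pullback \<sigma> \<rho>))"

end

theory Submission
  imports Defs "HOL-Analysis.Henstock_Kurzweil_Integration"
begin

text \<open>
  A change of representative and of renormalization alters \<open>\<rho>\<close> by a functional \<open>\<kappa>\<close> that vanishes on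
  \<open>F\<^sub>R\<^sup>n + F\<^sub>N\<^sup>k\<close>, up to the coboundary of a renormalization of the cochain relating the two
  cocycles; so the pullback of \<open>\<rho>\<partial>\<close> changes by the coboundary of \<open>\<kappa> \<circ> \<sigma>\<^sub>*\<close>.

  Two splittings \<open>\<sigma>\<^sub>0, \<sigma>\<^sub>1\<close> are joined by the splittings \<open>\<sigma>\<^sub>t = \<sigma>\<^sub>0 + t\<delta>\<close> with \<open>\<delta> = \<sigma>\<^sub>1 - \<sigma>\<^sub>0\<close>. Since the tensor
  algebra is free, the derivative of \<open>\<sigma>\<^sub>t\<^sub>*\<close> on the X-complexes is \<open>\<partial>h\<^sub>t + h\<^sub>t\<partial>\<close> for an explicit
  \<open>h\<^sub>t\<close>: with \<open>f\<close> the homomorphism induced by \<open>\<sigma>\<^sub>t\<close>,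
  \<open>h\<^sub>t(\<natural> x da) = f(x) \<delta>(a)\<close> for a letter \<open>a\<close>, and
  \<open>h\<^sub>t(a\<^sub>1\<dots>a\<^sub>k) = \<Sum>\<^sub>i \<natural> f(a\<^sub>1\<dots>a\<^sub>i\<^sub>-\<^sub>1) \<delta>(a\<^sub>i) d f(a\<^sub>i\<^sub>+\<^sub>1\<dots>a\<^sub>k)\<close>.
  It is continuous for the adic filtrations because \<open>\<delta>\<close> takes values in \<open>R + N\<close>. For a cocycle \<open>c\<close> the
  integral of \<open>c \<circ> h\<^sub>t\<close> over \<open>[0,1]\<close> is a cochain whose coboundary is \<open>c \<circ> \<sigma>\<^sub>1\<^sub>* - c \<circ> \<sigma>\<^sub>0\<^sub>*\<close>.

  If the extension splits, the splitting lifts to some \<open>\<sigma>\<close> for which the induced homomorphism maps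
  the kernel \<open>J\<close> of the multiplication into \<open>N\<close>; then \<open>\<rho> \<circ> \<sigma>\<^sub>*\<close> itself is a continuous cochain, and its
  coboundary is the cocycle in question.
\<close>

section \<open>Ideals and the adic filtrations of the X-complex\<close>

lemma cbilinear_times: "cbilinear ((*) :: 'a::complex_algebra \<Rightarrow> 'a \<Rightarrow> 'a)"
  by (rule cbilinearI) (simp_all add: distrib_left distrib_right)

definition alg_ideal :: "'a::complex_algebra set \<Rightarrow> bool"
  where "alg_ideal J \<longleftrightarrow> cvec.subspace J \<and> (\<forall>x\<in>J. \<forall>y. x * y \<in> J \<and> y * x \<in> J)"

lemma alg_ideal_mult: "alg_ideal J \<Longrightarrow> x \<in> J \<Longrightarrow> x * y \<in> J" "alg_ideal J \<Longrightarrow> x \<in> J \<Longrightarrow> y * x \<in> J"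
  by (auto simp: alg_ideal_def)

lemma alg_ideal_subspace: "alg_ideal J \<Longrightarrow> cvec.subspace J"
  by (simp add: alg_ideal_def)

lemma alg_ideal_span: "alg_ideal J \<Longrightarrow> cspan J = J"
  by (simp add: alg_ideal_def cvec.span_eq_iff)

lemma alg_ideal_kernel: "alg_hom f \<Longrightarrow> alg_ideal {x. f x = 0}"
  unfolding alg_ideal_def cvec.subspace_def alg_hom_def
  by (auto simp: clinear_simps)

text \<open>Associativity moves an extra factor past a generator of a product span. The predicates
  stay general because the same fact serves both the ideal property of powers and their
  multiplicativity.\<close>

lemma span_product:
  fixes x y z :: "'a::complex_algebra"
  shows "P x \<Longrightarrow> Q (y * z) \<Longrightarrow> x * y * z \<in> cspan {x * y | x y. P x \<and> Q y}"
    and "P (x * y) \<Longrightarrow> Q z \<Longrightarrow> x * (y * z) \<in> cspan {x * y | x y. P x \<and> Q y}"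
  by (intro cvec.span_base; metis (mono_tags, lifting) mem_Collect_eq mult.assoc)+

lemma alg_ideal_ideal_pow:
  assumes "alg_ideal J"
  shows "alg_ideal (ideal_pow J n)"
  using assms
proof (induction J n rule: ideal_pow.induct)
  case (3 J n)
  let ?S = "{x * y | x y. x \<in> J \<and> y \<in> ideal_pow J (Suc n)}"
  have IH: "alg_ideal (ideal_pow J (Suc n))" using 3 by simp
  have "x * y \<in> cspan ?S \<and> y * x \<in> cspan ?S" if "x \<in> cspan ?S" for x y
  proof
    show "x * y \<in> cspan ?S"
      by (rule clinear_maps_span[of "\<lambda>x. x * y", OF _ _ that])
        (auto simp: distrib_right intro!: clinearI span_product(1) alg_ideal_mult(1)[OF IH])
    show "y * x \<in> cspan ?S"
      by (rule clinear_maps_span[of "\<lambda>x. y * x", OF _ _ that])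
        (auto simp: distrib_left intro!: clinearI span_product(2) alg_ideal_mult(2)[OF 3(2)])
  qed
  then show ?case by (simp add: alg_ideal_def cvec.subspace_span)
qed (auto simp: alg_ideal_def)

lemma ideal_pow_Suc_subset:
  assumes "alg_ideal J"
  shows "ideal_pow J (Suc n) \<subseteq> ideal_pow J n"
proof (cases n)
  case (Suc m)
  have I: "alg_ideal (ideal_pow J (Suc m))"
    by (rule alg_ideal_ideal_pow[OF assms])
  show ?thesis
    unfolding Suc ideal_pow.simps(3)
    by (rule cvec.span_minimal) (auto intro: alg_ideal_mult[OF I] simp: alg_ideal_subspace[OF I])
qed simp

lemma ideal_pow_antimono: "alg_ideal J \<Longrightarrow> m \<le> n \<Longrightarrow> ideal_pow J n \<subseteq> ideal_pow J m"
  by (rule lift_Suc_antimono_le) (rule ideal_pow_Suc_subset)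

text \<open>Induction along the recursion of \<open>ideal_pow\<close>: the leading factor from
  \<open>J\<close> stays in place while \<open>y\<close> is absorbed into the remaining power. For
  \<open>p = 0\<close> the claim is that powers are ideals.\<close>

lemma ideal_pow_mult:
  assumes "alg_ideal J" "x \<in> ideal_pow J p" "y \<in> ideal_pow J q"
  shows "x * y \<in> ideal_pow J (p + q)"
  using assms
proof (induction J p arbitrary: x y rule: ideal_pow.induct)
  case (1 J)
  then show ?case by (simp add: alg_ideal_mult[OF alg_ideal_ideal_pow])
next
  case (2 J)
  then show ?case
    by (cases q) (auto intro: alg_ideal_mult cvec.span_base)
next
  case (3 J n)
  have "x * y \<in> cspan {x * y | x y. x \<in> J \<and> y \<in> ideal_pow J (Suc (n + q))}"
    by (rule clinear_maps_span[of "\<lambda>x. x * y", OF _ _ "3.prems"(2)[unfolded ideal_pow.simps]])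
      (use 3 in \<open>auto simp: distrib_right intro!: clinearI span_product(1)\<close>)
  then show ?case by simp
qed

lemma incl_linear: "clinear incl"
  by (rule clinearI) (simp_all add: incl_simps)

lemma incl_mult: "incl (x * y) = incl x * incl y"
  by (simp add: incl_simps)

lemma alg_part_simps [simp]:
  "alg_part (x + y) = alg_part x + alg_part y" "alg_part (c *\<^sub>C x) = c *\<^sub>C alg_part x"
  "alg_part (x - y) = alg_part x - alg_part y" "alg_part 0 = 0" "alg_part 1 = 0"
  "alg_part (incl a) = a" "scalar_part (incl a) = 0" "scalar_part (1::'a::complex_algebra unitization) = 1"
  "scalar_part (x + y) = scalar_part x + scalar_part y" "scalar_part (c *\<^sub>C x) = c * scalar_part x"
  "scalar_part (x - y) = scalar_part x - scalar_part y" "scalar_part 0 = 0"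
  "scalar_part (x * y) = scalar_part x * scalar_part y"
  "alg_part (x * y) = alg_part x * alg_part y + scalar_part x *\<^sub>C alg_part y + scalar_part y *\<^sub>C alg_part x"
  by (simp_all add: zero_unitization_def one_unitization_def plus_unitization_def incl_def
      minus_unitization_def scaleC_unitization_def times_unitization_def)

lemma unitization_decomp: "x = incl (alg_part x) + scalar_part x *\<^sub>C 1"
  by (simp add: unitization_eq_iff)

lemma mem_ideal_pow_plus:
  "x \<in> ideal_pow_plus J n \<longleftrightarrow> alg_part x \<in> ideal_pow J n \<and> (n > 0 \<longrightarrow> scalar_part x = 0)"
  by (auto simp: ideal_pow_plus_def unitization_eq_iff incl_def intro!: image_eqI)

lemma ideal_pow_plus_mult:
  assumes "alg_ideal J" "x \<in> ideal_pow_plus J p" "y \<in> ideal_pow_plus J q"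
  shows "x * y \<in> ideal_pow_plus J (p + q)"
proof -
  note I = alg_ideal_ideal_pow[OF assms(1)]
  note S = alg_ideal_subspace[OF I]
  show ?thesis
    using assms ideal_pow_mult[of J "alg_part x" p "alg_part y" q]
    by (cases p; cases q) (auto simp: mem_ideal_pow_plus cvec.subspace_0[OF S]
      intro!: cvec.subspace_add[OF S] cvec.subspace_scale[OF S])
qed

lemma subspace_ideal_pow_plus: "alg_ideal J \<Longrightarrow> cvec.subspace (ideal_pow_plus J n)"
  using alg_ideal_subspace[OF alg_ideal_ideal_pow[of J n]]
  by (auto simp: cvec.subspace_def mem_ideal_pow_plus)

lemma ideal_pow_plus_antimono: "alg_ideal J \<Longrightarrow> m \<le> n \<Longrightarrow> ideal_pow_plus J n \<subseteq> ideal_pow_plus J m"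
  using ideal_pow_antimono[of J m n] by (auto simp: mem_ideal_pow_plus)

lemma clinear_alg_part: "clinear alg_part"
  by (rule clinearI) simp_all

section \<open>Classes of one-forms and their adic orders\<close>

lemma natd_simps:
  "natd (x + x') y = natd x y + natd x' y" "natd x (y + y') = natd x y + natd x y'"
  "natd (c *\<^sub>C x) y = c *\<^sub>C natd x y" "natd x (c *\<^sub>C y) = c *\<^sub>C natd x y"
  by (simp_all add: cbilinear_simps[OF cbilinear_natd])

lemma clinear_natd: "clinear (natd x)" "clinear (\<lambda>x. natd x y)"
  using cbilinear_natd by (auto simp: cbilinear_def)

lemma natd_0 [simp]: "natd x 0 = 0" "natd 0 y = 0"
  using clinear_0[OF clinear_natd(1)] clinear_0[OF clinear_natd(2)] by auto

lemma natd_mult: "natd x (y * z) = natd (incl z * x) y + natd (x * incl y) z"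
  using natd_trace[of z x y] by simp

text \<open>The odd part of the even step \<open>X_filt J (2 * n)\<close>. Continuity of maps is
  later estimated in odd degree through these subspaces alone.\<close>

definition G_filt :: "'a::complex_algebra set \<Rightarrow> nat \<Rightarrow> 'a one_forms_nat set"
  where "G_filt J n = cspan {natd x y | x y. x \<in> ideal_pow_plus J n}"

lemma G_filt_natd: "x \<in> ideal_pow_plus J n \<Longrightarrow> natd x y \<in> G_filt J n"
  by (auto simp: G_filt_def intro: cvec.span_base)

lemma subspace_G_filt: "cvec.subspace (G_filt J n)"
  by (simp add: G_filt_def cvec.subspace_span)

lemma G_filt_antimono: "alg_ideal J \<Longrightarrow> m \<le> n \<Longrightarrow> G_filt J n \<subseteq> G_filt J m"
  unfolding G_filt_def using ideal_pow_plus_antimono[of J m n] by (intro cvec.span_mono) blast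

text \<open>The Leibniz rule and the trace property move all factors of \<open>y\<close> but one out
  from under the differential. The one left behind is why \<open>Suc p\<close> factors raise the
  order of the coefficient only by \<open>p\<close>; it still lies in \<open>J\<close>, as the odd
  filtration steps require.\<close>

lemma natd_ideal_pow:
  assumes "alg_ideal J" "x \<in> ideal_pow_plus J q" "y \<in> ideal_pow J (Suc p)"
  shows "natd x y \<in> cspan {natd x y | x y. x \<in> ideal_pow_plus J (q + p) \<and> y \<in> J}"
  using assms(2,3)
proof (induction p arbitrary: x y q)
  case 0
  then show ?case by (auto intro: cvec.span_base)
next
  case (Suc p)
  show ?case
  proof (rule clinear_maps_span[OF clinear_natd(1) _ Suc.prems(2)[unfolded ideal_pow.simps]])
    fix w assume "w \<in> {k * y | k y. k \<in> J \<and> y \<in> ideal_pow J (Suc p)}"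
    then obtain k y where w: "w = k * y" "k \<in> J" "y \<in> ideal_pow J (Suc p)" by blast
    have k: "incl k \<in> ideal_pow_plus J 1" and y: "incl y \<in> ideal_pow_plus J (Suc p)"
      using w by (simp_all add: mem_ideal_pow_plus)
    \<comment> \<open>The class of \<open>x d(k y)\<close> is that of \<open>(x k) dy\<close> plus
      that of \<open>(y x) dk\<close>. The first falls to the induction hypothesis with
      \<open>q\<close> raised by one; the second already has \<open>k\<close> in \<open>J\<close>
      under the differential.\<close>
    have "natd (x * incl k) y \<in> cspan {natd x y | x y. x \<in> ideal_pow_plus J (Suc q + p) \<and> y \<in> J}"
      using Suc.IH[OF _ w(3), of "x * incl k" "Suc q"]
        ideal_pow_plus_mult[OF assms(1) Suc.prems(1) k] by simp
    moreover have "natd (incl y * x) k \<in> cspan {natd x y | x y. x \<in> ideal_pow_plus J (Suc q + p) \<and> y \<in> J}"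
      using ideal_pow_plus_mult[OF assms(1) y Suc.prems(1)] w(2)
      by (intro cvec.span_base) (auto simp: add.commute)
    ultimately show "natd x w \<in> cspan {natd x y | x y. x \<in> ideal_pow_plus J (q + Suc p) \<and> y \<in> J}"
      by (simp add: w(1) natd_mult cvec.span_add)
  qed
qed

lemma natd_ideal_pow_G:
  assumes "alg_ideal J" "x \<in> ideal_pow_plus J q" "y \<in> ideal_pow J (Suc p)"
  shows "natd x y \<in> G_filt J (q + p)"
  using natd_ideal_pow[OF assms] unfolding G_filt_def
  by (rule rev_subsetD) (intro cvec.span_mono, blast)

lemma X_filt_even:
  "X_filt J (2 * n) = cspan (ideal_pow J (Suc n) \<union> {commutator x y | x y. x \<in> ideal_pow J n}) \<times> G_filt J n"
  by (simp add: X_filt_def G_filt_def)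

lemma X_filt_odd:
  "X_filt J (Suc (2 * n)) = ideal_pow J (Suc n) \<times>
      cspan ({natd x y | x y. x \<in> ideal_pow_plus J (Suc n)} \<union>
        {natd x y | x y. x \<in> ideal_pow_plus J n \<and> y \<in> J})"
  by (simp add: X_filt_def)

lemma subspace_Times: "cvec.subspace S \<Longrightarrow> cvec.subspace T \<Longrightarrow> cvec.subspace (S \<times> T)"
  by (auto simp: cvec.subspace_def zero_prod_def scaleC_prod_def)

lemma X_filt_Times:
  obtains S T where "X_filt J k = S \<times> T"
  by (simp add: X_filt_def Let_def) metis

lemma subspace_X_filt:
  assumes "alg_ideal J"
  shows "cvec.subspace (X_filt J k)"
proof (cases "even k")
  case True
  then show ?thesis
    by (elim evenE) (simp add: X_filt_even subspace_Times cvec.subspace_span subspace_G_filt)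
next
  case False
  then show ?thesis
    by (elim oddE) (simp add: X_filt_odd subspace_Times cvec.subspace_span
      alg_ideal_subspace[OF alg_ideal_ideal_pow[OF assms]])
qed

text \<open>Commutators do not raise the order, so only order \<open>n\<close> is guaranteed here;
  that suffices for an even step to lie in the odd step before it.\<close>

lemma X_filt_even_fst:
  assumes "alg_ideal J"
  shows "cspan (ideal_pow J (Suc n) \<union> {commutator x y | x y. x \<in> ideal_pow J n}) \<subseteq> ideal_pow J n"
proof (rule cvec.span_minimal)
  note I = alg_ideal_ideal_pow[OF assms]
  show "ideal_pow J (Suc n) \<union> {commutator x y | x y. x \<in> ideal_pow J n} \<subseteq> ideal_pow J n"
    using ideal_pow_Suc_subset[OF assms, of n]
    by (auto simp: commutator_def intro!: cvec.subspace_diff alg_ideal_subspace[OF I]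
      intro: alg_ideal_mult[OF I])
qed (simp add: alg_ideal_subspace alg_ideal_ideal_pow assms)

lemma X_filt_Suc_subset:
  assumes "alg_ideal J"
  shows "X_filt J (Suc k) \<subseteq> X_filt J k"
proof (cases "even k")
  case True
  then obtain n where k: "k = 2 * n" by blast
  have "cspan ({natd x y | x y. x \<in> ideal_pow_plus J (Suc n)} \<union>
        {natd x y | x y. x \<in> ideal_pow_plus J n \<and> y \<in> J}) \<subseteq> G_filt J n"
    using ideal_pow_plus_antimono[OF assms, of n "Suc n"]
    by (intro cvec.span_minimal subspace_G_filt) (auto intro: G_filt_natd)
  then show ?thesis
    unfolding k X_filt_even X_filt_odd by (auto intro: cvec.span_base)
next
  case False
  then obtain n where k: "k = Suc (2 * n)" by (auto elim: oddE)
  have "X_filt J (Suc k) = X_filt J (2 * Suc n)" by (simp add: k)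
  then show ?thesis
    using X_filt_even_fst[OF assms, of "Suc n"]
    unfolding k X_filt_odd X_filt_even G_filt_def
    by (auto intro: subsetD[OF cvec.span_mono])
qed

lemma X_filt_antimono: "alg_ideal J \<Longrightarrow> m \<le> n \<Longrightarrow> X_filt J n \<subseteq> X_filt J m"
  by (rule lift_Suc_antimono_le) (rule X_filt_Suc_subset)

lemma clinear_bbar: "clinear bbar"
  unfolding bbar_def
  by (rule clinear_form_ext)
    (auto simp: trace_like_def commutator_def scaleC_add_right algebra_simps intro!: cbilinearI)

lemma natd_1_mult_commute: "natd 1 (x * y) = natd 1 (y * x)"
  by (simp add: natd_mult)

lemma clinear_X_boundary: "clinear X_boundary"
  by (rule clinearI) (simp_all add: X_boundary_def clinear_simps[OF clinear_bbar] natd_simps prod_eq_iff)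

text \<open>Representatives are expanded in the free vector space under both quotients. Linear
  identities on the odd part can then be checked on the classes \<open>natd x y\<close>.\<close>

lemma one_forms_nat_span: "\<omega> \<in> cspan {natd x y | x y. True}"
proof (induction \<omega>)
  case (1 t)
  have lin: "clinear abs_one_forms_nat"
    by (rule clinearI) (simp_all add: plus_one_forms_nat.abs_eq scaleC_one_forms_nat.abs_eq)
  have lin2: "clinear abs_tensor"
    by (rule clinearI) (simp_all add: plus_tensor.abs_eq scaleC_tensor.abs_eq)
  have "abs_one_forms_nat (abs_tensor p) \<in> cspan {natd x y | x y. True}" for p :: "('a unitization \<times> 'a) \<Rightarrow>\<^sub>0 complex"
  proof -
    have "clinear (\<lambda>p. abs_one_forms_nat (abs_tensor p :: 'a one_forms))"
      by (rule clinearI) (simp_all add: clinear_simps[OF lin] clinear_simps[OF lin2])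
    note expand = clinear_basis_expansion[OF this, of p]
    have "abs_one_forms_nat (abs_tensor (basis z)) \<in> cspan {natd x y | x y. True}" for z :: "'a unitization \<times> 'a"
      by (cases z) (auto simp: natd.abs_eq tens.abs_eq intro!: cvec.span_base)
    then show ?thesis
      unfolding expand free_ext_def by (intro cvec.span_sum cvec.span_scale)
  qed
  then show ?case
    by (metis Quotient3_abs_rep[OF Quotient3_tensor])
qed

lemma clinear_eq_natd:
  assumes "clinear f" "clinear g" "\<And>x y. f (natd x y) = g (natd x y)"
  shows "f \<omega> = g \<omega>"
proof -
  have "clinear (\<lambda>\<omega>. f \<omega> - g \<omega>)"
    by (rule clinearI) (simp_all add: clinear_simps[OF assms(1)] clinear_simps[OF assms(2)]
      cvec.scale_right_diff_distrib)
  from clinear_zero_span[OF this _ one_forms_nat_span[of \<omega>]] show ?thesis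
    using assms(3) by auto
qed

lemma X_boundary_boundary [simp]: "X_boundary (X_boundary \<xi>) = 0"
proof -
  have "natd 1 (bbar \<omega>) = 0" for \<omega> :: "'a one_forms_nat"
    by (rule clinear_eq_natd[where f = "\<lambda>\<omega>. natd 1 (bbar \<omega>)" and g = "\<lambda>_. 0"])
      (auto intro!: clinearI simp: clinear_simps[OF clinear_bbar] natd_simps bbar_natd
        commutator_def clinear_diff[OF clinear_natd(1)] natd_1_mult_commute)
  then show ?thesis
    by (simp add: X_boundary_def bbar_natd commutator_def zero_prod_def)
qed

text \<open>Checked on generators. In an even step \<open>bbar\<close> produces commutators, while
  \<open>natd 1\<close> kills commutators and loses one order on powers. In an odd step that lost
  factor survives under the differential, as an element of \<open>J\<close>.\<close>

lemma X_boundary_X_filt: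
  assumes "alg_ideal J" "\<xi> \<in> X_filt J k"
  shows "X_boundary \<xi> \<in> X_filt J k"
proof (cases "even k")
  case True
  then obtain n where k: "k = 2 * n" by blast
  have "bbar (snd \<xi>) \<in> cspan (ideal_pow J (Suc n) \<union> {commutator x y | x y. x \<in> ideal_pow J n})"
  proof (rule clinear_maps_span[OF clinear_bbar, of "{natd x y | x y. x \<in> ideal_pow_plus J n}"])
    show "snd \<xi> \<in> cspan {natd x y | x y. x \<in> ideal_pow_plus J n}"
      using assms(2) by (auto simp: k X_filt_even G_filt_def)
  next
    fix z assume "z \<in> {natd x y | x y. x \<in> ideal_pow_plus J n}"
    then show "bbar z \<in> cspan (ideal_pow J (Suc n) \<union> {commutator x y | x y. x \<in> ideal_pow J n})"
      by (intro cvec.span_base UnI2) (clarsimp simp: bbar_natd mem_ideal_pow_plus, blast)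
  qed
  moreover have "natd 1 (fst \<xi>) \<in> G_filt J n"
    unfolding G_filt_def
  proof (rule clinear_maps_span[OF clinear_natd(1),
      of "ideal_pow J (Suc n) \<union> {commutator x y | x y. x \<in> ideal_pow J n}"])
    fix z assume "z \<in> ideal_pow J (Suc n) \<union> {commutator x y | x y. x \<in> ideal_pow J n}"
    then consider "z \<in> ideal_pow J (Suc n)" | x y where "z = commutator x y" by blast
    then have "natd 1 z \<in> G_filt J n"
    proof cases
      case 1
      have "1 \<in> ideal_pow_plus J 0" by (simp add: mem_ideal_pow_plus)
      from natd_ideal_pow_G[OF assms(1) this 1] show ?thesis by simp
    next
      case 2
      have "natd 1 z = 0"
        by (simp add: 2 commutator_def clinear_diff[OF clinear_natd(1)] natd_1_mult_commute)
      then show ?thesis by (simp add: cvec.subspace_0 subspace_G_filt)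
    qed
    then show "natd 1 z \<in> cspan {natd x y | x y. x \<in> ideal_pow_plus J n}"
      by (simp add: G_filt_def)
  qed (use assms(2) in \<open>auto simp: k X_filt_even\<close>)
  ultimately show ?thesis
    by (simp add: k X_filt_even X_boundary_def)
next
  case False
  then obtain n where k: "k = Suc (2 * n)" by (auto elim: oddE)
  note I = alg_ideal_ideal_pow[OF assms(1)]
  have comm: "commutator (alg_part x) y \<in> ideal_pow J (Suc n)"
    if "x \<in> ideal_pow_plus J n \<and> y \<in> J \<or> x \<in> ideal_pow_plus J (Suc n)" for x y
  proof -
    have "alg_part x * y \<in> ideal_pow J (Suc n)" "y * alg_part x \<in> ideal_pow J (Suc n)"
      using that ideal_pow_mult[OF assms(1), of "alg_part x" n y 1]
        ideal_pow_mult[OF assms(1), of y 1 "alg_part x" n]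
      by (auto simp: mem_ideal_pow_plus intro: alg_ideal_mult[OF I])
    then show ?thesis
      by (simp add: commutator_def cvec.subspace_diff alg_ideal_subspace[OF I])
  qed
  have "bbar (snd \<xi>) \<in> cspan (ideal_pow J (Suc n))"
  proof (rule clinear_maps_span[OF clinear_bbar])
    show "snd \<xi> \<in> cspan ({natd x y | x y. x \<in> ideal_pow_plus J (Suc n)} \<union>
        {natd x y | x y. x \<in> ideal_pow_plus J n \<and> y \<in> J})"
      using assms(2) by (auto simp: k X_filt_odd)
  qed (use comm in \<open>auto simp: bbar_natd intro!: cvec.span_base\<close>)
  moreover have "natd 1 (fst \<xi>) \<in> cspan {natd x y | x y. x \<in> ideal_pow_plus J n \<and> y \<in> J}"
    using natd_ideal_pow[OF assms(1), of 1 0 "fst \<xi>" n] assms(2)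
    by (auto simp: k X_filt_odd mem_ideal_pow_plus)
  ultimately show ?thesis
    using cvec.span_mono[of "{natd x y | x y. x \<in> ideal_pow_plus J n \<and> y \<in> J}"
      "{natd x y | x y. x \<in> ideal_pow_plus J (Suc n)} \<union> {natd x y | x y. x \<in> ideal_pow_plus J n \<and> y \<in> J}"]
    by (auto simp: k X_filt_odd X_boundary_def alg_ideal_span[OF I])
qed

lemma X_filt_evenI:
  "x \<in> ideal_pow J (Suc n) \<Longrightarrow> \<omega> \<in> G_filt J n \<Longrightarrow> (x, \<omega>) \<in> X_filt J (2 * n)"
  by (auto simp: X_filt_even intro: cvec.span_base)

section \<open>Sums of two ideals and the diagonal filtration\<close>

definition ideal_sum :: "'a::complex_algebra set \<Rightarrow> 'a set \<Rightarrow> 'a set"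
  where "ideal_sum R N = {x + y | x y. x \<in> R \<and> y \<in> N}"

lemma alg_ideal_sum:
  assumes "alg_ideal R" "alg_ideal N"
  shows "alg_ideal (ideal_sum R N)"
proof -
  have "cvec.subspace (ideal_sum R N)"
    unfolding ideal_sum_def
    using cvec.subspace_sums[of R N] assms by (simp add: alg_ideal_def)
  moreover have "x * y \<in> ideal_sum R N \<and> y * x \<in> ideal_sum R N" if "x \<in> ideal_sum R N" for x y
    using that alg_ideal_mult[OF assms(1)] alg_ideal_mult[OF assms(2)]
    by (auto simp: ideal_sum_def distrib_left distrib_right) blast+
  ultimately show ?thesis by (simp add: alg_ideal_def)
qed

lemma ideal_sum_memI: "x \<in> R \<Longrightarrow> y \<in> N \<Longrightarrow> x + y \<in> ideal_sum R N"
  by (auto simp: ideal_sum_def)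

text \<open>A product of \<open>p + q\<close> sums expands into words with at least \<open>p\<close>
  factors from \<open>R\<close> or at least \<open>q\<close> factors from \<open>N\<close>.
  Induction on \<open>p + q\<close> replaces the expansion by peeling off one factor.\<close>

lemma ideal_pow_sum:
  assumes R: "alg_ideal R" and N: "alg_ideal N"
  shows "ideal_pow (ideal_sum R N) (p + q) \<subseteq> ideal_sum (ideal_pow R p) (ideal_pow N q)"
proof (induction "p + q" arbitrary: p q)
  case 0
  then show ?case
    by (auto simp: ideal_sum_def intro: exI[of _ 0])
next
  case (Suc k)
  note IR = alg_ideal_ideal_pow[OF R] and IN = alg_ideal_ideal_pow[OF N]
  note I = alg_ideal_sum[OF IR[of p] IN[of q]]
  show ?case
  proof (cases "p = 0 \<or> q = 0")
    case True
    have "x \<in> ideal_sum (ideal_pow R p) (ideal_pow N q)" for x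
      using True ideal_sum_memI[of x "ideal_pow R p" 0 "ideal_pow N q"]
        ideal_sum_memI[of 0 "ideal_pow R p" x "ideal_pow N q"]
        cvec.subspace_0[OF alg_ideal_subspace[OF IR]] cvec.subspace_0[OF alg_ideal_subspace[OF IN]]
      by (metis (no_types, lifting) UNIV_I add.left_neutral add.right_neutral ideal_pow.simps(1))
    then show ?thesis by blast
  next
    case False
    then obtain p' q' where p: "p = Suc p'" and q: "q = Suc q'" by (meson not0_implies_Suc)
    have sub: "ideal_pow R p \<subseteq> ideal_sum (ideal_pow R p) (ideal_pow N q)"
      "ideal_pow N q \<subseteq> ideal_sum (ideal_pow R p) (ideal_pow N q)"
      using ideal_sum_memI[of _ "ideal_pow R p" 0 "ideal_pow N q"]
        ideal_sum_memI[of 0 "ideal_pow R p" _ "ideal_pow N q"]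
        cvec.subspace_0[OF alg_ideal_subspace[OF IR]] cvec.subspace_0[OF alg_ideal_subspace[OF IN]]
      by auto
    have prod: "x * y \<in> ideal_sum (ideal_pow R p) (ideal_pow N q)"
      if x: "x \<in> ideal_sum R N" and y: "y \<in> ideal_pow (ideal_sum R N) (Suc (p' + q'))" for x y
    proof -
      obtain r m where x: "x = r + m" "r \<in> R" "m \<in> N" using x by (auto simp: ideal_sum_def)
      \<comment> \<open>The same \<open>y\<close> is decomposed twice: once with an
        \<open>R\<close>-power one short, to be multiplied by the \<open>R\<close>-part of
        \<open>x\<close>, and once with an \<open>N\<close>-power one short, for the
        \<open>N\<close>-part.\<close>
      have "y \<in> ideal_sum (ideal_pow R p') (ideal_pow N q)"
        using Suc.hyps(1)[of p' q] Suc.hyps(2) y by (auto simp: p q)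
      then obtain a b where ab: "y = a + b" "a \<in> ideal_pow R p'" "b \<in> ideal_pow N q"
        by (auto simp: ideal_sum_def)
      have "y \<in> ideal_sum (ideal_pow R p) (ideal_pow N q')"
        using Suc.hyps(1)[of p q'] Suc.hyps(2) y by (auto simp: p q)
      then obtain c d where cd: "y = c + d" "c \<in> ideal_pow R p" "d \<in> ideal_pow N q'"
        by (auto simp: ideal_sum_def)
      have "r * a \<in> ideal_pow R p" "r * b \<in> ideal_pow N q" "m * c \<in> ideal_pow R p" "m * d \<in> ideal_pow N q"
        using ideal_pow_mult[OF R, of r 1 a p'] ideal_pow_mult[OF N, of m 1 d q'] x ab cd
        by (auto simp: p q intro: alg_ideal_mult[OF IR] alg_ideal_mult[OF IN])
      then have "r * a + r * b + (m * c + m * d) \<in> ideal_sum (ideal_pow R p) (ideal_pow N q)"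
        using sub by (intro cvec.subspace_add[OF alg_ideal_subspace[OF I]]) auto
      moreover have "x * y = r * (a + b) + m * (c + d)"
        by (simp only: x distrib_right ab(1)[symmetric] cd(1)[symmetric])
      ultimately show ?thesis by (simp only: distrib_left)
    qed
    have "ideal_pow (ideal_sum R N) (p + q) = ideal_pow (ideal_sum R N) (Suc (Suc (p' + q')))"
      by (simp add: p q)
    also have "\<dots> \<subseteq> ideal_sum (ideal_pow R p) (ideal_pow N q)"
      unfolding ideal_pow.simps using prod
      by (intro cvec.span_minimal alg_ideal_subspace[OF I]) auto
    finally show ?thesis .
  qed
qed

text \<open>Only the coefficient of each generator is split; the form under the differential is left
  alone.\<close>

lemma G_filt_sum:
  assumes R: "alg_ideal R" and N: "alg_ideal N" and \<omega>: "\<omega> \<in> G_filt (ideal_sum R N) (p + p)"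
  shows "\<exists>\<alpha>\<in>G_filt R p. \<exists>\<beta>\<in>G_filt N p. \<omega> = \<alpha> + \<beta>"
  using \<omega>[unfolded G_filt_def]
proof (induction rule: cvec.span_induct_alt)
  case base
  then show ?case using cvec.subspace_0[OF subspace_G_filt] by (metis add_0)
next
  case (step c z \<omega>)
  then obtain \<alpha> \<beta> where ab: "\<alpha> \<in> G_filt R p" "\<beta> \<in> G_filt N p" "\<omega> = \<alpha> + \<beta>" by blast
  obtain x y where z: "z = natd x y" "x \<in> ideal_pow_plus (ideal_sum R N) (p + p)" using step by blast
  \<comment> \<open>For \<open>p = 0\<close> the coefficient may have a scalar part and goes
    entirely into the first summand; otherwise its scalar part vanishes and
    \<open>ideal_pow_sum\<close> applies.\<close>
  obtain r m where rm: "x = r + m" "r \<in> ideal_pow_plus R p" "m \<in> ideal_pow_plus N p"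
  proof (cases "p = 0")
    case True
    then show ?thesis using that[of x 0] by (simp add: mem_ideal_pow_plus)
  next
    case False
    then obtain a b where "alg_part x = a + b" "a \<in> ideal_pow R p" "b \<in> ideal_pow N p"
      using z(2) ideal_pow_sum[OF R N, of p p] by (auto simp: mem_ideal_pow_plus ideal_sum_def)
    then show ?thesis
      using z(2) False that[of "incl a" "incl b"]
      by (simp add: mem_ideal_pow_plus unitization_eq_iff)
  qed
  have "c *\<^sub>C z + \<omega> = (c *\<^sub>C natd r y + \<alpha>) + (c *\<^sub>C natd m y + \<beta>)"
    by (simp add: z rm natd_simps ab scaleC_add_right)
  moreover have "c *\<^sub>C natd r y + \<alpha> \<in> G_filt R p" "c *\<^sub>C natd m y + \<beta> \<in> G_filt N p"
    using ab rm by (auto intro!: cvec.subspace_add cvec.subspace_scale subspace_G_filt G_filt_natd)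
  ultimately show ?case by blast
qed

text \<open>Step \<open>m\<close> contains the even step \<open>2 * m\<close>, which asks for order
  \<open>m + 1\<close> in even and \<open>m\<close> in odd degree. Halving the exponents for
  \<open>R\<close> and \<open>N\<close> explains \<open>2 * m + 2\<close> and
  \<open>2 * m\<close>.\<close>

lemma mem_X_tilde:
  assumes R: "alg_ideal R" and N: "alg_ideal N"
    and x: "x \<in> ideal_pow (ideal_sum R N) (2 * m + 2)" and \<omega>: "\<omega> \<in> G_filt (ideal_sum R N) (2 * m)"
  shows "(x, \<omega>) \<in> X_tilde R N m"
proof -
  have "2 * m + 2 = Suc m + Suc m" by simp
  then have "x \<in> ideal_sum (ideal_pow R (Suc m)) (ideal_pow N (Suc m))"
    using x ideal_pow_sum[OF R N, of "Suc m" "Suc m"] by (metis subsetD)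
  then obtain a b where ab: "x = a + b" "a \<in> ideal_pow R (Suc m)" "b \<in> ideal_pow N (Suc m)"
    by (auto simp: ideal_sum_def)
  obtain \<alpha> \<beta> where \<alpha>\<beta>: "\<omega> = \<alpha> + \<beta>" "\<alpha> \<in> G_filt R m" "\<beta> \<in> G_filt N m"
    using G_filt_sum[OF R N, of \<omega> m] \<omega> by (auto simp: mult_2)
  have "(a, \<alpha>) \<in> X_filt R m" "(b, \<beta>) \<in> X_filt N m"
    using X_filt_evenI[OF ab(2) \<alpha>\<beta>(2)] X_filt_evenI[OF ab(3) \<alpha>\<beta>(3)]
      X_filt_antimono[OF R, of m "2 * m"] X_filt_antimono[OF N, of m "2 * m"] by auto
  then show ?thesis
    unfolding X_tilde_def ab(1) \<alpha>\<beta>(1) add_Pair[symmetric] by blast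
qed

section \<open>Functoriality of the X-complex\<close>

lemma alg_hom_linear: "alg_hom f \<Longrightarrow> clinear f"
  and alg_hom_mult: "alg_hom f \<Longrightarrow> f (x * y) = f x * f y"
  by (simp_all add: alg_hom_def)

lemma unitize_map_simps:
  assumes "alg_hom f"
  shows "unitize_map f (x + y) = unitize_map f x + unitize_map f y"
    "unitize_map f (c *\<^sub>C x) = c *\<^sub>C unitize_map f x"
    "unitize_map f (x * y) = unitize_map f x * unitize_map f y"
    "unitize_map f (incl a) = incl (f a)"
    "unitize_map f 1 = 1"
    "alg_part (unitize_map f x) = f (alg_part x)"
    "scalar_part (unitize_map f x) = scalar_part x"
  using assms
  by (simp_all add: unitize_map_def unitization_eq_iff alg_hom_mult clinear_simps[OF alg_hom_linear])

definition form_map :: "('a::complex_algebra \<Rightarrow> 'b::complex_algebra) \<Rightarrow> 'a one_forms_nat \<Rightarrow> 'b one_forms_nat"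
  where "form_map f = form_ext (\<lambda>x0 x1. natd (unitize_map f x0) (f x1))"

lemma trace_like_form_map:
  assumes "alg_hom f"
  shows "trace_like (\<lambda>x0 x1. natd (unitize_map f x0) (f x1))"
  by (auto simp: trace_like_def natd_mult natd_simps unitize_map_simps[OF assms] alg_hom_mult[OF assms]
      clinear_simps[OF alg_hom_linear[OF assms]] intro!: cbilinearI)

lemma form_map_natd: "alg_hom f \<Longrightarrow> form_map f (natd x y) = natd (unitize_map f x) (f y)"
  by (simp add: form_map_def form_ext_natd trace_like_form_map)

lemma clinear_form_map: "alg_hom f \<Longrightarrow> clinear (form_map f)"
  by (simp add: form_map_def clinear_form_ext trace_like_form_map)

lemma X_map_eq: "X_map f \<xi> = (f (fst \<xi>), form_map f (snd \<xi>))"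
  by (simp add: X_map_def form_map_def)

lemma clinear_X_map:
  assumes "alg_hom f"
  shows "clinear (X_map f)"
  by (rule clinearI) (simp_all add: X_map_eq prod_eq_iff clinear_simps[OF alg_hom_linear[OF assms]]
      clinear_simps[OF clinear_form_map[OF assms]])

lemma X_map_boundary:
  assumes "alg_hom f"
  shows "X_map f (X_boundary \<xi>) = X_boundary (X_map f \<xi>)"
proof -
  note lin = alg_hom_linear[OF assms] clinear_form_map[OF assms]
  have "f (bbar \<omega>) = bbar (form_map f \<omega>)" for \<omega>
    by (rule clinear_eq_natd[where f = "\<lambda>\<omega>. f (bbar \<omega>)" and g = "\<lambda>\<omega>. bbar (form_map f \<omega>)"])
      (auto intro!: clinearI simp: clinear_simps[OF lin(1)] clinear_simps[OF lin(2)]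
        clinear_simps[OF clinear_bbar] bbar_natd form_map_natd[OF assms] commutator_def
        alg_hom_mult[OF assms] unitize_map_simps[OF assms])
  then show ?thesis
    by (simp add: X_map_eq X_boundary_def form_map_natd[OF assms] unitize_map_simps[OF assms])
qed

lemma alg_hom_ideal_pow:
  assumes f: "alg_hom f" and "f ` J \<subseteq> J'"
  shows "x \<in> ideal_pow J n \<Longrightarrow> f x \<in> ideal_pow J' n"
  using assms(2)
proof (induction J n arbitrary: x rule: ideal_pow.induct)
  case (3 J n)
  show ?case
    unfolding ideal_pow.simps
    by (rule clinear_maps_span[OF alg_hom_linear[OF f] _ "3.prems"(1)[unfolded ideal_pow.simps]])
      (use 3 in \<open>auto 4 4 simp: alg_hom_mult[OF f] intro!: cvec.span_base\<close>)
qed auto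

lemma unitize_map_ideal_pow_plus:
  "alg_hom f \<Longrightarrow> f ` J \<subseteq> J' \<Longrightarrow> x \<in> ideal_pow_plus J n \<Longrightarrow> unitize_map f x \<in> ideal_pow_plus J' n"
  by (auto simp: mem_ideal_pow_plus unitize_map_simps alg_hom_ideal_pow)

lemma X_filt_evenD:
  assumes "alg_ideal J" "\<xi> \<in> X_filt J (2 * n)"
  shows "fst \<xi> \<in> ideal_pow J n" "snd \<xi> \<in> G_filt J n"
  using assms(2) subsetD[OF X_filt_even_fst[OF assms(1), of n], of "fst \<xi>"]
  by (auto simp: X_filt_even)

text \<open>The commutator part of the filtration is forgotten in the target, so that only plain
  orders have to be tracked; a shift of the index later makes up for this.\<close>

lemma X_map_X_filt:
  assumes f: "alg_hom f" "f ` J \<subseteq> J'" and J: "alg_ideal J" and \<xi>: "\<xi> \<in> X_filt J (2 * n)"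
  shows "X_map f \<xi> \<in> ideal_pow J' n \<times> G_filt J' n"
proof -
  have "f (fst \<xi>) \<in> ideal_pow J' n"
    by (rule alg_hom_ideal_pow[OF f X_filt_evenD(1)[OF J \<xi>]])
  moreover have "form_map f (snd \<xi>) \<in> G_filt J' n"
    unfolding G_filt_def
  proof (rule clinear_maps_span[OF clinear_form_map[OF f(1)]])
    show "snd \<xi> \<in> cspan {natd x y | x y. x \<in> ideal_pow_plus J n}"
      using X_filt_evenD(2)[OF J \<xi>] by (simp add: G_filt_def)
    fix z assume "z \<in> {natd x y | x y. x \<in> ideal_pow_plus J n}"
    then show "form_map f z \<in> cspan {natd x y | x y. x \<in> ideal_pow_plus J' n}"
      using unitize_map_ideal_pow_plus[OF f]
      by (intro cvec.span_base) (clarsimp simp: form_map_natd[OF f(1)], blast)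
  qed
  ultimately show ?thesis by (simp add: X_map_eq)
qed

section \<open>Linear maps on the tensor algebra\<close>

definition multilinear :: "('a::complex_vector list \<Rightarrow> 'v::complex_vector) \<Rightarrow> bool"
  where "multilinear g \<longleftrightarrow>
    (\<forall>u a b v. g (u @ (a + b) # v) = g (u @ a # v) + g (u @ b # v)) \<and>
    (\<forall>u c a v. g (u @ (c *\<^sub>C a) # v) = c *\<^sub>C g (u @ a # v))"

text \<open>The universal property of the tensor algebra as a vector space, extending
  \<open>T_ext\<close> from products of letters to arbitrary functions of words. It is meaningful
  for multilinear \<open>g\<close>, because a representative is chosen.\<close>

definition T_lift :: "('a::complex_vector list \<Rightarrow> 'v::complex_vector) \<Rightarrow> 'a tensor_algebra \<Rightarrow> 'v"
  where "T_lift g t = free_ext (\<lambda>w. g (Rep_word w)) (rep_tensor_algebra t)"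

abbreviation T_word :: "'a::complex_vector word \<Rightarrow> 'a tensor_algebra"
  where "T_word w \<equiv> abs_tensor_algebra (basis w)"

lemma T_lift_abs:
  assumes "multilinear g"
  shows "T_lift g (abs_tensor_algebra p) = free_ext (\<lambda>w. g (Rep_word w)) p"
proof -
  have "free_ext (\<lambda>w. g (Rep_word w)) r = 0" if "r \<in> multilinear_rels" for r
    using that assms
    by cases (simp_all add: free_ext_simps word_at.rep_eq multilinear_def)
  moreover have "rep_tensor_algebra (abs_tensor_algebra p) - p \<in> cspan multilinear_rels"
    by (rule rep_abs_rsp_left[OF Quotient3_tensor_algebra]) (simp add: cvec.span_zero)
  ultimately have "free_ext (\<lambda>w. g (Rep_word w)) (rep_tensor_algebra (abs_tensor_algebra p) - p) = 0"
    by (rule clinear_zero_span[OF clinear_free_ext])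
  then show ?thesis by (simp add: T_lift_def free_ext_simps)
qed

lemma T_lift_word: "multilinear g \<Longrightarrow> T_lift g (T_word w) = g (Rep_word w)"
  by (simp add: T_lift_abs)

lemma clinear_T_lift:
  assumes "multilinear g"
  shows "clinear (T_lift g)"
proof (rule clinearI)
  fix x y c
  show "T_lift g (x + y) = T_lift g x + T_lift g y"
    by (induction x, induction y)
      (simp add: plus_tensor_algebra.abs_eq T_lift_abs[OF assms] free_ext_simps)
  show "T_lift g (c *\<^sub>C x) = c *\<^sub>C T_lift g x"
    by (induction x) (simp add: scaleC_tensor_algebra.abs_eq T_lift_abs[OF assms] free_ext_simps)
qed

lemma T_lift_param_add: "T_lift (\<lambda>w. f w + g w) t = T_lift f t + T_lift g t"
  and T_lift_param_scaleC: "T_lift (\<lambda>w. c *\<^sub>C f w) t = c *\<^sub>C T_lift f t"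
  by (simp_all add: T_lift_def free_ext_map_add free_ext_map_scaleC)

text \<open>The value is a finite linear combination of values of \<open>g\<close>, so adic
  estimates reduce to single words.\<close>

lemma T_lift_subspace:
  "cvec.subspace S \<Longrightarrow> (\<And>w. g w \<in> S) \<Longrightarrow> T_lift g t \<in> S"
  unfolding T_lift_def free_ext_def
  by (intro cvec.subspace_sum cvec.subspace_scale) auto

lemma clinear_eq_T_word:
  assumes "clinear f" "clinear g" "\<And>w. f (T_word w) = g (T_word w)"
  shows "f t = g t"
proof (induction t)
  case (1 p)
  have lin: "clinear abs_tensor_algebra"
    by (rule clinearI) (simp_all add: plus_tensor_algebra.abs_eq scaleC_tensor_algebra.abs_eq)
  show ?case
    by (rule clinear_eq_basis[where f = "\<lambda>p. f (abs_tensor_algebra p)" and g = "\<lambda>p. g (abs_tensor_algebra p)"])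
      (auto intro!: clinearI simp: clinear_simps[OF lin] clinear_simps[OF assms(1)]
        clinear_simps[OF assms(2)] assms(3))
qed

lemma cbilinear_eq_T_word:
  assumes "cbilinear f" "cbilinear g" "\<And>v w. f (T_word v) (T_word w) = g (T_word v) (T_word w)"
  shows "f s t = g s t"
proof (rule clinear_eq_T_word[where f = "\<lambda>s. f s t" and g = "\<lambda>s. g s t"])
  fix v show "f (T_word v) t = g (T_word v) t"
    by (rule clinear_eq_T_word) (use assms in \<open>auto simp: cbilinear_def\<close>)
qed (use assms in \<open>auto simp: cbilinear_def\<close>)

lemma T_word_mult: "T_word v * T_word w = T_word (word_append v w)"
  by (simp add: times_tensor_algebra.abs_eq)

section \<open>The homotopy associated with an infinitesimal deformation\<close>

text \<open>Extending the second argument to the unitalization by \<open>d1 = 0\<close> preserves the trace property and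
  lets the empty word be treated like any other.\<close>

definition natd' :: "'a::complex_algebra unitization \<Rightarrow> 'a unitization \<Rightarrow> 'a one_forms_nat"
  where "natd' x y = natd x (alg_part y)"

lemma natd'_simps:
  "natd' (x + x') y = natd' x y + natd' x' y" "natd' x (y + y') = natd' x y + natd' x y'"
  "natd' (c *\<^sub>C x) y = c *\<^sub>C natd' x y" "natd' x (c *\<^sub>C y) = c *\<^sub>C natd' x y"
  "natd' x 0 = 0" "natd' 0 y = 0" "natd' x 1 = 0"
  by (simp_all add: natd'_def natd_simps)

text \<open>The Leibniz rule and the trace property in one formula. Splitting \<open>y\<close> and
  \<open>z\<close> into algebra and scalar parts reduces it to \<open>natd_mult\<close>; the scalar
  terms match because the differential kills \<open>1\<close>.\<close>

lemma natd'_mult: "natd' x (y * z) = natd' (z * x) y + natd' (x * y) z"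
proof -
  have y: "y = incl (alg_part y) + scalar_part y *\<^sub>C 1" and z: "z = incl (alg_part z) + scalar_part z *\<^sub>C 1"
    by (rule unitization_decomp)+
  have "natd' (z * x) y = natd (incl (alg_part z) * x) (alg_part y) + scalar_part z *\<^sub>C natd x (alg_part y)"
    by (subst z) (simp add: natd'_def distrib_right natd_simps)
  moreover have "natd' (x * y) z = natd (x * incl (alg_part y)) (alg_part z) + scalar_part y *\<^sub>C natd x (alg_part z)"
    by (subst y) (simp add: natd'_def distrib_left natd_simps)
  ultimately show ?thesis
    by (simp add: natd'_def natd_simps natd_mult)
qed

lemma bbar_natd': "bbar (natd' x y) = alg_part (x * y - y * x)"
  by (simp add: natd'_def bbar_natd commutator_def)

lemma G_filt_natd': "x \<in> ideal_pow_plus J n \<Longrightarrow> natd' x y \<in> G_filt J n"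
  by (simp add: natd'_def G_filt_natd)

text \<open>For a word \<open>w = a\<^sub>1\<dots>a\<^sub>k\<close> let \<open>S\<close> be the product of the \<open>s(a\<^sub>i)\<close> over a factor of \<open>w\<close>. Then
  \<open>word_cyc w x\<close> is the sum of \<open>S(a\<^sub>i\<^sub>+\<^sub>1\<dots>a\<^sub>k) x S(a\<^sub>1\<dots>a\<^sub>i\<^sub>-\<^sub>1) d(a\<^sub>i)\<close>, and \<open>word_form w x\<close> is the sum of
  \<open>natd' (x S(a\<^sub>1\<dots>a\<^sub>i\<^sub>-\<^sub>1) d(a\<^sub>i)) S(a\<^sub>i\<^sub>+\<^sub>1\<dots>a\<^sub>k)\<close>. The parameter \<open>x\<close> is what makes both recursions
  and their product formulas close up.\<close>

locale deformation =
  fixes s d :: "'a::complex_algebra \<Rightarrow> 'm::complex_algebra"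
  assumes linear_s: "clinear s" and linear_d: "clinear d"
begin

definition word_hom :: "'a list \<Rightarrow> 'm unitization"
  where "word_hom w = prod_list (map (\<lambda>a. incl (s a)) w)"

text \<open>The derivation along \<open>word_hom\<close> with value \<open>d a\<close> on a letter,
  which is the derivative of the product when \<open>s\<close> moves in direction
  \<open>d\<close>.\<close>

fun word_der :: "'a list \<Rightarrow> 'm unitization" where
  "word_der [] = 0"
| "word_der (a # w) = incl (d a) * word_hom w + incl (s a) * word_der w"

fun word_cyc :: "'a list \<Rightarrow> 'm unitization \<Rightarrow> 'm unitization" where
  "word_cyc [] x = 0"
| "word_cyc (a # w) x = word_hom w * x * incl (d a) + word_cyc w (x * incl (s a))"

fun word_form :: "'a list \<Rightarrow> 'm unitization \<Rightarrow> 'm one_forms_nat" where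
  "word_form [] x = 0"
| "word_form (a # w) x = natd' (x * incl (d a)) (word_hom w) + word_form w (x * incl (s a))"

lemma word_hom_simps [simp]:
  "word_hom [] = 1" "word_hom (a # w) = incl (s a) * word_hom w"
  "word_hom (v @ w) = word_hom v * word_hom w"
  by (simp_all add: word_hom_def)

lemmas incl_sd = clinear_simps(1,2)[OF linear_s] clinear_simps(1,2)[OF linear_d]
  clinear_simps(1,2)[OF incl_linear]

lemma word_linear:
  "word_cyc w (x + y) = word_cyc w x + word_cyc w y" "word_cyc w (c *\<^sub>C x) = c *\<^sub>C word_cyc w x"
  "word_form w (x + y) = word_form w x + word_form w y" "word_form w (c *\<^sub>C x) = c *\<^sub>C word_form w x"
  by (induction w arbitrary: x y)
    (simp_all add: distrib_left distrib_right natd'_simps scaleC_add_right)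

lemma multilinear_word_hom: "multilinear word_hom"
  unfolding multilinear_def by (simp add: incl_sd distrib_left distrib_right)

lemma multilinear_word_der: "multilinear word_der"
proof -
  have "word_der (u @ (a + b) # v) = word_der (u @ a # v) + word_der (u @ b # v)" for u a b v
    by (induction u) (simp_all add: incl_sd distrib_left distrib_right)
  moreover have "word_der (u @ (c *\<^sub>C a) # v) = c *\<^sub>C word_der (u @ a # v)" for u c a v
    by (induction u) (simp_all add: incl_sd scaleC_add_right)
  ultimately show ?thesis by (simp add: multilinear_def)
qed

lemma multilinear_word_cyc: "multilinear (\<lambda>w. word_cyc w x)"
proof -
  have "word_cyc (u @ (a + b) # v) x = word_cyc (u @ a # v) x + word_cyc (u @ b # v) x" for u a b v
    by (induction u arbitrary: x) (simp_all add: incl_sd distrib_left distrib_right word_linear)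
  moreover have "word_cyc (u @ (c *\<^sub>C a) # v) x = c *\<^sub>C word_cyc (u @ a # v) x" for u c a v
    by (induction u arbitrary: x) (simp_all add: incl_sd scaleC_add_right word_linear)
  ultimately show ?thesis by (simp add: multilinear_def)
qed

lemma multilinear_word_form: "multilinear (\<lambda>w. word_form w x)"
proof -
  have "word_form (u @ (a + b) # v) x = word_form (u @ a # v) x + word_form (u @ b # v) x" for u a b v
    by (induction u arbitrary: x) (simp_all add: incl_sd distrib_left distrib_right word_linear natd'_simps)
  moreover have "word_form (u @ (c *\<^sub>C a) # v) x = c *\<^sub>C word_form (u @ a # v) x" for u c a v
    by (induction u arbitrary: x) (simp_all add: incl_sd scaleC_add_right word_linear natd'_simps)
  ultimately show ?thesis by (simp add: multilinear_def)
qed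

text \<open>Read cyclically around \<open>x\<close>: for a letter of \<open>v\<close> the factor
  \<open>w\<close> comes directly before \<open>x\<close>, for a letter of \<open>w\<close> the
  factor \<open>v\<close> comes directly after it.\<close>

lemma word_cyc_append: "word_cyc (v @ w) x = word_cyc v (word_hom w * x) + word_cyc w (x * word_hom v)"
  by (induction v arbitrary: x) (simp_all add: mult.assoc)

text \<open>For a letter of \<open>v\<close> the product under the differential ends with that of
  \<open>w\<close>, and \<open>natd'_mult\<close> takes it apart. One half is the cyclic term for
  \<open>v\<close>, the other adds up to the cross term with \<open>word_der v\<close>.\<close>

lemma word_form_append:
  "word_form (v @ w) x = word_form v (word_hom w * x) + word_form w (x * word_hom v)
    + natd' (x * word_der v) (word_hom w)"
  by (induction v arbitrary: x) (simp_all add: mult.assoc natd'_mult natd'_simps distrib_left)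

text \<open>The differential of a product is invariant under cyclic rotation. Rotating each summand
  of \<open>word_cyc\<close> gives \<open>x\<close> times a summand of \<open>word_der w\<close>, to
  which the Leibniz rule applies.\<close>

lemma natd'_word_cyc: "natd' 1 (word_cyc w x) = natd' x (word_der w) + natd' (word_der w) x"
  by (induction w arbitrary: x) (simp_all add: natd'_simps natd'_mult mult.assoc)

text \<open>Each summand of \<open>word_form\<close> has a commutator as boundary; its first product
  belongs to \<open>x * word_der w\<close>, its second to \<open>word_cyc w x\<close>.\<close>

lemma bbar_word_form: "bbar (word_form w x) = alg_part (x * word_der w - word_cyc w x)"
proof (induction w arbitrary: x)
  case Nil
  then show ?case by (simp add: clinear_0[OF clinear_bbar])
next
  case (Cons a w)
  \<comment> \<open>The rewriting is restricted because the simplifier would expand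
    \<open>alg_part\<close> of products; the identity is proved in the unitalization and
    \<open>alg_part\<close> applied afterwards.\<close>
  have "bbar (word_form (a # w) x) = alg_part (x * incl (d a) * word_hom w - word_hom w * (x * incl (d a)))
      + alg_part (x * incl (s a) * word_der w - word_cyc w (x * incl (s a)))"
    by (simp only: word_form.simps clinear_add[OF clinear_bbar] bbar_natd' Cons)
  also have "\<dots> = alg_part ((x * incl (d a) * word_hom w - word_hom w * (x * incl (d a)))
      + (x * incl (s a) * word_der w - word_cyc w (x * incl (s a))))"
    by (simp only: alg_part_simps)
  also have "\<dots> = alg_part (x * word_der (a # w) - word_cyc (a # w) x)"
    by (rule arg_cong[where f = alg_part]) (simp add: algebra_simps)
  finally show ?case .
qed

abbreviation hom where "hom \<equiv> T_ext s"

definition der where "der = T_lift word_der"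
definition cyc where "cyc y x = T_lift (\<lambda>w. word_cyc w x) y"
definition form where "form y x = T_lift (\<lambda>w. word_form w x) y"

lemma alg_hom_hom: "alg_hom hom"
  by (rule alg_hom_T_ext[OF linear_s])

lemma incl_word_prod: "w \<noteq> [] \<Longrightarrow> incl (word_prod s w) = word_hom w"
proof (induction w rule: list_nonempty_induct)
  case (cons a w)
  then show ?case by (cases w) (simp_all add: incl_mult)
qed simp

lemma incl_hom_word: "incl (hom (T_word w)) = word_hom (Rep_word w)"
  by (simp add: T_ext_word[OF linear_s] incl_word_prod Rep_word_nonempty)

lemma clinear_der: "clinear der"
  unfolding der_def by (rule clinear_T_lift[OF multilinear_word_der])

lemma cbilinear_cyc: "cbilinear cyc" and cbilinear_form: "cbilinear form"
  unfolding cyc_def form_def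
  by (rule cbilinearI; simp add: clinear_simps[OF clinear_T_lift[OF multilinear_word_cyc]]
      clinear_simps[OF clinear_T_lift[OF multilinear_word_form]] word_linear
      T_lift_param_add T_lift_param_scaleC)+

lemmas lin_simps = clinear_simps(1,2)[OF clinear_der] cbilinear_simps[OF cbilinear_cyc]
  cbilinear_simps[OF cbilinear_form] clinear_simps(1,2)[OF alg_hom_linear[OF alg_hom_hom]]
  clinear_simps(1,2)[OF incl_linear]

lemma T_word_values:
  "der (T_word w) = word_der (Rep_word w)" "cyc (T_word w) x = word_cyc (Rep_word w) x"
  "form (T_word w) x = word_form (Rep_word w) x"
  by (simp_all add: der_def cyc_def form_def T_lift_word multilinear_word_der multilinear_word_cyc
      multilinear_word_form)

lemma cyc_mult: "cyc (y * z) x = cyc y (incl (hom z) * x) + cyc z (x * incl (hom y))"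
  by (rule cbilinear_eq_T_word[where f = "\<lambda>y z. cyc (y * z) x"
        and g = "\<lambda>y z. cyc y (incl (hom z) * x) + cyc z (x * incl (hom y))"])
    (auto intro!: cbilinearI simp: lin_simps distrib_left distrib_right scaleC_add_right T_word_mult
      T_word_values incl_hom_word word_append.rep_eq word_cyc_append)

lemma form_mult:
  "form (y * z) x = form y (incl (hom z) * x) + form z (x * incl (hom y)) + natd' (x * der y) (incl (hom z))"
  by (rule cbilinear_eq_T_word[where f = "\<lambda>y z. form (y * z) x"
        and g = "\<lambda>y z. form y (incl (hom z) * x) + form z (x * incl (hom y)) + natd' (x * der y) (incl (hom z))"])
    (auto intro!: cbilinearI simp: lin_simps distrib_left distrib_right scaleC_add_right T_word_mult
      T_word_values incl_hom_word word_append.rep_eq word_form_append natd'_simps)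

lemma natd'_cyc: "natd' 1 (cyc y x) = natd' x (der y) + natd' (der y) x"
  by (rule clinear_eq_T_word[where f = "\<lambda>y. natd' 1 (cyc y x)"
        and g = "\<lambda>y. natd' x (der y) + natd' (der y) x"])
    (auto intro!: clinearI simp: lin_simps natd'_simps scaleC_add_right T_word_values natd'_word_cyc)

lemma bbar_form: "bbar (form y x) = alg_part (x * der y - cyc y x)"
proof (rule clinear_eq_T_word[where f = "\<lambda>y. bbar (form y x)" and g = "\<lambda>y. alg_part (x * der y - cyc y x)"])
  have lin: "clinear (\<lambda>y. x * der y - cyc y x)"
    by (rule clinearI) (simp_all add: lin_simps distrib_left cvec.scale_right_diff_distrib)
  show "clinear (\<lambda>y. alg_part (x * der y - cyc y x))"
    by (rule clinearI) (simp_all only: clinear_simps[OF lin] alg_part_simps)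
qed (auto intro!: clinearI simp: lin_simps clinear_simps[OF clinear_bbar] T_word_values bbar_word_form)

text \<open>The component of the homotopy from odd to even degree. For a letter \<open>a\<close> it
  sends the class of \<open>x da\<close> to \<open>hom x * d a\<close>; on longer words the Leibniz
  rule forces the cyclic sum.\<close>

definition H_even where "H_even = form_ext (\<lambda>x y. alg_part (cyc y (unitize_map hom x)))"

text \<open>The trace property is precisely \<open>cyc_mult\<close>.\<close>

lemma trace_like_cyc: "trace_like (\<lambda>x y. alg_part (cyc y (unitize_map hom x)))"
  by (auto simp: trace_like_def cyc_mult lin_simps unitize_map_simps[OF alg_hom_hom] intro!: cbilinearI)

lemma H_even_natd: "H_even (natd x y) = alg_part (cyc y (unitize_map hom x))"
  by (simp add: H_even_def form_ext_natd trace_like_cyc)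

definition homotopy :: "'a tensor_algebra X \<Rightarrow> 'm X"
  where "homotopy \<xi> = (H_even (snd \<xi>), form (fst \<xi>) 1)"

text \<open>The homotopy formula in even degree: the two occurrences of \<open>cyc y 1\<close>
  cancel.\<close>

lemma H_even_boundary: "H_even (natd 1 y) + bbar (form y 1) = alg_part (der y)"
  by (simp add: H_even_natd bbar_form unitize_map_simps[OF alg_hom_hom])

text \<open>For the parameter \<open>1\<close> the cyclic terms of the two products agree, so only
  the cross terms of \<open>form_mult\<close> remain.\<close>

lemma form_commutator:
  "form (commutator y z) 1 = natd' (der y) (incl (hom z)) - natd' (der z) (incl (hom y))"
proof -
  have "clinear (\<lambda>y. form y 1)"
    by (rule clinearI) (simp_all add: lin_simps)
  from clinear_diff[OF this] show ?thesis
    by (simp add: commutator_def form_mult)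
qed

text \<open>The homotopy formula in odd degree; the right side is the product rule for the image of
  the class of \<open>x dy\<close>. The term with \<open>der y\<close> in the coefficient arises
  from the commutator and from \<open>natd'_cyc\<close> with opposite signs.\<close>

lemma H_odd_boundary:
  "form (bbar (natd x y)) 1 + natd 1 (H_even (natd x y))
    = natd (der (alg_part x)) (hom y) + natd (unitize_map hom x) (alg_part (der y))"
  using natd'_cyc[of y "unitize_map hom x"]
  by (simp add: bbar_natd form_commutator H_even_natd unitize_map_simps[OF alg_hom_hom] natd'_def)

lemma clinear_H_even: "clinear H_even"
  by (simp add: H_even_def clinear_form_ext trace_like_cyc)

lemma clinear_homotopy: "clinear homotopy"
  by (rule clinearI) (simp_all add: homotopy_def prod_eq_iff lin_simps clinear_simps[OF clinear_H_even])

section \<open>Adic continuity of the homotopy\<close>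

context
  fixes K :: "'m set"
  assumes K: "alg_ideal K" and d_K: "\<And>a. d a \<in> K"
begin

lemma incl_d_K: "incl (d a) \<in> ideal_pow_plus K (Suc 0)"
  by (simp add: mem_ideal_pow_plus d_K)

lemma ideal_pow_plus_absorb:
  "x \<in> ideal_pow_plus K q \<Longrightarrow> x * y \<in> ideal_pow_plus K q"
  "x \<in> ideal_pow_plus K q \<Longrightarrow> y * x \<in> ideal_pow_plus K q"
  using ideal_pow_plus_mult[OF K, of x q y 0] ideal_pow_plus_mult[OF K, of y 0 x q]
  by (simp_all add: ideal_pow_plus_def)

lemma mult_incl_d_K: "x \<in> ideal_pow_plus K q \<Longrightarrow> x * incl (d a) \<in> ideal_pow_plus K (Suc q)"
  using ideal_pow_plus_mult[OF K _ incl_d_K] by fastforce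

lemma der_K: "der y \<in> ideal_pow_plus K (Suc 0)"
  unfolding der_def
proof (rule T_lift_subspace[OF subspace_ideal_pow_plus[OF K]])
  fix w show "word_der w \<in> ideal_pow_plus K (Suc 0)"
    by (induction w) (auto intro!: cvec.subspace_add cvec.subspace_0 subspace_ideal_pow_plus[OF K]
      intro: ideal_pow_plus_absorb incl_d_K)
qed

text \<open>Every summand of \<open>word_cyc\<close> contains \<open>x\<close> and one value of
  \<open>d\<close>, which lies in \<open>K\<close>. The induction lets \<open>x\<close> vary, as the
  recursion multiplies it by values of \<open>s\<close>.\<close>

lemma cyc_K:
  assumes "x \<in> ideal_pow_plus K q"
  shows "cyc y x \<in> ideal_pow_plus K (Suc q)"
  unfolding cyc_def
proof (rule T_lift_subspace[OF subspace_ideal_pow_plus[OF K]])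
  fix w show "word_cyc w x \<in> ideal_pow_plus K (Suc q)"
    using assms
    by (induction w arbitrary: x)
      (auto intro!: cvec.subspace_add cvec.subspace_0 subspace_ideal_pow_plus[OF K]
        intro: ideal_pow_plus_absorb mult_incl_d_K)
qed

lemma form_K:
  assumes "x \<in> ideal_pow_plus K q"
  shows "form y x \<in> G_filt K (Suc q)"
  unfolding form_def
proof (rule T_lift_subspace[OF subspace_G_filt])
  fix w show "word_form w x \<in> G_filt K (Suc q)"
    using assms
    by (induction w arbitrary: x)
      (auto intro!: cvec.subspace_add cvec.subspace_0 subspace_G_filt G_filt_natd'
        intro: ideal_pow_plus_absorb mult_incl_d_K)
qed

context
  fixes J
  assumes J: "alg_ideal J" and hom_J: "hom ` J \<subseteq> K"
begin

text \<open>One factor \<open>j\<close> is peeled off with \<open>form_mult\<close>. In the cross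
  term \<open>x\<close> and \<open>der j\<close> give order \<open>q + 1\<close>, but the remaining
  power under the differential loses one order; this term dictates the bound.\<close>

lemma form_ideal_pow:
  assumes "x \<in> ideal_pow_plus K q" "y \<in> ideal_pow J (Suc p)"
  shows "form y x \<in> G_filt K (p + q)"
  using assms
proof (induction p arbitrary: y x q)
  case 0
  then show ?case using form_K[of x q y] G_filt_antimono[OF K, of q "Suc q"] by auto
next
  case (Suc p)
  have lin: "clinear (\<lambda>y. form y x)"
    by (rule clinearI) (simp_all add: lin_simps)
  have "form y x \<in> cspan (G_filt K (Suc p + q))"
  proof (rule clinear_maps_span[OF lin _ Suc.prems(2)[unfolded ideal_pow.simps]])
    fix w assume "w \<in> {j * y | j y. j \<in> J \<and> y \<in> ideal_pow J (Suc p)}"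
    then obtain j y where w: "w = j * y" "j \<in> J" "y \<in> ideal_pow J (Suc p)" by blast
    have j: "incl (hom j) \<in> ideal_pow_plus K (Suc 0)"
      using w(2) hom_J by (auto simp: mem_ideal_pow_plus)
    have hy: "hom y \<in> ideal_pow K (Suc p)"
      using w(3) by (rule alg_hom_ideal_pow[OF alg_hom_hom hom_J])
    then have y: "incl (hom y) \<in> ideal_pow_plus K (Suc p)"
      by (simp add: mem_ideal_pow_plus)
    have "form j (incl (hom y) * x) \<in> G_filt K (Suc p + q)"
      using form_K[OF ideal_pow_plus_mult[OF K y Suc.prems(1)]]
        G_filt_antimono[OF K, of "Suc p + q" "Suc (Suc p + q)"] by auto
    moreover have "form y (x * incl (hom j)) \<in> G_filt K (Suc p + q)"
      using Suc.IH[OF ideal_pow_plus_mult[OF K Suc.prems(1) j] w(3)] by simp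
    moreover have "natd' (x * der j) (incl (hom y)) \<in> G_filt K (Suc p + q)"
      using natd_ideal_pow_G[OF K ideal_pow_plus_mult[OF K Suc.prems(1) der_K] hy]
      by (simp add: natd'_def add.commute)
    ultimately show "form w x \<in> cspan (G_filt K (Suc p + q))"
      unfolding w(1) form_mult
      by (intro cvec.span_base cvec.subspace_add[OF subspace_G_filt])
  qed
  then show ?case by (simp add: cvec.span_eq_iff[THEN iffD2] subspace_G_filt)
qed

text \<open>The odd value loses the order spent in \<open>form_ideal_pow\<close>; the even value
  gains one from \<open>d\<close> and is weakened to what the diagonal filtration asks for.\<close>

lemma homotopy_X_filt:
  assumes "\<xi> \<in> X_filt J (2 * Suc n)"
  shows "homotopy \<xi> \<in> ideal_pow K (Suc n) \<times> G_filt K n"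
proof -
  have "fst \<xi> \<in> ideal_pow J (Suc n)"
    by (rule X_filt_evenD(1)[OF J assms])
  then have "form (fst \<xi>) 1 \<in> G_filt K n"
    using form_ideal_pow[of 1 0 "fst \<xi>" n] by (simp add: ideal_pow_plus_def)
  moreover have "H_even (snd \<xi>) \<in> cspan (ideal_pow K (Suc n))"
  proof (rule clinear_maps_span[OF clinear_H_even])
    show "snd \<xi> \<in> cspan {natd x y | x y. x \<in> ideal_pow_plus J (Suc n)}"
      using X_filt_evenD(2)[OF J assms] by (simp add: G_filt_def)
    fix z assume "z \<in> {natd x y | x y. x \<in> ideal_pow_plus J (Suc n)}"
    then obtain x y where z: "z = natd x y" "x \<in> ideal_pow_plus J (Suc n)" by blast
    have "cyc y (unitize_map hom x) \<in> ideal_pow_plus K (Suc n)"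
      using cyc_K[OF unitize_map_ideal_pow_plus[OF alg_hom_hom hom_J z(2)]]
        ideal_pow_plus_antimono[OF K, of "Suc n" "Suc (Suc n)"] by auto
    then show "H_even z \<in> cspan (ideal_pow K (Suc n))"
      by (auto simp: z(1) H_even_natd mem_ideal_pow_plus intro: cvec.span_base)
  qed
  ultimately show ?thesis
    by (simp add: homotopy_def alg_ideal_span[OF alg_ideal_ideal_pow[OF K]])
qed

end

end

end

section \<open>Integration of the homotopy along a segment of splittings\<close>

text \<open>Polynomial curves in a bare vector space, which carries no topology, together with their formal
  derivatives.\<close>

inductive poly_curve :: "(real \<Rightarrow> 'v::complex_vector) \<Rightarrow> (real \<Rightarrow> 'v) \<Rightarrow> bool" where
  const: "poly_curve (\<lambda>_. v) (\<lambda>_. 0)"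
| times: "poly_curve g g' \<Longrightarrow> poly_curve (\<lambda>t. of_real t *\<^sub>C g t) (\<lambda>t. g t + of_real t *\<^sub>C g' t)"
| plus: "poly_curve g g' \<Longrightarrow> poly_curve k k' \<Longrightarrow> poly_curve (\<lambda>t. g t + k t) (\<lambda>t. g' t + k' t)"

lemma poly_curve_linear:
  assumes "clinear L" "poly_curve g g'"
  shows "poly_curve (\<lambda>t. L (g t)) (\<lambda>t. L (g' t))"
  using assms(2) by induction (auto simp: clinear_simps[OF assms(1)] intro: poly_curve.intros)

text \<open>Induction on the first curve alone; for a constant one the claim is linearity in the
  second.\<close>

lemma poly_curve_bilinear:
  assumes "cbilinear L" "poly_curve g g'" "poly_curve k k'"
  shows "poly_curve (\<lambda>t. L (g t) (k t)) (\<lambda>t. L (g' t) (k t) + L (g t) (k' t))"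
  using assms(2)
proof induction
  case (const v)
  have lin: "clinear (\<lambda>x. L x y)" "clinear (L x)" for x y
    using assms(1) by (auto simp: cbilinear_def)
  from poly_curve_linear[OF lin(2)[of v] assms(3)] show ?case
    by (simp add: clinear_0[OF lin(1)])
next
  case (times g g')
  from poly_curve.times[OF times.IH] show ?case
    by (simp add: cbilinear_simps[OF assms(1)] scaleC_add_right add.assoc)
next
  case (plus g g' h h')
  from poly_curve.plus[OF plus.IH] show ?case
    by (simp add: cbilinear_simps[OF assms(1)] algebra_simps)
qed

lemma poly_curve_sum:
  "(\<And>i. i \<in> I \<Longrightarrow> poly_curve (g i) (g' i)) \<Longrightarrow> poly_curve (\<lambda>t. \<Sum>i\<in>I. g i t) (\<lambda>t. \<Sum>i\<in>I. g' i t)"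
  by (induction I rule: infinite_finite_induct) (auto intro: poly_curve.intros)

lemma clinear_scale: "clinear ((*\<^sub>C) c)"
  by (rule clinearI) (simp_all add: scaleC_add_right mult.commute)

lemma poly_curve_T_lift:
  assumes "\<And>w. poly_curve (\<lambda>t. g t w) (\<lambda>t. g' t w)"
  shows "poly_curve (\<lambda>t. T_lift (g t) y) (\<lambda>t. T_lift (g' t) y)"
  unfolding T_lift_def free_ext_def
  by (intro poly_curve_sum poly_curve_linear[OF clinear_scale] assms)

lemma poly_curve_affine: "poly_curve (\<lambda>t. u + of_real t *\<^sub>C v) (\<lambda>_. v)"
  using poly_curve.plus[OF const[of u] times[OF const[of v]]] by simp

text \<open>For complex values the formal derivative is the true one. Integrability and the
  fundamental theorem of calculus enter through this.\<close>

lemma poly_curve_has_vector_derivative: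
  fixes g :: "real \<Rightarrow> complex"
  shows "poly_curve g g' \<Longrightarrow> (g has_vector_derivative g' t) (at t within S)"
proof (induction rule: poly_curve.induct)
  case (times g g')
  have "((\<lambda>t. complex_of_real t) has_vector_derivative 1) (at t within S)"
    using has_vector_derivative_of_real[OF DERIV_ident] by simp
  from has_vector_derivative_mult[OF this times.IH] show ?case
    by (simp add: add.commute)
qed (auto intro!: derivative_eq_intros)

lemma poly_curve_integrable:
  fixes g :: "real \<Rightarrow> complex"
  assumes "poly_curve g g'"
  shows "g integrable_on {a..b}"
  by (rule integrable_continuous_real, rule continuous_on_vector_derivative,
      rule poly_curve_has_vector_derivative[OF assms])

lemma poly_curve_integral_deriv:
  fixes g :: "real \<Rightarrow> complex"
  assumes "poly_curve g g'"
  shows "integral {0..1} g' = g 1 - g 0"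
  by (rule integral_unique, rule fundamental_theorem_of_calculus)
    (simp_all add: poly_curve_has_vector_derivative[OF assms])

section \<open>The segment joining two linear maps\<close>

locale splitting_pair =
  fixes s0 s1 :: "'a::complex_algebra \<Rightarrow> 'm::complex_algebra"
  assumes linear_s0: "clinear s0" and linear_s1: "clinear s1"
begin

definition path :: "real \<Rightarrow> 'a \<Rightarrow> 'm"
  where "path t a = s0 a + of_real t *\<^sub>C (s1 a - s0 a)"

abbreviation diff where "diff a \<equiv> s1 a - s0 a"

lemma path_0_1: "path 0 = s0" "path 1 = s1"
  by (simp_all add: path_def fun_eq_iff)

text \<open>The deformation is instantiated for all times at once, so its constants, such as
  \<open>hom\<close>, \<open>der\<close> and \<open>homotopy\<close>, take \<open>t\<close> as first
  argument from here on.\<close>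

sublocale deformation "path t" diff for t
  by unfold_locales
    (auto intro!: clinearI simp: path_def clinear_simps[OF linear_s0] clinear_simps[OF linear_s1]
      scaleC_add_right cvec.scale_right_diff_distrib mult.commute)

lemma poly_curve_mult:
  fixes g g' k k' :: "real \<Rightarrow> 'm unitization"
  shows "poly_curve g g' \<Longrightarrow> poly_curve k k' \<Longrightarrow> poly_curve (\<lambda>t. g t * k t) (\<lambda>t. g' t * k t + g t * k' t)"
  by (rule poly_curve_bilinear[OF cbilinear_times])

lemma poly_curve_path: "poly_curve (\<lambda>t. incl (path t a)) (\<lambda>t. incl (diff a))"
  unfolding path_def by (rule poly_curve_linear[OF incl_linear poly_curve_affine])

text \<open>The recursion of \<open>word_der\<close> is the product rule along \<open>path\<close>,
  whose derivative is constantly \<open>diff\<close>.\<close>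

lemma poly_curve_word_hom: "poly_curve (\<lambda>t. word_hom t w) (\<lambda>t. word_der t w)"
  by (induction w) (auto intro: poly_curve.intros poly_curve_mult poly_curve_path)

lemma cbilinear_natd': "cbilinear natd'"
  by (rule cbilinearI) (simp_all add: natd'_simps)

text \<open>Mere existence of a derivative is asserted, as it serves integrability only. The
  parameter is itself a curve because the recursion multiplies it by
  \<open>incl (path t a)\<close>.\<close>

lemma poly_curve_word_cyc:
  "poly_curve x x' \<Longrightarrow> \<exists>g'. poly_curve (\<lambda>t. word_cyc t w (x t)) g'"
proof (induction w arbitrary: x x')
  case (Cons a w)
  obtain g' where "poly_curve (\<lambda>t. word_cyc t w (x t * incl (path t a))) g'"
    using Cons.IH[OF poly_curve_mult[OF Cons.prems poly_curve_path]] by blast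
  from poly_curve.plus[OF poly_curve_mult[OF poly_curve_mult[OF poly_curve_word_hom Cons.prems] const] this]
  show ?case by auto
qed (auto intro: poly_curve.intros)

lemma poly_curve_word_form:
  "poly_curve x x' \<Longrightarrow> \<exists>g'. poly_curve (\<lambda>t. word_form t w (x t)) g'"
proof (induction w arbitrary: x x')
  case (Cons a w)
  obtain g' where "poly_curve (\<lambda>t. word_form t w (x t * incl (path t a))) g'"
    using Cons.IH[OF poly_curve_mult[OF Cons.prems poly_curve_path]] by blast
  from poly_curve.plus[OF poly_curve_bilinear[OF cbilinear_natd' poly_curve_mult[OF Cons.prems const]
      poly_curve_word_hom] this]
  show ?case by auto
qed (auto intro: poly_curve.intros)

lemma incl_hom: "incl (hom t y) = T_lift (word_hom t) y"
  by (rule clinear_eq_T_word[where f = "\<lambda>y. incl (hom t y)"])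
    (auto intro!: clinearI clinear_T_lift multilinear_word_hom
      simp: lin_simps incl_hom_word T_lift_word[OF multilinear_word_hom])

lemma poly_curve_hom: "poly_curve (\<lambda>t. hom t y) (\<lambda>t. alg_part (der t y))"
proof -
  have "poly_curve (\<lambda>t. alg_part (incl (hom t y))) (\<lambda>t. alg_part (der t y))"
    unfolding incl_hom der_def
    by (intro poly_curve_linear[OF clinear_alg_part] poly_curve_T_lift poly_curve_word_hom)
  then show ?thesis by simp
qed

lemma poly_curve_unitize: "poly_curve (\<lambda>t. unitize_map (hom t) x) (\<lambda>t. der t (alg_part x))"
proof -
  have "poly_curve (\<lambda>t. incl (hom t (alg_part x)) + scalar_part x *\<^sub>C 1) (\<lambda>t. der t (alg_part x) + 0)"
    unfolding incl_hom der_def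
    by (intro poly_curve.intros poly_curve_T_lift poly_curve_word_hom)
  moreover have "incl (hom t (alg_part x)) + scalar_part x *\<^sub>C 1 = unitize_map (hom t) x" for t
    by (simp add: unitization_eq_iff unitize_map_def)
  ultimately show ?thesis by simp
qed

lemma T_lift_curve_ex:
  assumes "\<And>w. \<exists>g'. poly_curve (\<lambda>t. g t w) g'"
  shows "\<exists>g'. poly_curve (\<lambda>t. T_lift (g t) y) g'"
proof -
  obtain g' where "\<And>w. poly_curve (\<lambda>t. g t w) (g' w)" using assms by metis
  then have "poly_curve (\<lambda>t. T_lift (g t) y) (\<lambda>t. T_lift (\<lambda>w. g' w t) y)"
    by (rule poly_curve_T_lift)
  then show ?thesis by blast
qed

lemma poly_curve_Pair:
  assumes "poly_curve g g'" "poly_curve k k'"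
  shows "poly_curve (\<lambda>t. (g t, k t)) (\<lambda>t. (g' t, k' t))"
proof -
  have "clinear (\<lambda>x. (x, 0))" "clinear (\<lambda>y. (0, y))"
    by (rule clinearI; simp add: prod_eq_iff)+
  from poly_curve.plus[OF poly_curve_linear[OF this(1) assms(1)] poly_curve_linear[OF this(2) assms(2)]]
  show ?thesis by simp
qed

lemma poly_curve_H_even: "\<exists>g'. poly_curve (\<lambda>t. H_even t \<omega>) g'"
  using one_forms_nat_span[of \<omega>]
proof (induction rule: cvec.span_induct_alt)
  case base
  then show ?case by (auto simp: clinear_0[OF clinear_H_even] intro: poly_curve.intros)
next
  case (step c z \<omega>)
  then obtain x y where z: "z = natd x y" by blast
  obtain g' where "poly_curve (\<lambda>t. T_lift (\<lambda>w. word_cyc t w (unitize_map (hom t) x)) y) g'"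
    using T_lift_curve_ex[where g = "\<lambda>t w. word_cyc t w (unitize_map (hom t) x)",
        OF poly_curve_word_cyc[OF poly_curve_unitize]] by blast
  then have *: "poly_curve (\<lambda>t. H_even t z) (\<lambda>t. alg_part (g' t))"
    unfolding z H_even_natd cyc_def by (rule poly_curve_linear[OF clinear_alg_part])
  obtain k' where "poly_curve (\<lambda>t. H_even t \<omega>) k'" using step by blast
  from poly_curve.plus[OF poly_curve_linear[OF clinear_scale *] this]
  show ?case by (auto simp: clinear_simps[OF clinear_H_even])
qed

lemma poly_curve_homotopy: "\<exists>g'. poly_curve (\<lambda>t. homotopy t \<xi>) g'"
proof -
  obtain g' where "poly_curve (\<lambda>t. H_even t (snd \<xi>)) g'" using poly_curve_H_even by blast
  moreover obtain k' where "poly_curve (\<lambda>t. form t (fst \<xi>) 1) k'"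
    using T_lift_curve_ex[where g = "\<lambda>t w. word_form t w 1", OF poly_curve_word_form[OF const]]
    unfolding form_def by blast
  ultimately have "poly_curve (\<lambda>t. homotopy t \<xi>) (\<lambda>t. (g' t, k' t))"
    unfolding homotopy_def by (rule poly_curve_Pair)
  then show ?thesis by blast
qed

text \<open>On generators the product rule yields the right side of \<open>H_odd_boundary\<close>,
  which is then read backwards.\<close>

lemma poly_curve_form_map:
  "poly_curve (\<lambda>t. form_map (hom t) \<omega>) (\<lambda>t. form t (bbar \<omega>) 1 + natd 1 (H_even t \<omega>))"
  using one_forms_nat_span[of \<omega>]
proof (induction rule: cvec.span_induct_alt)
  case base
  have "form t 0 1 = 0" for t
    using cbilinear_simps(3)[OF cbilinear_form, of t 0 0 1] by simp
  then show ?case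
    by (simp add: clinear_0[OF clinear_form_map[OF alg_hom_hom]] clinear_0[OF clinear_H_even]
        clinear_0[OF clinear_bbar] const)
next
  case (step c z \<omega>)
  then obtain x y where z: "z = natd x y" by blast
  have "poly_curve (\<lambda>t. form_map (hom t) z) (\<lambda>t. form t (bbar z) 1 + natd 1 (H_even t z))"
    using poly_curve_bilinear[OF cbilinear_natd poly_curve_unitize poly_curve_hom, of x y]
    by (simp only: z form_map_natd[OF alg_hom_hom] H_odd_boundary)
  from poly_curve.plus[OF poly_curve_linear[OF clinear_scale this, of c] step.IH]
  show ?case
    by (simp add: clinear_simps[OF clinear_form_map[OF alg_hom_hom]] clinear_simps[OF clinear_H_even]
        clinear_simps[OF clinear_bbar] lin_simps natd_simps scaleC_add_right algebra_simps)
qed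

text \<open>The infinitesimal homotopy formula: the derivative of the induced chain map is
  \<open>homotopy\<close> composed with the boundary on either side.\<close>

lemma poly_curve_X_map:
  "poly_curve (\<lambda>t. X_map (hom t) \<xi>) (\<lambda>t. homotopy t (X_boundary \<xi>) + X_boundary (homotopy t \<xi>))"
  using poly_curve_Pair[OF poly_curve_hom poly_curve_form_map, of "fst \<xi>" "snd \<xi>"]
  by (simp add: X_map_eq homotopy_def X_boundary_def H_even_boundary)

text \<open>The functional is applied before integrating, so that the integrand is complex
  valued.\<close>

definition transgress :: "('m X \<Rightarrow> complex) \<Rightarrow> 'a tensor_algebra X \<Rightarrow> complex"
  where "transgress c \<xi> = integral {0..1} (\<lambda>t. c (homotopy t \<xi>))"

lemma clinear_transgress:
  assumes "clinear c"
  shows "clinear (transgress c)"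
proof (rule clinearI)
  have int: "(\<lambda>t. c (homotopy t \<xi>)) integrable_on {0..1}" for \<xi>
    using poly_curve_homotopy[of \<xi>] poly_curve_integrable[OF poly_curve_linear[OF assms]] by blast
  show "transgress c (\<xi> + \<eta>) = transgress c \<xi> + transgress c \<eta>" for \<xi> \<eta>
    by (simp add: transgress_def clinear_simps[OF clinear_homotopy] clinear_simps[OF assms] integral_add int)
  show "transgress c (a *\<^sub>C \<xi>) = a *\<^sub>C transgress c \<xi>" for a \<xi>
    by (simp add: transgress_def clinear_simps[OF clinear_homotopy] clinear_simps[OF assms])
qed

text \<open>A cocycle kills the summand of \<open>poly_curve_X_map\<close> that ends with the
  boundary; the rest is integrated by the fundamental theorem of calculus.\<close>

lemma transgress_boundary:
  assumes "clinear c" "\<And>\<xi>. c (X_boundary \<xi>) = 0"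
  shows "transgress c (X_boundary \<xi>) = c (X_map (T_ext s1) \<xi>) - c (X_map (T_ext s0) \<xi>)"
  using poly_curve_integral_deriv[OF poly_curve_linear[OF assms(1) poly_curve_X_map[of \<xi>]]]
  by (simp add: transgress_def clinear_simps[OF assms(1)] assms(2) path_0_1)

end

section \<open>Cohomology of pro-complexes\<close>

lemma linear_projection:
  fixes S :: "'v::complex_vector set"
  assumes "cvec.subspace S"
  obtains p :: "'v \<Rightarrow> 'v" where "clinear p" "\<And>x. p x \<in> S" "\<And>x. x \<in> S \<Longrightarrow> p x = x"
proof -
  interpret vector_space_pair "scaleC :: complex \<Rightarrow> 'v \<Rightarrow> 'v" "scaleC :: complex \<Rightarrow> 'v \<Rightarrow> 'v"
    by unfold_locales
  \<comment> \<open>A left inverse of the identity on \<open>S\<close> with range in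
    \<open>S\<close> is a projection onto \<open>S\<close>.\<close>
  have "clinear (\<lambda>x::'v. x)" by (rule clinear_id)
  from linear_exists_left_inverse_on[OF this assms]
  obtain p where "range p \<subseteq> S" "clinear p" "\<And>x. x \<in> S \<Longrightarrow> p x = x"
    by (auto simp: inj_on_def)
  then show ?thesis using that by blast
qed

lemma linear_section:
  fixes g :: "'v::complex_vector \<Rightarrow> 'w::complex_vector"
  assumes "clinear g" "surj g"
  obtains h where "clinear h" "\<And>x. g (h x) = x"
proof -
  interpret vector_space_pair "scaleC :: complex \<Rightarrow> 'v \<Rightarrow> 'v" "scaleC :: complex \<Rightarrow> 'w \<Rightarrow> 'w"
    by unfold_locales
  from linear_surjective_right_inverse[OF assms] show ?thesis
    using that by (auto simp: fun_eq_iff)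
qed

text \<open>The functional \<open>\<tau>\<close> on \<open>S\<close> and zero on \<open>W\<close>
  agree on the intersection, hence glue to a functional on the sum, which is extended by a
  projection.\<close>

lemma linear_extension:
  fixes \<tau> :: "'v::complex_vector \<Rightarrow> complex"
  assumes S: "cvec.subspace S" and W: "cvec.subspace W"
    and add: "\<And>x y. x \<in> S \<Longrightarrow> y \<in> S \<Longrightarrow> \<tau> (x + y) = \<tau> x + \<tau> y"
    and scale: "\<And>c x. x \<in> S \<Longrightarrow> \<tau> (c *\<^sub>C x) = c * \<tau> x"
    and zero: "\<And>x. x \<in> S \<Longrightarrow> x \<in> W \<Longrightarrow> \<tau> x = 0"
  obtains \<rho> where "clinear \<rho>" "\<And>x. x \<in> S \<Longrightarrow> \<rho> x = \<tau> x" "\<And>x. x \<in> W \<Longrightarrow> \<rho> x = 0"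
proof -
  let ?U = "{x + y | x y. x \<in> S \<and> y \<in> W}"
  have U: "cvec.subspace ?U" by (rule cvec.subspace_sums[OF S W])
  \<comment> \<open>\<open>f\<close> picks an \<open>S\<close>-component modulo \<open>W\<close>. It
    need not be linear, but \<open>\<tau>\<close> does not see the choice, by the fact
    \<open>eq\<close>.\<close>
  define f where "f z = (SOME x. x \<in> S \<and> z - x \<in> W)" for z
  have f: "f z \<in> S \<and> z - f z \<in> W" if "z \<in> ?U" for z
  proof -
    from that have "\<exists>x. x \<in> S \<and> z - x \<in> W" by auto
    then show ?thesis unfolding f_def by (rule someI_ex)
  qed
  have eq: "\<tau> (f z) = \<tau> x" if "z \<in> ?U" "x \<in> S" "z - x \<in> W" for z x
  proof -
    have "f z - x \<in> S" using f[OF that(1)] that by (simp add: cvec.subspace_diff S)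
    moreover have "f z - x \<in> W"
      using cvec.subspace_diff[OF W that(3), of "z - f z"] f[OF that(1)] by simp
    ultimately have "\<tau> (f z - x) = 0" by (rule zero)
    then show ?thesis
      using add[of "f z - x" x] \<open>f z - x \<in> S\<close> that(2) by simp
  qed
  obtain p where p: "clinear p" "\<And>x. p x \<in> ?U" "\<And>x. x \<in> ?U \<Longrightarrow> p x = x"
    by (rule linear_projection[OF U]) (rule that)
  define \<rho> where "\<rho> z = \<tau> (f (p z))" for z
  have "clinear \<rho>"
  proof (rule clinearI)
    fix x y c
    have fp: "f (p x) \<in> S" "f (p y) \<in> S" "p x - f (p x) \<in> W" "p y - f (p y) \<in> W"
      using f p(2) by auto
    have "p (x + y) - (f (p x) + f (p y)) \<in> W"
      using cvec.subspace_add[OF W fp(3,4)] by (simp add: clinear_add[OF p(1)] algebra_simps)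
    then have "\<tau> (f (p (x + y))) = \<tau> (f (p x) + f (p y))"
      using fp p(2) by (intro eq) (auto intro: cvec.subspace_add[OF S])
    then show "\<rho> (x + y) = \<rho> x + \<rho> y"
      using fp by (simp add: \<rho>_def add)
    have "p (c *\<^sub>C x) - c *\<^sub>C f (p x) \<in> W"
      using cvec.subspace_scale[OF W fp(3), of c]
      by (simp add: clinear_scaleC[OF p(1)] cvec.scale_right_diff_distrib)
    then have "\<tau> (f (p (c *\<^sub>C x))) = \<tau> (c *\<^sub>C f (p x))"
      using fp p(2) by (intro eq) (auto intro: cvec.subspace_scale[OF S])
    then show "\<rho> (c *\<^sub>C x) = c *\<^sub>C \<rho> x"
      using fp by (simp add: \<rho>_def scale)
  qed
  moreover have "\<rho> x = \<tau> x" if "x \<in> S" for x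
  proof -
    have "x + 0 \<in> ?U" using that cvec.subspace_0[OF W] by blast
    then show ?thesis
      using eq[of x x] that cvec.subspace_0[OF W] by (simp add: \<rho>_def p(3))
  qed
  moreover have "\<rho> x = 0" if "x \<in> W" for x
  proof -
    have "0 + x \<in> ?U" using that cvec.subspace_0[OF S] by blast
    then show ?thesis
      using eq[of x 0] that cvec.subspace_0[OF S] zero[of 0] cvec.subspace_0[OF W]
      by (simp add: \<rho>_def p(3))
  qed
  ultimately show ?thesis using that by blast
qed

text \<open>Shared by the two complexes at issue: a filtration step of the X-complex of
  \<open>M\<close>, completed along \<open>N\<close>, and the whole X-complex of the tensor
  algebra.\<close>

locale pro_complex =
  fixes S :: "'a::complex_algebra X set" and G :: "nat \<Rightarrow> 'a X set"
  assumes subspace_S: "cvec.subspace S"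
    and boundary_S: "\<xi> \<in> S \<Longrightarrow> X_boundary \<xi> \<in> S"
    and boundary_G: "\<xi> \<in> G k \<Longrightarrow> X_boundary \<xi> \<in> G k"
    and antimono_G: "m \<le> k \<Longrightarrow> G k \<subseteq> G m"
begin

lemma cochains_0: "(\<lambda>_. 0) \<in> cochains S G"
  by (simp add: cochains_def)

text \<open>The two functionals may vanish on different steps; the larger index serves both.\<close>

lemma cochains_lincomb:
  assumes "\<tau> \<in> cochains S G" "\<tau>' \<in> cochains S G"
  shows "(\<lambda>\<xi>. a * \<tau> \<xi> + b * \<tau>' \<xi>) \<in> cochains S G"
proof -
  obtain k k' where "\<forall>\<xi>\<in>S \<inter> G k. \<tau> \<xi> = 0" "\<forall>\<xi>\<in>S \<inter> G k'. \<tau>' \<xi> = 0"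
    using assms by (auto simp: cochains_def)
  moreover have "G (max k k') \<subseteq> G k" "G (max k k') \<subseteq> G k'" by (simp_all add: antimono_G)
  ultimately have "\<forall>\<xi>\<in>S \<inter> G (max k k'). a * \<tau> \<xi> + b * \<tau>' \<xi> = 0"
    by (metis IntD1 IntD2 IntI add_0 mult_zero_right subsetD)
  then show ?thesis
    using assms unfolding cochains_def by (simp add: algebra_simps) blast
qed

lemma cobd_lincomb: "cobd S (\<lambda>\<xi>. a * \<tau> \<xi> + b * \<tau>' \<xi>) = (\<lambda>\<xi>. a * cobd S \<tau> \<xi> + b * cobd S \<tau>' \<xi>)"
  by (auto simp: cobd_def)

lemma cocycles_lincomb:
  assumes "\<tau> \<in> cocycles S G" "\<tau>' \<in> cocycles S G"
  shows "(\<lambda>\<xi>. a * \<tau> \<xi> + b * \<tau>' \<xi>) \<in> cocycles S G"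
  using assms cochains_lincomb unfolding cocycles_def by (simp add: cobd_lincomb)

lemma cocycles_0: "(\<lambda>_. 0) \<in> cocycles S G"
  by (simp add: cocycles_def cochains_0 cobd_def fun_eq_iff)

lemma cohom_relI:
  "\<tau> \<in> cocycles S G \<Longrightarrow> \<tau>' \<in> cocycles S G \<Longrightarrow> \<theta> \<in> cochains S G \<Longrightarrow>
    (\<And>\<xi>. \<tau> \<xi> - \<tau>' \<xi> = cobd S \<theta> \<xi>) \<Longrightarrow> (\<tau>, \<tau>') \<in> cohom_rel S G"
  unfolding cohom_rel_def by (auto simp: image_iff fun_eq_iff)

lemma cohom_relE:
  assumes "(\<tau>, \<tau>') \<in> cohom_rel S G"
  obtains \<theta> where "\<tau> \<in> cocycles S G" "\<tau>' \<in> cocycles S G" "\<theta> \<in> cochains S G"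
    "\<And>\<xi>. \<tau> \<xi> - \<tau>' \<xi> = cobd S \<theta> \<xi>"
  using assms unfolding cohom_rel_def by (auto simp: image_iff fun_eq_iff)

lemma cohom_rel_lincomb:
  assumes "(\<tau>1, \<tau>1') \<in> cohom_rel S G" "(\<tau>2, \<tau>2') \<in> cohom_rel S G"
  shows "(\<lambda>\<xi>. a * \<tau>1 \<xi> + b * \<tau>2 \<xi>, \<lambda>\<xi>. a * \<tau>1' \<xi> + b * \<tau>2' \<xi>) \<in> cohom_rel S G"
proof -
  obtain \<theta>1 where 1: "\<tau>1 \<in> cocycles S G" "\<tau>1' \<in> cocycles S G" "\<theta>1 \<in> cochains S G"
    "\<And>\<xi>. \<tau>1 \<xi> - \<tau>1' \<xi> = cobd S \<theta>1 \<xi>" using assms(1) by (rule cohom_relE) blast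
  obtain \<theta>2 where 2: "\<tau>2 \<in> cocycles S G" "\<tau>2' \<in> cocycles S G" "\<theta>2 \<in> cochains S G"
    "\<And>\<xi>. \<tau>2 \<xi> - \<tau>2' \<xi> = cobd S \<theta>2 \<xi>" using assms(2) by (rule cohom_relE) blast
  show ?thesis
  proof (rule cohom_relI[OF cocycles_lincomb[OF 1(1) 2(1)] cocycles_lincomb[OF 1(2) 2(2)]
        cochains_lincomb[OF 1(3) 2(3)]])
    show "a * \<tau>1 \<xi> + b * \<tau>2 \<xi> - (a * \<tau>1' \<xi> + b * \<tau>2' \<xi>) = cobd S (\<lambda>\<xi>. a * \<theta>1 \<xi> + b * \<theta>2 \<xi>) \<xi>" for \<xi>
      by (simp add: cobd_lincomb 1(4)[symmetric] 2(4)[symmetric] algebra_simps)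
  qed
qed

lemma cohom_rel_refl: "\<tau> \<in> cocycles S G \<Longrightarrow> (\<tau>, \<tau>) \<in> cohom_rel S G"
  by (rule cohom_relI[OF _ _ cochains_0]) (simp_all add: cobd_def)

lemma cohom_rel_sym:
  assumes "(\<tau>, \<tau>') \<in> cohom_rel S G"
  shows "(\<tau>', \<tau>) \<in> cohom_rel S G"
proof -
  obtain \<theta> where \<theta>: "\<tau> \<in> cocycles S G" "\<tau>' \<in> cocycles S G" "\<theta> \<in> cochains S G"
    "\<And>\<xi>. \<tau> \<xi> - \<tau>' \<xi> = cobd S \<theta> \<xi>" using assms by (rule cohom_relE) blast
  have "\<tau>' \<xi> - \<tau> \<xi> = cobd S (\<lambda>\<xi>. (-1) * \<theta> \<xi> + 0 * \<theta> \<xi>) \<xi>" for \<xi>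
    unfolding cobd_lincomb \<theta>(4)[symmetric] by simp
  from cohom_relI[OF \<theta>(2,1) cochains_lincomb[OF \<theta>(3,3)] this] show ?thesis .
qed

lemma cohom_rel_trans:
  assumes "(\<tau>1, \<tau>2) \<in> cohom_rel S G" "(\<tau>2, \<tau>3) \<in> cohom_rel S G"
  shows "(\<tau>1, \<tau>3) \<in> cohom_rel S G"
proof -
  obtain \<theta>1 where 1: "\<tau>1 \<in> cocycles S G" "\<tau>2 \<in> cocycles S G" "\<theta>1 \<in> cochains S G"
    "\<And>\<xi>. \<tau>1 \<xi> - \<tau>2 \<xi> = cobd S \<theta>1 \<xi>" using assms(1) by (rule cohom_relE) blast
  obtain \<theta>2 where 2: "\<tau>2 \<in> cocycles S G" "\<tau>3 \<in> cocycles S G" "\<theta>2 \<in> cochains S G"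
    "\<And>\<xi>. \<tau>2 \<xi> - \<tau>3 \<xi> = cobd S \<theta>2 \<xi>" using assms(2) by (rule cohom_relE) blast
  have "\<tau>1 \<xi> - \<tau>3 \<xi> = cobd S (\<lambda>\<xi>. 1 * \<theta>1 \<xi> + 1 * \<theta>2 \<xi>) \<xi>" for \<xi>
    unfolding cobd_lincomb 1(4)[symmetric] 2(4)[symmetric] by simp
  from cohom_relI[OF 1(1) 2(2) cochains_lincomb[OF 1(3) 2(3)] this] show ?thesis .
qed

lemma mem_coh_class: "\<tau>' \<in> coh_class S G \<tau> \<longleftrightarrow> (\<tau>, \<tau>') \<in> cohom_rel S G"
  by (simp add: coh_class_def)

lemma coh_class_self: "\<tau> \<in> cocycles S G \<Longrightarrow> \<tau> \<in> coh_class S G \<tau>"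
  by (simp add: mem_coh_class cohom_rel_refl)

lemma coh_class_eqI: "(\<tau>, \<tau>') \<in> cohom_rel S G \<Longrightarrow> coh_class S G \<tau> = coh_class S G \<tau>'"
  by (intro set_eqI) (metis mem_coh_class cohom_rel_sym cohom_rel_trans)

lemma mem_cohomE:
  assumes "c \<in> cohom S G"
  obtains \<tau> where "\<tau> \<in> cocycles S G" "c = coh_class S G \<tau>"
  using assms by (auto simp: cohom_def quotient_def coh_class_def)

lemma coh_class_cohom: "\<tau> \<in> cocycles S G \<Longrightarrow> coh_class S G \<tau> \<in> cohom S G"
  by (auto simp: cohom_def quotient_def coh_class_def)

text \<open>The union defining \<open>coh_add\<close> runs over a nonempty family of equal
  classes.\<close>

lemma coh_add_class:
  assumes "\<tau> \<in> cocycles S G" "\<tau>' \<in> cocycles S G"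
  shows "coh_add S G (coh_class S G \<tau>) (coh_class S G \<tau>') = coh_class S G (\<lambda>\<xi>. \<tau> \<xi> + \<tau>' \<xi>)"
proof -
  have "coh_class S G (\<lambda>\<xi>. \<alpha> \<xi> + \<alpha>' \<xi>) = coh_class S G (\<lambda>\<xi>. \<tau> \<xi> + \<tau>' \<xi>)"
    if "\<alpha> \<in> coh_class S G \<tau>" "\<alpha>' \<in> coh_class S G \<tau>'" for \<alpha> \<alpha>'
    using that cohom_rel_lincomb[of \<alpha> \<tau> \<alpha>' \<tau>' 1 1]
    by (intro coh_class_eqI) (simp add: mem_coh_class cohom_rel_sym)
  then have "coh_add S G (coh_class S G \<tau>) (coh_class S G \<tau>')
      = (\<Union>\<alpha>\<in>coh_class S G \<tau>. \<Union>\<alpha>'\<in>coh_class S G \<tau>'. coh_class S G (\<lambda>\<xi>. \<tau> \<xi> + \<tau>' \<xi>))"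
    unfolding coh_add_def by (intro SUP_cong refl)
  with coh_class_self show ?thesis using assms by auto
qed

lemma coh_scale_class:
  assumes "\<tau> \<in> cocycles S G"
  shows "coh_scale S G a (coh_class S G \<tau>) = coh_class S G (\<lambda>\<xi>. a * \<tau> \<xi>)"
proof -
  have "coh_class S G (\<lambda>\<xi>. a * \<alpha> \<xi>) = coh_class S G (\<lambda>\<xi>. a * \<tau> \<xi>)"
    if "\<alpha> \<in> coh_class S G \<tau>" for \<alpha>
    using that cohom_rel_lincomb[of \<alpha> \<tau> \<alpha> \<tau> a 0]
    by (intro coh_class_eqI) (simp add: mem_coh_class cohom_rel_sym)
  then have "coh_scale S G a (coh_class S G \<tau>) = (\<Union>\<alpha>\<in>coh_class S G \<tau>. coh_class S G (\<lambda>\<xi>. a * \<tau> \<xi>))"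
    unfolding coh_scale_def by (intro SUP_cong refl)
  with coh_class_self show ?thesis using assms by auto
qed

end

lemma cochains_UNIV: "\<rho> \<in> cochains UNIV G \<longleftrightarrow> clinear \<rho> \<and> (\<exists>k. \<forall>\<xi>\<in>G k. \<rho> \<xi> = 0)"
  by (simp add: cochains_def Vector_Spaces.linear_iff cvec.vector_space_axioms)

lemma cobd_UNIV: "cobd UNIV \<rho> = (\<lambda>\<xi>. \<rho> (X_boundary \<xi>))"
  by (simp add: cobd_def)

lemma pro_complex_X_filt: "alg_ideal R \<Longrightarrow> alg_ideal N \<Longrightarrow> pro_complex (X_filt R n) (X_filt N)"
  by unfold_locales (auto intro: subspace_X_filt X_boundary_X_filt dest: X_filt_antimono)

lemma pro_complex_UNIV_X_filt: "alg_ideal N \<Longrightarrow> pro_complex UNIV (X_filt N)"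
  by unfold_locales (auto intro: X_boundary_X_filt dest: X_filt_antimono)

text \<open>Both sides send a word to the same product. For a splitting this identifies the
  projection after \<open>T_ext\<close> with the multiplication map.\<close>

lemma T_ext_compose:
  assumes "alg_hom p" "clinear s"
  shows "p (T_ext s y) = T_ext (\<lambda>a. p (s a)) y"
proof -
  have lin: "clinear (\<lambda>a. p (s a))"
    by (rule clinearI) (simp_all add: clinear_simps[OF assms(2)] clinear_simps[OF alg_hom_linear[OF assms(1)]])
  have "p (word_prod s w) = word_prod (\<lambda>a. p (s a)) w" if "w \<noteq> []" for w
    using that
  proof (induction w rule: list_nonempty_induct)
    case (cons a w)
    then show ?case by (cases w) (simp_all add: alg_hom_mult[OF assms(1)])
  qed simp
  note word = this
  show ?thesis
    by (rule clinear_eq_T_word[where f = "\<lambda>y. p (T_ext s y)"])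
      (auto intro!: clinearI simp: word T_ext_word assms(2) lin Rep_word_nonempty
        clinear_simps[OF alg_hom_linear[OF assms(1)]]
        clinear_simps[OF alg_hom_linear[OF alg_hom_T_ext[OF assms(2)]]]
        clinear_simps[OF alg_hom_linear[OF alg_hom_T_ext[OF lin]]])
qed

lemma alg_ideal_T_kernel: "alg_ideal T_kernel"
  unfolding T_kernel_def by (intro alg_ideal_kernel alg_hom_T_ext clinear_id)

section \<open>Renormalization\<close>

lemma cochains_pullback:
  assumes "alg_hom f" "\<And>m. \<exists>k. X_map f ` G k \<subseteq> G' m" "\<rho> \<in> cochains UNIV G'"
  shows "\<rho> \<circ> X_map f \<in> cochains UNIV G"
proof -
  from assms(3) obtain m where \<rho>: "clinear \<rho>" "\<forall>\<xi>\<in>G' m. \<rho> \<xi> = 0" by (auto simp: cochains_UNIV)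
  obtain k where "X_map f ` G k \<subseteq> G' m" using assms(2) by blast
  then have "\<forall>\<xi>\<in>G k. (\<rho> \<circ> X_map f) \<xi> = 0" using \<rho>(2) by auto
  moreover have "clinear (\<rho> \<circ> X_map f)"
    by (rule clinearI) (simp_all add: clinear_simps[OF \<rho>(1)] clinear_simps[OF clinear_X_map[OF assms(1)]])
  ultimately show ?thesis by (auto simp: cochains_UNIV)
qed

text \<open>Formally a coboundary, but the cochain on the right need not be continuous:
  \<open>\<rho>\<close> vanishes on an \<open>N\<close>-adic step, whereas the kernel of
  multiplication is only mapped into the sum of \<open>R\<close> and \<open>N\<close>.\<close>

lemma renormalized_pullback_eq:
  "alg_hom (T_ext \<sigma>) \<Longrightarrow> renormalized_pullback \<sigma> \<rho> = cobd UNIV (\<rho> \<circ> X_map (T_ext \<sigma>))"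
  by (simp add: renormalized_pullback_def cobd_UNIV fun_eq_iff X_map_boundary)

definition X_proj :: "bit \<Rightarrow> 'a::complex_algebra X \<Rightarrow> 'a X"
  where "X_proj i \<xi> = (if i = 0 then (fst \<xi>, 0) else (0, snd \<xi>))"

lemma clinear_X_proj: "clinear (X_proj i)"
  by (rule clinearI) (simp_all add: X_proj_def prod_eq_iff)

lemma X_proj_in_X_filt:
  assumes "alg_ideal J" "\<xi> \<in> X_filt J k"
  shows "X_proj i \<xi> \<in> X_filt J k"
proof -
  obtain S T where "X_filt J k = S \<times> T" by (rule X_filt_Times)
  then show ?thesis
    using cvec.subspace_0[OF subspace_X_filt[OF assms(1), of k]] assms(2)
    unfolding X_proj_def by (simp add: mem_Times_iff)
qed

lemma X_proj_part: "X_proj (i + 1) \<xi> \<in> X_part (i + 1)" "X_proj i \<xi> + X_proj (i + 1) \<xi> = \<xi>"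
proof -
  consider "i = 0" "i + 1 = 1" | "i = 1" "i + 1 = 0" by (cases i rule: bit.exhaust) auto
  then show "X_proj (i + 1) \<xi> \<in> X_part (i + 1)" "X_proj i \<xi> + X_proj (i + 1) \<xi> = \<xi>"
    by cases (simp_all only: X_proj_def X_part_def, auto)
qed

lemma X_proj_boundary: "\<xi> \<in> X_part i \<Longrightarrow> X_proj i (X_boundary \<xi>) = 0"
  by (auto simp: X_proj_def X_part_def X_boundary_def prod_eq_iff clinear_0[OF clinear_bbar] split: if_splits)

lemma X_map_X_part:
  "\<xi> \<in> X_part i \<Longrightarrow> alg_hom f \<Longrightarrow> X_map f \<xi> \<in> X_part i"
  by (auto simp: X_part_def X_map_eq clinear_0[OF alg_hom_linear] clinear_0[OF clinear_form_map] split: if_splits)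

text \<open>Everything the construction takes from the lifting diagram: two ideals and a projection
  whose kernel is their sum.\<close>

locale renormalization =
  fixes R N :: "'m::complex_algebra set" and \<pi> :: "'m \<Rightarrow> 'a::complex_algebra"
  assumes ideal_R: "alg_ideal R" and ideal_N: "alg_ideal N" and hom_\<pi>: "alg_hom \<pi>"
    and ker_\<pi>: "{x. \<pi> x = 0} = ideal_sum R N"
begin

abbreviation FR where "FR \<equiv> X_filt R"
abbreviation FN where "FN \<equiv> X_filt N"
abbreviation FT :: "nat \<Rightarrow> 'a tensor_algebra X set" where "FT \<equiv> X_filt T_kernel"

sublocale F: pro_complex "FR n" FN for n
  by (rule pro_complex_X_filt[OF ideal_R ideal_N])

sublocale T: pro_complex UNIV FT
  by (rule pro_complex_UNIV_X_filt[OF alg_ideal_T_kernel])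

lemma T_ext_kernel:
  assumes "linear_splitting \<pi> \<sigma>"
  shows "T_ext \<sigma> ` T_kernel \<subseteq> ideal_sum R N"
proof -
  have "\<pi> (T_ext \<sigma> y) = T_ext (\<lambda>a. a) y" for y
    using assms by (simp add: T_ext_compose[OF hom_\<pi>] linear_splitting_def)
  then show ?thesis by (auto simp: ker_\<pi>[symmetric] T_kernel_def)
qed

lemma ideal_K: "alg_ideal (ideal_sum R N)"
  by (rule alg_ideal_sum[OF ideal_R ideal_N])

lemma splitting_alg_hom: "linear_splitting \<pi> \<sigma> \<Longrightarrow> alg_hom (T_ext \<sigma>)"
  by (simp add: linear_splitting_def alg_hom_T_ext)

lemma X_map_X_tilde:
  assumes "linear_splitting \<pi> \<sigma>"
  shows "\<exists>k. X_map (T_ext \<sigma>) ` FT k \<subseteq> X_tilde R N m"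
proof (intro exI subsetI)
  \<comment> \<open>The even step with half index \<open>2 * m + 2\<close> provides the order that
    \<open>mem_X_tilde\<close> asks for in even degree.\<close>
  fix \<eta> assume "\<eta> \<in> X_map (T_ext \<sigma>) ` FT (2 * (2 * m + 2))"
  then have "\<eta> \<in> ideal_pow (ideal_sum R N) (2 * m + 2) \<times> G_filt (ideal_sum R N) (2 * m + 2)"
    using X_map_X_filt[OF splitting_alg_hom[OF assms] T_ext_kernel[OF assms] alg_ideal_T_kernel] by blast
  then show "\<eta> \<in> X_tilde R N m"
    using mem_X_tilde[OF ideal_R ideal_N, of "fst \<eta>" m "snd \<eta>"]
      G_filt_antimono[OF ideal_K, of "2 * m" "2 * m + 2"] by auto
qed

text \<open>Vanishing on one step of each filtration is vanishing on a diagonal step, by taking the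
  larger index.\<close>

lemma cochains_X_tilde:
  assumes "clinear \<delta>" "\<And>\<xi>. \<xi> \<in> FR n \<Longrightarrow> \<delta> \<xi> = 0" "\<And>\<xi>. \<xi> \<in> FN k \<Longrightarrow> \<delta> \<xi> = 0"
  shows "\<delta> \<in> cochains UNIV (X_tilde R N)"
proof -
  have "\<delta> \<xi> = 0" if \<xi>: "\<xi> \<in> X_tilde R N (max n k)" for \<xi>
  proof -
    obtain \<alpha> \<beta> where "\<xi> = \<alpha> + \<beta>" "\<alpha> \<in> FR (max n k)" "\<beta> \<in> FN (max n k)"
      using \<xi> unfolding X_tilde_def by blast
    then show ?thesis
      using assms(2)[of \<alpha>] assms(3)[of \<beta>] X_filt_antimono[OF ideal_R, of n "max n k"]
        X_filt_antimono[OF ideal_N, of k "max n k"]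
      by (metis (no_types, lifting) add_0 clinear_add[OF assms(1)] max.cobounded1 max.cobounded2 subsetD)
  qed
  then show ?thesis using assms(1) unfolding cochains_UNIV by blast
qed

lemma renormalizationD:
  assumes "\<rho> \<in> renormalizations R N n \<tau>"
  obtains k where "clinear \<rho>" "\<And>\<xi>. \<xi> \<in> FR n \<Longrightarrow> \<rho> \<xi> = \<tau> \<xi>" "\<And>\<xi>. \<xi> \<in> FN k \<Longrightarrow> \<rho> \<xi> = 0"
  using assms by (auto simp: renormalizations_def cochains_UNIV)

lemma renormalizationI:
  assumes "clinear \<rho>" "\<And>\<xi>. \<xi> \<in> FR n \<Longrightarrow> \<rho> \<xi> = \<tau> \<xi>" "\<And>\<xi>. \<xi> \<in> FN k \<Longrightarrow> \<rho> \<xi> = 0"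
  shows "\<rho> \<in> renormalizations R N n \<tau>"
  using assms unfolding renormalizations_def cochains_UNIV by blast

lemma renormalization_ex:
  assumes "\<tau> \<in> cochains (FR n) FN"
  obtains \<rho> where "\<rho> \<in> renormalizations R N n \<tau>"
proof -
  obtain k where "\<forall>\<xi>\<in>FR n \<inter> FN k. \<tau> \<xi> = 0" using assms by (auto simp: cochains_def)
  then obtain \<rho> where "clinear \<rho>" "\<And>x. x \<in> FR n \<Longrightarrow> \<rho> x = \<tau> x" "\<And>x. x \<in> FN k \<Longrightarrow> \<rho> x = 0"
    using linear_extension[OF subspace_X_filt[OF ideal_R] subspace_X_filt[OF ideal_N], of n \<tau> k] assms
    unfolding cochains_def by blast
  then show ?thesis using that renormalizationI by blast
qed

lemma cocycle_boundary: "\<tau> \<in> cocycles (FR n) FN \<Longrightarrow> \<xi> \<in> FR n \<Longrightarrow> \<tau> (X_boundary \<xi>) = 0"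
  unfolding cocycles_def cobd_def fun_eq_iff by (metis (mono_tags, lifting) mem_Collect_eq)

text \<open>On \<open>FR n\<close> the functional \<open>\<rho>\<close> agrees with the cocycle
  \<open>\<tau>\<close>, and \<open>FR n\<close> is stable under the boundary; on
  \<open>FN k\<close> already \<open>\<rho>\<close> vanishes.\<close>

lemma cobd_renormalization:
  assumes "\<tau> \<in> cocycles (FR n) FN" "\<rho> \<in> renormalizations R N n \<tau>"
  shows "cobd UNIV \<rho> \<in> cochains UNIV (X_tilde R N)" "cobd UNIV \<rho> \<in> cocycles UNIV (X_tilde R N)"
proof -
  obtain k where \<rho>: "clinear \<rho>" "\<And>\<xi>. \<xi> \<in> FR n \<Longrightarrow> \<rho> \<xi> = \<tau> \<xi>" "\<And>\<xi>. \<xi> \<in> FN k \<Longrightarrow> \<rho> \<xi> = 0"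
    using renormalizationD[OF assms(2)] by blast
  have "clinear (cobd UNIV \<rho>)"
    by (rule clinearI) (simp_all add: cobd_UNIV clinear_simps[OF \<rho>(1)] clinear_simps[OF clinear_X_boundary])
  then show "cobd UNIV \<rho> \<in> cochains UNIV (X_tilde R N)"
    by (rule cochains_X_tilde[of _ n k])
      (simp_all add: cobd_UNIV \<rho> F.boundary_S F.boundary_G cocycle_boundary[OF assms(1)])
  then show "cobd UNIV \<rho> \<in> cocycles UNIV (X_tilde R N)"
    by (simp add: cocycles_def cobd_UNIV clinear_0[OF \<rho>(1)])
qed

lemma renormalized_pullback_cocycle:
  assumes "linear_splitting \<pi> \<sigma>" "\<tau> \<in> cocycles (FR n) FN" "\<rho> \<in> renormalizations R N n \<tau>"
  shows "renormalized_pullback \<sigma> \<rho> \<in> cocycles UNIV FT"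
proof -
  note hom = splitting_alg_hom[OF assms(1)]
  have "renormalized_pullback \<sigma> \<rho> \<in> cochains UNIV FT"
    unfolding renormalized_pullback_def
    by (rule cochains_pullback[OF hom X_map_X_tilde[OF assms(1)] cobd_renormalization(1)[OF assms(2,3)]])
  moreover have "\<rho> 0 = 0"
    using renormalizationD[OF assms(3)] clinear_0 by metis
  ultimately show ?thesis
    by (simp add: cocycles_def cobd_UNIV renormalized_pullback_def X_map_boundary[OF hom])
qed

lemma renormalized_pullback_cong:
  assumes \<sigma>: "linear_splitting \<pi> \<sigma>" and rel: "(\<tau>, \<tau>') \<in> cohom_rel (FR n) FN"
    and \<rho>: "\<rho> \<in> renormalizations R N n \<tau>" and \<rho>': "\<rho>' \<in> renormalizations R N n \<tau>'"
  shows "(renormalized_pullback \<sigma> \<rho>, renormalized_pullback \<sigma> \<rho>') \<in> cohom_rel UNIV FT"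
proof -
  note hom = splitting_alg_hom[OF \<sigma>]
  obtain \<theta> where \<theta>: "\<tau> \<in> cocycles (FR n) FN" "\<tau>' \<in> cocycles (FR n) FN" "\<theta> \<in> cochains (FR n) FN"
    "\<And>\<xi>. \<tau> \<xi> - \<tau>' \<xi> = cobd (FR n) \<theta> \<xi>" using rel by (rule F.cohom_relE) blast
  obtain \<mu> where \<mu>: "\<mu> \<in> renormalizations R N n \<theta>" by (rule renormalization_ex[OF \<theta>(3)])
  obtain k1 where 1: "clinear \<rho>" "\<And>\<xi>. \<xi> \<in> FR n \<Longrightarrow> \<rho> \<xi> = \<tau> \<xi>" "\<And>\<xi>. \<xi> \<in> FN k1 \<Longrightarrow> \<rho> \<xi> = 0"
    using renormalizationD[OF \<rho>] by blast
  obtain k2 where 2: "clinear \<rho>'" "\<And>\<xi>. \<xi> \<in> FR n \<Longrightarrow> \<rho>' \<xi> = \<tau>' \<xi>" "\<And>\<xi>. \<xi> \<in> FN k2 \<Longrightarrow> \<rho>' \<xi> = 0"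
    using renormalizationD[OF \<rho>'] by blast
  obtain k3 where 3: "clinear \<mu>" "\<And>\<xi>. \<xi> \<in> FR n \<Longrightarrow> \<mu> \<xi> = \<theta> \<xi>" "\<And>\<xi>. \<xi> \<in> FN k3 \<Longrightarrow> \<mu> \<xi> = 0"
    using renormalizationD[OF \<mu>] by blast
  define k where "k = max k1 (max k2 k3)"
  have sub: "FN k \<subseteq> FN k1" "FN k \<subseteq> FN k2" "FN k \<subseteq> FN k3"
    by (simp_all add: k_def X_filt_antimono[OF ideal_N])
  \<comment> \<open>Here \<open>\<mu>\<close> renormalizes the cochain \<open>\<theta>\<close>
    relating the cocycles, so \<open>\<delta>\<close> vanishes on \<open>FR n\<close>. Its
    coboundary is the difference of those of \<open>\<rho>\<close> and \<open>\<rho>'\<close>, as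
    the boundary squares to zero.\<close>
  define \<delta> where "\<delta> \<xi> = \<rho> \<xi> - \<rho>' \<xi> - \<mu> (X_boundary \<xi>)" for \<xi>
  have "clinear \<delta>"
    by (rule clinearI) (simp_all add: \<delta>_def clinear_simps[OF 1(1)] clinear_simps[OF 2(1)]
        clinear_simps[OF 3(1)] clinear_simps[OF clinear_X_boundary] algebra_simps)
  then have \<delta>: "\<delta> \<in> cochains UNIV (X_tilde R N)"
  proof (rule cochains_X_tilde[of _ n k])
    fix \<xi> assume "\<xi> \<in> FR n"
    then show "\<delta> \<xi> = 0"
      using \<theta>(4)[of \<xi>] by (simp add: \<delta>_def 1 2 3 cobd_def F.boundary_S)
  next
    fix \<xi> assume "\<xi> \<in> FN k"
    then have "\<rho> \<xi> = 0" "\<rho>' \<xi> = 0" "\<mu> (X_boundary \<xi>) = 0"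
      using sub 1(3) 2(3) 3(3) F.boundary_G[of \<xi> k3] by blast+
    then show "\<delta> \<xi> = 0" by (simp add: \<delta>_def)
  qed
  show ?thesis
  proof (rule T.cohom_relI[OF renormalized_pullback_cocycle[OF \<sigma> \<theta>(1) \<rho>]
        renormalized_pullback_cocycle[OF \<sigma> \<theta>(2) \<rho>'] cochains_pullback[OF hom X_map_X_tilde[OF \<sigma>] \<delta>]])
    show "renormalized_pullback \<sigma> \<rho> \<xi> - renormalized_pullback \<sigma> \<rho>' \<xi> = cobd UNIV (\<delta> \<circ> X_map (T_ext \<sigma>)) \<xi>" for \<xi>
      by (simp add: renormalized_pullback_def cobd_UNIV X_map_boundary[OF hom] \<delta>_def clinear_0[OF 3(1)])
  qed
qed

lemma E_map_class:
  assumes "linear_splitting \<pi> \<sigma>" "\<tau> \<in> cocycles (FR n) FN" "\<rho> \<in> renormalizations R N n \<tau>"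
  shows "E_map R N \<sigma> n (coh_class (FR n) FN \<tau>) = HP_class (renormalized_pullback \<sigma> \<rho>)"
proof -
  have "HP_class (renormalized_pullback \<sigma> \<rho>') = HP_class (renormalized_pullback \<sigma> \<rho>)"
    if "\<tau>' \<in> coh_class (FR n) FN \<tau>" "\<rho>' \<in> renormalizations R N n \<tau>'" for \<tau>' \<rho>'
    using that assms(3)
    by (intro T.coh_class_eqI renormalized_pullback_cong[OF assms(1)])
      (auto simp: F.mem_coh_class intro: F.cohom_rel_sym)
  moreover have "\<tau> \<in> coh_class (FR n) FN \<tau>" by (rule F.coh_class_self[OF assms(2)])
  ultimately show ?thesis
    using assms(3) unfolding E_map_def by blast
qed

lemma E_map_classE:
  assumes "linear_splitting \<pi> \<sigma>" "c \<in> cohom (FR n) FN"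
  obtains \<tau> \<rho> where "\<tau> \<in> cocycles (FR n) FN" "c = coh_class (FR n) FN \<tau>"
    "\<rho> \<in> renormalizations R N n \<tau>" "E_map R N \<sigma> n c = HP_class (renormalized_pullback \<sigma> \<rho>)"
    "renormalized_pullback \<sigma> \<rho> \<in> cocycles UNIV FT"
proof -
  obtain \<tau> where \<tau>: "\<tau> \<in> cocycles (FR n) FN" "c = coh_class (FR n) FN \<tau>"
    by (rule F.mem_cohomE[OF assms(2)])
  then have "\<tau> \<in> cochains (FR n) FN" by (simp add: cocycles_def)
  then obtain \<rho> where \<rho>: "\<rho> \<in> renormalizations R N n \<tau>" by (rule renormalization_ex)
  from that[OF \<tau> \<rho>] E_map_class[OF assms(1) \<tau>(1) \<rho>]
    renormalized_pullback_cocycle[OF assms(1) \<tau>(1) \<rho>] \<tau>(2) show ?thesis by simp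
qed

lemma renormalization_lincomb:
  assumes "\<rho> \<in> renormalizations R N n \<tau>" "\<rho>' \<in> renormalizations R N n \<tau>'"
  shows "(\<lambda>\<xi>. a * \<rho> \<xi> + b * \<rho>' \<xi>) \<in> renormalizations R N n (\<lambda>\<xi>. a * \<tau> \<xi> + b * \<tau>' \<xi>)"
proof -
  obtain k1 where 1: "clinear \<rho>" "\<And>\<xi>. \<xi> \<in> FR n \<Longrightarrow> \<rho> \<xi> = \<tau> \<xi>" "\<And>\<xi>. \<xi> \<in> FN k1 \<Longrightarrow> \<rho> \<xi> = 0"
    using renormalizationD[OF assms(1)] by blast
  obtain k2 where 2: "clinear \<rho>'" "\<And>\<xi>. \<xi> \<in> FR n \<Longrightarrow> \<rho>' \<xi> = \<tau>' \<xi>" "\<And>\<xi>. \<xi> \<in> FN k2 \<Longrightarrow> \<rho>' \<xi> = 0"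
    using renormalizationD[OF assms(2)] by blast
  have sub: "FN (max k1 k2) \<subseteq> FN k1" "FN (max k1 k2) \<subseteq> FN k2"
    by (simp_all add: X_filt_antimono[OF ideal_N])
  show ?thesis
  proof (rule renormalizationI[of _ _ _ "max k1 k2"])
    show "clinear (\<lambda>\<xi>. a * \<rho> \<xi> + b * \<rho>' \<xi>)"
      by (rule clinearI) (simp_all add: clinear_simps[OF 1(1)] clinear_simps[OF 2(1)] algebra_simps)
    show "a * \<rho> \<xi> + b * \<rho>' \<xi> = 0" if "\<xi> \<in> FN (max k1 k2)" for \<xi>
      using 1(3)[OF subsetD[OF sub(1) that]] 2(3)[OF subsetD[OF sub(2) that]] by simp
  qed (simp add: 1 2)
qed

lemma coh_linear_E_map:
  assumes \<sigma>: "linear_splitting \<pi> \<sigma>"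
  shows "coh_linear (FR n) FN UNIV FT (E_map R N \<sigma> n)"
  unfolding coh_linear_def
proof (intro conjI ballI allI)
  fix c assume c: "c \<in> cohom (FR n) FN"
  obtain \<tau> \<rho> where \<tau>: "\<tau> \<in> cocycles (FR n) FN" "c = coh_class (FR n) FN \<tau>"
    "\<rho> \<in> renormalizations R N n \<tau>" "E_map R N \<sigma> n c = HP_class (renormalized_pullback \<sigma> \<rho>)"
    "renormalized_pullback \<sigma> \<rho> \<in> cocycles UNIV FT"
    by (rule E_map_classE[OF \<sigma> c])
  show "E_map R N \<sigma> n c \<in> cohom UNIV FT"
    by (simp add: \<tau>(4,5) T.coh_class_cohom)
  show "E_map R N \<sigma> n (coh_scale (FR n) FN a c) = coh_scale UNIV FT a (E_map R N \<sigma> n c)" for a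
    using E_map_class[OF \<sigma> F.cocycles_lincomb[OF \<tau>(1,1), of a 0] renormalization_lincomb[OF \<tau>(3,3), of a 0]]
    by (simp add: \<tau>(4) T.coh_scale_class[OF \<tau>(5)]) (simp add: \<tau>(2) F.coh_scale_class[OF \<tau>(1)]
        renormalized_pullback_def comp_def cobd_UNIV)
  fix c' assume c': "c' \<in> cohom (FR n) FN"
  obtain \<tau>' \<rho>' where \<tau>': "\<tau>' \<in> cocycles (FR n) FN" "c' = coh_class (FR n) FN \<tau>'"
    "\<rho>' \<in> renormalizations R N n \<tau>'" "E_map R N \<sigma> n c' = HP_class (renormalized_pullback \<sigma> \<rho>')"
    "renormalized_pullback \<sigma> \<rho>' \<in> cocycles UNIV FT"
    by (rule E_map_classE[OF \<sigma> c'])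
  show "E_map R N \<sigma> n (coh_add (FR n) FN c c') = coh_add UNIV FT (E_map R N \<sigma> n c) (E_map R N \<sigma> n c')"
    using E_map_class[OF \<sigma> F.cocycles_lincomb[OF \<tau>(1) \<tau>'(1), of 1 1] renormalization_lincomb[OF \<tau>(3) \<tau>'(3), of 1 1]]
    by (simp add: \<tau>(4) \<tau>'(4) T.coh_add_class[OF \<tau>(5) \<tau>'(5)])
      (simp add: \<tau>(2) \<tau>'(2) F.coh_add_class[OF \<tau>(1) \<tau>'(1)] renormalized_pullback_def comp_def cobd_UNIV)
qed

lemma E_map_degree:
  assumes \<sigma>: "linear_splitting \<pi> \<sigma>" and c: "c \<in> cohom_deg i (FR n) FN"
  shows "E_map R N \<sigma> n c \<in> HP_deg (i + 1)"
proof -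
  note hom = splitting_alg_hom[OF \<sigma>]
  obtain \<tau> where \<tau>: "\<tau> \<in> cocycles (FR n) FN" "homogeneous i \<tau>" "c = coh_class (FR n) FN \<tau>"
    using c by (auto simp: cohom_deg_def)
  then have \<tau>_cochain: "\<tau> \<in> cochains (FR n) FN" by (simp add: cocycles_def)
  obtain \<rho> where \<rho>: "\<rho> \<in> renormalizations R N n \<tau>" by (rule renormalization_ex[OF \<tau>_cochain])
  obtain k where 1: "clinear \<rho>" "\<And>\<xi>. \<xi> \<in> FR n \<Longrightarrow> \<rho> \<xi> = \<tau> \<xi>" "\<And>\<xi>. \<xi> \<in> FN k \<Longrightarrow> \<rho> \<xi> = 0"
    using renormalizationD[OF \<rho>] by blast
  \<comment> \<open>A renormalization need not be homogeneous. Composing with the projection to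
    degree \<open>i\<close> gives one that is, and the class does not depend on which is
    used.\<close>
  define \<rho>' where "\<rho>' \<xi> = \<rho> (X_proj i \<xi>)" for \<xi>
  have \<rho>': "\<rho>' \<in> renormalizations R N n \<tau>"
  proof (rule renormalizationI[of _ _ _ k])
    show "clinear \<rho>'"
      by (rule clinearI) (simp_all add: \<rho>'_def clinear_simps[OF 1(1)] clinear_simps[OF clinear_X_proj])
    show "\<rho>' \<xi> = 0" if "\<xi> \<in> FN k" for \<xi>
      using that by (simp add: \<rho>'_def 1(3) X_proj_in_X_filt[OF ideal_N])
    show "\<rho>' \<xi> = \<tau> \<xi>" if "\<xi> \<in> FR n" for \<xi>
    proof -
      have "\<tau> (X_proj (i + 1) \<xi>) = 0"
        using \<tau>(2) X_proj_part(1) unfolding homogeneous_def by blast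
      moreover have "\<rho> \<xi> = \<rho> (X_proj i \<xi>) + \<rho> (X_proj (i + 1) \<xi>)"
        by (metis X_proj_part(2) clinear_add[OF 1(1)])
      ultimately show ?thesis
        using that by (simp add: \<rho>'_def 1(2) X_proj_in_X_filt[OF ideal_R])
    qed
  qed
  \<comment> \<open>Homogeneity of degree \<open>i + 1\<close> means vanishing on the part of degree
    \<open>i\<close>, whose boundary has no component of degree \<open>i\<close>.\<close>
  have "i + 1 + 1 = i" by (cases i) simp_all
  then have "homogeneous (i + 1) (renormalized_pullback \<sigma> \<rho>')"
    using X_proj_boundary[OF X_map_X_part[OF _ hom]]
    by (simp add: homogeneous_def renormalized_pullback_def cobd_UNIV \<rho>'_def clinear_0[OF 1(1)])
  then show ?thesis
    using E_map_class[OF \<sigma> \<tau>(1) \<rho>'] renormalized_pullback_cocycle[OF \<sigma> \<tau>(1) \<rho>']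
    by (auto simp: \<tau>(3) cohom_deg_def)
qed

section \<open>Independence of the splitting, vanishing and restriction\<close>

lemma renormalized_pullback_splitting:
  assumes \<sigma>: "linear_splitting \<pi> \<sigma>" and \<sigma>': "linear_splitting \<pi> \<sigma>'"
    and \<tau>: "\<tau> \<in> cocycles (FR n) FN" and \<rho>: "\<rho> \<in> renormalizations R N n \<tau>"
  shows "(renormalized_pullback \<sigma>' \<rho>, renormalized_pullback \<sigma> \<rho>) \<in> cohom_rel UNIV FT"
proof -
  interpret P: splitting_pair \<sigma> \<sigma>'
    by (rule splitting_pair.intro) (use \<sigma> \<sigma>' in \<open>auto simp: linear_splitting_def\<close>)
  let ?c = "cobd UNIV \<rho>" and ?K = "ideal_sum R N"
  obtain m where c: "clinear ?c" "\<forall>\<xi>\<in>X_tilde R N m. ?c \<xi> = 0"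
    using cobd_renormalization(1)[OF \<tau> \<rho>] by (auto simp: cochains_UNIV)
  have \<pi>: "\<pi> (\<sigma> a) = a" "\<pi> (\<sigma>' a) = a" for a
    using \<sigma> \<sigma>' by (simp_all add: linear_splitting_def)
  note lin_\<pi> = clinear_simps[OF alg_hom_linear[OF hom_\<pi>]]
  \<comment> \<open>Every point of the segment is a splitting, so the kernel of multiplication stays
    under control for all \<open>t\<close>.\<close>
  have "linear_splitting \<pi> (P.path t)" for t
    using P.linear_s by (simp add: linear_splitting_def P.path_def lin_\<pi> \<pi>)
  then have hom_K: "T_ext (P.path t) ` T_kernel \<subseteq> ?K" for t by (rule T_ext_kernel)
  have "\<pi> (P.diff a) = 0" for a by (simp add: lin_\<pi> \<pi>)
  then have diff: "P.diff a \<in> ?K" for a using ker_\<pi> by blast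
  have "P.transgress ?c \<in> cochains UNIV FT"
  proof -
    \<comment> \<open>The filtration step does not depend on \<open>t\<close>, so the integrand
      vanishes identically. The index yields order \<open>2 * m + 2\<close> in even degree, as in
      \<open>mem_X_tilde\<close>.\<close>
    have "P.transgress ?c \<xi> = 0" if "\<xi> \<in> FT (2 * Suc (2 * m + 1))" for \<xi>
    proof -
      have "P.homotopy t \<xi> \<in> X_tilde R N m" for t
        using P.homotopy_X_filt[OF ideal_K diff alg_ideal_T_kernel hom_K that, of t]
          mem_X_tilde[OF ideal_R ideal_N, of "fst (P.homotopy t \<xi>)" m "snd (P.homotopy t \<xi>)"]
          G_filt_antimono[OF ideal_K, of "2 * m" "2 * m + 1"] by (auto simp: mem_Times_iff)
      then show ?thesis using c(2) by (simp add: P.transgress_def)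
    qed
    then show ?thesis
      using P.clinear_transgress[OF c(1)] unfolding cochains_UNIV by blast
  qed
  \<comment> \<open>This gives the cocycle condition for \<open>?c\<close>, whose value on a
    boundary is \<open>\<rho>\<close> at a double boundary.\<close>
  moreover have "\<rho> 0 = 0"
    using renormalizationD[OF \<rho>] clinear_0 by metis
  then have "renormalized_pullback \<sigma>' \<rho> \<xi> - renormalized_pullback \<sigma> \<rho> \<xi> = cobd UNIV (P.transgress ?c) \<xi>" for \<xi>
    using P.transgress_boundary[OF c(1), of \<xi>] by (simp add: cobd_UNIV renormalized_pullback_def)
  ultimately show ?thesis
    by (rule T.cohom_relI[OF renormalized_pullback_cocycle[OF \<sigma>' \<tau> \<rho>] renormalized_pullback_cocycle[OF \<sigma> \<tau> \<rho>]])
qed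

lemma E_map_splitting:
  assumes \<sigma>: "linear_splitting \<pi> \<sigma>" and \<sigma>': "linear_splitting \<pi> \<sigma>'" and c: "c \<in> cohom (FR n) FN"
  shows "E_map R N \<sigma>' n c = E_map R N \<sigma> n c"
proof -
  obtain \<tau> \<rho> where \<tau>: "\<tau> \<in> cocycles (FR n) FN" "c = coh_class (FR n) FN \<tau>"
    "\<rho> \<in> renormalizations R N n \<tau>" "E_map R N \<sigma> n c = HP_class (renormalized_pullback \<sigma> \<rho>)"
    "renormalized_pullback \<sigma> \<rho> \<in> cocycles UNIV FT"
    by (rule E_map_classE[OF \<sigma> c])
  show ?thesis
    using E_map_class[OF \<sigma>' \<tau>(1,3)] T.coh_class_eqI[OF renormalized_pullback_splitting[OF \<sigma> \<sigma>' \<tau>(1,3)]]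
    by (simp add: \<tau>(4) \<tau>(2)[symmetric])
qed

lemma E_map_zero:
  assumes \<sigma>: "linear_splitting \<pi> \<sigma>" and N: "T_ext \<sigma> ` T_kernel \<subseteq> N" and c: "c \<in> cohom (FR n) FN"
  shows "E_map R N \<sigma> n c = coh_zero UNIV FT"
proof -
  note hom = splitting_alg_hom[OF \<sigma>]
  obtain \<tau> \<rho> where \<tau>: "\<tau> \<in> cocycles (FR n) FN" "c = coh_class (FR n) FN \<tau>"
    "\<rho> \<in> renormalizations R N n \<tau>" "E_map R N \<sigma> n c = HP_class (renormalized_pullback \<sigma> \<rho>)"
    "renormalized_pullback \<sigma> \<rho> \<in> cocycles UNIV FT"
    by (rule E_map_classE[OF \<sigma> c])
  have "\<exists>k. X_map (T_ext \<sigma>) ` FT k \<subseteq> FN m" for m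
  proof (intro exI subsetI)
    \<comment> \<open>One extra order makes up for the commutators forgotten in
      \<open>X_map_X_filt\<close>.\<close>
    fix \<eta> assume "\<eta> \<in> X_map (T_ext \<sigma>) ` FT (2 * Suc m)"
    then have "\<eta> \<in> ideal_pow N (Suc m) \<times> G_filt N (Suc m)"
      using X_map_X_filt[OF hom N alg_ideal_T_kernel] by blast
    then have "\<eta> \<in> FN (2 * m)"
      using X_filt_evenI[of "fst \<eta>" N m "snd \<eta>"] G_filt_antimono[OF ideal_N, of m "Suc m"] by auto
    then show "\<eta> \<in> FN m" using X_filt_antimono[OF ideal_N, of m "2 * m"] by auto
  qed
  moreover have "\<rho> \<in> cochains UNIV FN" using \<tau>(3) by (simp add: renormalizations_def)
  ultimately have "\<rho> \<circ> X_map (T_ext \<sigma>) \<in> cochains UNIV FT" by (rule cochains_pullback[OF hom])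
  then have "(renormalized_pullback \<sigma> \<rho>, \<lambda>_. 0) \<in> cohom_rel UNIV FT"
    by (rule T.cohom_relI[OF \<tau>(5) T.cocycles_0]) (simp add: renormalized_pullback_eq[OF hom])
  then show ?thesis
    by (simp add: \<tau>(4) coh_zero_def T.coh_class_eqI)
qed

text \<open>A renormalization of a cocycle also renormalizes its restriction, so both sides are
  represented by the same pullback.\<close>

lemma E_map_restrict:
  assumes \<sigma>: "linear_splitting \<pi> \<sigma>" and c: "c \<in> cohom (FR n) FN"
  shows "coh_restrict (FR (n + 1)) FN c \<in> cohom (FR (n + 1)) FN"
    and "E_map R N \<sigma> (n + 1) (coh_restrict (FR (n + 1)) FN c) = E_map R N \<sigma> n c"
proof -
  define res :: "('m X \<Rightarrow> complex) \<Rightarrow> 'm X \<Rightarrow> complex"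
    where "res \<tau> = (\<lambda>\<xi>. if \<xi> \<in> FR (n + 1) then \<tau> \<xi> else 0)" for \<tau>
  have sub: "FR (n + 1) \<subseteq> FR n" by (rule X_filt_antimono[OF ideal_R]) simp
  have res_cochain: "res \<tau> \<in> cochains (FR (n + 1)) FN" if "\<tau> \<in> cochains (FR n) FN" for \<tau>
    using that sub cvec.subspace_add[OF subspace_X_filt[OF ideal_R]]
      cvec.subspace_scale[OF subspace_X_filt[OF ideal_R]]
    unfolding cochains_def res_def by (simp add: subset_eq) blast
  have cobd_res: "cobd (FR (n + 1)) (res \<tau>) = res (cobd (FR n) \<tau>)" for \<tau>
    using sub F.boundary_S by (auto simp: cobd_def res_def fun_eq_iff)
  have res_cocycle: "res \<tau> \<in> cocycles (FR (n + 1)) FN" if "\<tau> \<in> cocycles (FR n) FN" for \<tau>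
    using that res_cochain[of \<tau>] cobd_res[of \<tau>] unfolding cocycles_def by (simp add: res_def)
  have res_rel: "(res \<tau>, res \<tau>') \<in> cohom_rel (FR (n + 1)) FN" if rel: "(\<tau>, \<tau>') \<in> cohom_rel (FR n) FN" for \<tau> \<tau>'
  proof -
    obtain \<theta> where \<theta>: "\<tau> \<in> cocycles (FR n) FN" "\<tau>' \<in> cocycles (FR n) FN" "\<theta> \<in> cochains (FR n) FN"
      "\<And>\<xi>. \<tau> \<xi> - \<tau>' \<xi> = cobd (FR n) \<theta> \<xi>" using rel by (rule F.cohom_relE) blast
    have "res \<tau> \<xi> - res \<tau>' \<xi> = cobd (FR (n + 1)) (res \<theta>) \<xi>" for \<xi>
      unfolding cobd_res by (simp add: \<theta>(4)[symmetric] res_def)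
    from F.cohom_relI[OF res_cocycle[OF \<theta>(1)] res_cocycle[OF \<theta>(2)] res_cochain[OF \<theta>(3)] this] show ?thesis .
  qed
  obtain \<tau> \<rho> where \<tau>: "\<tau> \<in> cocycles (FR n) FN" "c = coh_class (FR n) FN \<tau>"
    "\<rho> \<in> renormalizations R N n \<tau>" "E_map R N \<sigma> n c = HP_class (renormalized_pullback \<sigma> \<rho>)"
    "renormalized_pullback \<sigma> \<rho> \<in> cocycles UNIV FT"
    by (rule E_map_classE[OF \<sigma> c])
  have "coh_class (FR (n + 1)) FN (res \<alpha>) = coh_class (FR (n + 1)) FN (res \<tau>)" if "\<alpha> \<in> c" for \<alpha>
    using that \<tau>(2) F.cohom_rel_sym by (intro F.coh_class_eqI res_rel) (simp add: F.mem_coh_class)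
  then have "coh_restrict (FR (n + 1)) FN c = (\<Union>\<alpha>\<in>c. coh_class (FR (n + 1)) FN (res \<tau>))"
    unfolding coh_restrict_def res_def[symmetric] by (intro SUP_cong refl)
  also have "\<dots> = coh_class (FR (n + 1)) FN (res \<tau>)"
    using F.coh_class_self[OF \<tau>(1)] \<tau>(2) by auto
  finally have r: "coh_restrict (FR (n + 1)) FN c = coh_class (FR (n + 1)) FN (res \<tau>)" .
  show "coh_restrict (FR (n + 1)) FN c \<in> cohom (FR (n + 1)) FN"
    unfolding r by (rule F.coh_class_cohom[OF res_cocycle[OF \<tau>(1)]])
  have "\<rho> \<in> renormalizations R N (n + 1) (res \<tau>)"
    using \<tau>(3) sub by (auto simp: renormalizations_def res_def)
  from E_map_class[OF \<sigma> res_cocycle[OF \<tau>(1)] this]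
  show "E_map R N \<sigma> (n + 1) (coh_restrict (FR (n + 1)) FN c) = E_map R N \<sigma> n c"
    unfolding r \<tau>(4) .
qed

end

section \<open>Application to the lifting diagram\<close>

theorem proposition2p3:
  fixes j_n :: "'j::complex_algebra \<Rightarrow> 'n::complex_algebra"
    and n_q :: "'n \<Rightarrow> 'q::complex_algebra"
    and r_m :: "'r::complex_algebra \<Rightarrow> 'm::complex_algebra"
    and m_p :: "'m \<Rightarrow> 'p::complex_algebra"
    and b_e :: "'b::complex_algebra \<Rightarrow> 'e::complex_algebra"
    and e_a :: "'e \<Rightarrow> 'a::complex_algebra"
    and j_r :: "'j \<Rightarrow> 'r" and r_b :: "'r \<Rightarrow> 'b"
    and n_m :: "'n \<Rightarrow> 'm" and m_e :: "'m \<Rightarrow> 'e"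
    and q_p :: "'q \<Rightarrow> 'p" and p_a :: "'p \<Rightarrow> 'a"
    and R N :: "'m set"
    and \<sigma> :: "'a \<Rightarrow> 'm"
    and n :: nat
  assumes "lifting j_n n_q r_m m_p b_e e_a j_r r_b n_m m_e q_p p_a"
    and "R = range r_m" and "N = range n_m"
    and "n \<ge> 1"
    and "linear_splitting (e_a \<circ> m_e) \<sigma>"
  shows
    "pro_chain_map (X_filt T_kernel) (X_tilde R N) (X_map (T_ext \<sigma>)) \<and>
     (\<forall>\<tau> \<in> cocycles (X_filt R n) (X_filt N).
        renormalizations R N n \<tau> \<noteq> {} \<and>
        (\<forall>\<rho> \<in> renormalizations R N n \<tau>.
           cobd UNIV \<rho> \<in> cocycles UNIV (X_tilde R N) \<and>
           renormalized_pullback \<sigma> \<rho> \<in> cocycles UNIV (X_filt T_kernel) \<and>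
           E_map R N \<sigma> n (coh_class (X_filt R n) (X_filt N) \<tau>)
             = HP_class (renormalized_pullback \<sigma> \<rho>))) \<and>
     coh_linear (X_filt R n) (X_filt N) UNIV (X_filt T_kernel) (E_map R N \<sigma> n) \<and>
     (\<forall>i. \<forall>c \<in> cohom_deg i (X_filt R n) (X_filt N). E_map R N \<sigma> n c \<in> HP_deg (i + 1)) \<and>
     (\<forall>\<sigma>'. linear_splitting (e_a \<circ> m_e) \<sigma>' \<longrightarrow>
        (\<forall>c \<in> cohom (X_filt R n) (X_filt N). E_map R N \<sigma>' n c = E_map R N \<sigma> n c)) \<and>
     ((\<exists>s. alg_hom s \<and> (\<forall>a. e_a (s a) = a)) \<longrightarrow>
        (\<forall>c \<in> cohom (X_filt R n) (X_filt N).
           E_map R N \<sigma> n c = coh_zero UNIV (X_filt T_kernel))) \<and>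
     (\<forall>c \<in> cohom (X_filt R n) (X_filt N).
        coh_restrict (X_filt R (n + 1)) (X_filt N) c \<in> cohom (X_filt R (n + 1)) (X_filt N) \<and>
        E_map R N \<sigma> (n + 1) (coh_restrict (X_filt R (n + 1)) (X_filt N) c)
          = E_map R N \<sigma> n c)"
proof -
  have ext: "extension r_m m_p" "extension b_e e_a" "extension j_r r_b" "extension n_m m_e"
    and comm: "b_e (r_b x) = m_e (r_m x)" for x
    using assms(1) by (auto simp: lifting_def fun_eq_iff)
  have R: "R = {x. m_p x = 0}" "alg_hom m_p" and N: "N = {x. m_e x = 0}" "alg_hom m_e" "surj m_e"
    and B: "range b_e = {x. e_a x = 0}" "alg_hom e_a" and r_b: "surj r_b"
    using ext assms(2,3) by (simp_all add: extension_def)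
  note lin_m_e = clinear_simps[OF alg_hom_linear[OF N(2)]]
  interpret renormalization R N "e_a \<circ> m_e"
  proof
    show "alg_ideal R" "alg_ideal N"
      unfolding R(1) N(1) by (rule alg_ideal_kernel R(2) N(2))+
    have "clinear (e_a \<circ> m_e)"
      by (rule clinearI) (simp_all add: lin_m_e clinear_simps[OF alg_hom_linear[OF B(2)]])
    then show "alg_hom (e_a \<circ> m_e)"
      using N(2) B(2) by (simp add: alg_hom_def)
    \<comment> \<open>Diagram chase: the image of \<open>x\<close> in \<open>E\<close> comes from
      \<open>B\<close>, hence from some \<open>r\<close> in \<open>R\<close> along the surjection
      \<open>r_b\<close>; subtracting \<open>r\<close> leaves an element killed by
      \<open>m_e\<close>, that is, of \<open>N\<close>.\<close>
    have "x \<in> ideal_sum R N" if x: "e_a (m_e x) = 0" for x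
    proof -
      have "m_e x \<in> range b_e" using x B(1) by simp
      then obtain b where "m_e x = b_e b" by blast
      moreover obtain r where "b = r_b r" using surjD[OF r_b] by blast
      ultimately have "m_e (x - r_m r) = 0" using comm[of r] by (simp add: lin_m_e(5))
      then have "x - r_m r \<in> N" unfolding N(1) by simp
      moreover have "r_m r \<in> R" unfolding assms(2) by simp
      ultimately show ?thesis using ideal_sum_memI[of "r_m r" R "x - r_m r" N] by simp
    qed
    moreover have "e_a (m_e x) = 0" if K: "x \<in> ideal_sum R N" for x
    proof -
      obtain r m where x: "x = r_m r + m" "m_e m = 0"
        using K by (auto simp: ideal_sum_def assms(2) N(1))
      have "m_e x = b_e (r_b r)" by (simp add: x lin_m_e comm)
      then show ?thesis using B(1) by auto
    qed
    ultimately show "{x. (e_a \<circ> m_e) x = 0} = ideal_sum R N" by auto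
  qed
  note \<sigma> = assms(5)
  note hom = splitting_alg_hom[OF \<sigma>]
  have "pro_chain_map (X_filt T_kernel) (X_tilde R N) (X_map (T_ext \<sigma>))"
    unfolding pro_chain_map_def
    using clinear_X_map[OF hom] X_map_boundary[OF hom] X_map_X_tilde[OF \<sigma>] by simp
  moreover have "renormalizations R N n \<tau> \<noteq> {}" if "\<tau> \<in> cocycles (X_filt R n) (X_filt N)" for \<tau>
    using that renormalization_ex[of \<tau> n] by (auto simp: cocycles_def)
  moreover have "E_map R N \<sigma> n c = coh_zero UNIV (X_filt T_kernel)"
    if split: "\<exists>s. alg_hom s \<and> (\<forall>a. e_a (s a) = a)" and c: "c \<in> cohom (X_filt R n) (X_filt N)" for c
  proof -
    obtain s where s: "alg_hom s" "\<And>a. e_a (s a) = a" using split by blast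
    obtain h where h: "clinear h" "\<And>x. m_e (h x) = x"
      by (rule linear_section[OF alg_hom_linear[OF N(2)] N(3)]) (rule that)
    define \<sigma>' where "\<sigma>' a = h (s a)" for a
    have \<sigma>': "linear_splitting (e_a \<circ> m_e) \<sigma>'"
      by (auto simp: linear_splitting_def \<sigma>'_def h(2) s(2) clinear_simps[OF h(1)]
          clinear_simps[OF alg_hom_linear[OF s(1)]] intro!: clinearI)
    \<comment> \<open>Since \<open>s\<close> is multiplicative, the homomorphism induced by
      \<open>\<sigma>'\<close> covers \<open>s\<close> after multiplication, and so maps the kernel
      of multiplication into \<open>N\<close>.\<close>
    then have "m_e (T_ext \<sigma>' y) = s (T_ext (\<lambda>a. a) y)" for y
      by (simp add: T_ext_compose[OF N(2)] T_ext_compose[OF s(1) clinear_id] linear_splitting_def \<sigma>'_def h(2))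
    then have "T_ext \<sigma>' ` T_kernel \<subseteq> N"
      by (auto simp: N(1) T_kernel_def clinear_0[OF alg_hom_linear[OF s(1)]])
    from E_map_zero[OF \<sigma>' this c] show ?thesis
      by (simp add: E_map_splitting[OF \<sigma> \<sigma>' c])
  qed
  ultimately show ?thesis
    using cobd_renormalization(2) renormalized_pullback_cocycle[OF \<sigma>] E_map_class[OF \<sigma>]
      coh_linear_E_map[OF \<sigma>] E_map_degree[OF \<sigma>] E_map_splitting[OF \<sigma>] E_map_restrict[OF \<sigma>]
    by (intro conjI ballI allI impI) blast+
qed

end
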